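(* Let $f$ be a smooth diffeomorphism of a compact $d$-dimensional Riemannian manifold $M$ preserving a smooth probability measure $\mu$, and suppose that $f$ is $r$-fold exponentially mixing for Lipschitz observables for all $r\ge2$. Let $\gamma(x)=\lim_{\rho\to0}\rho^{-d}\mu(B(x,\rho))$ and let $\tau>0$. Let $x$ be distributed according to $\mu$. Then the number of visits of $\{f^k(x)\}_{k\in[1,\tau\rho^{-d}]}$ to $B(x,\rho)$ converges in law, as $\rho\to0$, to a mixture of Poisson distributions; namely, for each integer $l\ge0$, $$\lim_{\rho\to0}\mu\Big(x:\mathrm{Card}\{1\le n\le\tau\rho^{-d}:d(x,f^nx)\le\rho\}=l\Big)=\int_Me^{-\gamma(z)\tau}\frac{(\gamma(z)\tau)^l}{l!}\,d\mu(z).$$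
   Context: Smooth measure: a measure with smooth positive density with respect to Riemannian volume. For $p\ge1$, $(f,M,\mu)$ is $(p+1)$-fold exponentially mixing for Lipschitz observables if there are $C>0$ and $\theta<1$ such that for every Lipschitz $A:M^{p+1}\to\mathbb R$ and all integers $0=k_0\le k_1\le\dots\le k_p$ with $k_{j+1}-k_j\ge m$ for all $0\le j\le p-1$, $$\Big|\int_MA(x,f^{k_1}x,\dots,f^{k_p}x)\,d\mu(x)-\int_{M^{p+1}}A(x_0,\dots,x_p)\,d\mu(x_0)\cdots d\mu(x_p)\Big|\le C\theta^m\|A\|_{\mathrm{Lip}}.$$ $B(x,\rho)$ is the Riemannian ball and $d(\cdot,\cdot)$ the Riemannian distance. *)

theory Defs
  imports "HOL-Probability.Probability"
begin

section \<open>Smooth functions on open subsets of Euclidean space\<close>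

primrec Ck_on :: "nat \<Rightarrow> ('a::real_normed_vector \<Rightarrow> 'b::real_normed_vector) \<Rightarrow> 'a set \<Rightarrow> bool" where
  "Ck_on 0 f S \<longleftrightarrow> continuous_on S f"
| "Ck_on (Suc k) f S \<longleftrightarrow>
     (\<forall>x\<in>S. f differentiable at x) \<and> (\<forall>v. Ck_on k (\<lambda>x. frechet_derivative f (at x) v) S)"

definition smooth_on :: "'a::real_normed_vector set \<Rightarrow> ('a \<Rightarrow> 'b::real_normed_vector) \<Rightarrow> bool" where
  "smooth_on S f \<longleftrightarrow> (\<forall>k. Ck_on k f S)"

section \<open>Smooth manifolds\<close>

text \<open>
  A manifold is a type \<^typ>\<open>'a\<close>, Hausdorff and second countable by its sort in the theorem, with a smooth
  atlas. The dimension is \<^term>\<open>CARD('n)\<close>. A chart is a pair of a domain and a coordinate map; the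
  values of the coordinate map outside the domain are irrelevant.
\<close>

type_synonym ('a, 'n) chart = "'a set \<times> ('a \<Rightarrow> real ^ 'n)"

definition is_chart :: "('a::topological_space, 'n::finite) chart \<Rightarrow> bool" where
  "is_chart c \<longleftrightarrow> (case c of (U, \<phi>) \<Rightarrow>
     open U \<and> open (\<phi> ` U) \<and> inj_on \<phi> U \<and> homeomorphism U (\<phi> ` U) \<phi> (inv_into U \<phi>))"

definition smooth_atlas :: "('a::topological_space, 'n::finite) chart set \<Rightarrow> bool" where
  "smooth_atlas \<A> \<longleftrightarrow>
     (\<forall>c\<in>\<A>. is_chart c) \<and> (\<Union>c\<in>\<A>. fst c) = UNIV \<and>
     (\<forall>(U, \<phi>)\<in>\<A>. \<forall>(V, \<psi>)\<in>\<A>. smooth_on (\<phi> ` (U \<inter> V)) (\<psi> \<circ> inv_into U \<phi>))"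

definition smooth_fun :: "('a::topological_space, 'n::finite) chart set \<Rightarrow> ('a \<Rightarrow> real) \<Rightarrow> bool" where
  "smooth_fun \<A> h \<longleftrightarrow> (\<forall>(U, \<phi>)\<in>\<A>. smooth_on (\<phi> ` U) (h \<circ> inv_into U \<phi>))"

definition smooth_map :: "('a::topological_space, 'n::finite) chart set \<Rightarrow> ('a \<Rightarrow> 'a) \<Rightarrow> bool" where
  "smooth_map \<A> f \<longleftrightarrow> continuous_on UNIV f \<and>
     (\<forall>(U, \<phi>)\<in>\<A>. \<forall>(V, \<psi>)\<in>\<A>. smooth_on (\<phi> ` (U \<inter> f -` V)) (\<psi> \<circ> f \<circ> inv_into U \<phi>))"

definition smooth_diffeo :: "('a::topological_space, 'n::finite) chart set \<Rightarrow> ('a \<Rightarrow> 'a) \<Rightarrow> bool" where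
  "smooth_diffeo \<A> f \<longleftrightarrow> bij f \<and> smooth_map \<A> f \<and> smooth_map \<A> (inv f)"

section \<open>Riemannian metric, distance and volume\<close>

text \<open>
  A Riemannian metric is given by its component matrices: \<^term>\<open>g c p\<close> is the Gram matrix at \<^term>\<open>p\<close>
  of the coordinate frame of the chart \<^term>\<open>c\<close>, meaningful for \<^term>\<open>p\<close> in the domain of \<^term>\<open>c\<close>.
  The last clause is the transformation law of a covariant 2-tensor.
\<close>

type_synonym ('a, 'n) metric_components = "('a, 'n) chart \<Rightarrow> 'a \<Rightarrow> real ^ 'n ^ 'n"

definition riemannian_metric ::
    "('a::topological_space, 'n::finite) chart set \<Rightarrow> ('a, 'n) metric_components \<Rightarrow> bool" where
  "riemannian_metric \<A> g \<longleftrightarrow>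
     (\<forall>(U, \<phi>)\<in>\<A>. smooth_on (\<phi> ` U) (g (U, \<phi>) \<circ> inv_into U \<phi>) \<and>
        (\<forall>p\<in>U. transpose (g (U, \<phi>) p) = g (U, \<phi>) p \<and>
           (\<forall>v. v \<noteq> 0 \<longrightarrow> 0 < v \<bullet> (g (U, \<phi>) p *v v)))) \<and>
     (\<forall>(U, \<phi>)\<in>\<A>. \<forall>(V, \<psi>)\<in>\<A>. \<forall>p\<in>U \<inter> V.
        let J = jacobian (\<psi> \<circ> inv_into U \<phi>) (at (\<phi> p))
        in g (U, \<phi>) p = transpose J ** g (V, \<psi>) p ** J)"

definition riemannian_manifold ::
    "('a::topological_space, 'n::finite) chart set \<Rightarrow> ('a, 'n) metric_components \<Rightarrow> bool" where
  "riemannian_manifold \<A> g \<longleftrightarrow> smooth_atlas \<A> \<and> riemannian_metric \<A> g"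

text \<open>
  The library notion of piecewise \<open>C\<^sup>1\<close> does not bound the velocity near the finitely many
  exceptional times, so a curve may have infinite length; this does not affect the infimum.
\<close>

definition piecewise_C1_curve ::
    "('a::topological_space, 'n::finite) chart set \<Rightarrow> (real \<Rightarrow> 'a) \<Rightarrow> bool" where
  "piecewise_C1_curve \<A> \<sigma> \<longleftrightarrow> path \<sigma> \<and>
     (\<forall>(U, \<phi>)\<in>\<A>. \<forall>a b. {a..b} \<subseteq> {0..1} \<and> \<sigma> ` {a..b} \<subseteq> U \<longrightarrow>
        (\<phi> \<circ> \<sigma>) piecewise_C1_differentiable_on {a..b})"

text \<open>By the transformation law the speed does not depend on the chart that is chosen.\<close>

definition curve_speed ::
    "('a::topological_space, 'n::finite) chart set \<Rightarrow> ('a, 'n) metric_components \<Rightarrow>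
     (real \<Rightarrow> 'a) \<Rightarrow> real \<Rightarrow> real" where
  "curve_speed \<A> g \<sigma> t =
     (let c = (SOME c. c \<in> \<A> \<and> \<sigma> t \<in> fst c);
          v = vector_derivative (snd c \<circ> \<sigma>) (at t)
      in sqrt (v \<bullet> (g c (\<sigma> t) *v v)))"

definition curve_length ::
    "('a::topological_space, 'n::finite) chart set \<Rightarrow> ('a, 'n) metric_components \<Rightarrow>
     (real \<Rightarrow> 'a) \<Rightarrow> ennreal" where
  "curve_length \<A> g \<sigma> = (\<integral>\<^sup>+t\<in>{0..1}. ennreal (curve_speed \<A> g \<sigma> t) \<partial>lborel)"

text \<open>
  Connectedness of the manifold is not assumed. The distance is \<open>\<infinity>\<close>, the infimum of the empty set
  in \<^typ>\<open>ennreal\<close>, between points of different components.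
\<close>

definition riem_dist ::
    "('a::topological_space, 'n::finite) chart set \<Rightarrow> ('a, 'n) metric_components \<Rightarrow>
     'a \<Rightarrow> 'a \<Rightarrow> ennreal" where
  "riem_dist \<A> g x y =
     (INF \<sigma>\<in>{\<sigma>. piecewise_C1_curve \<A> \<sigma> \<and> pathstart \<sigma> = x \<and> pathfinish \<sigma> = y}. curve_length \<A> g \<sigma>)"

definition riem_ball ::
    "('a::topological_space, 'n::finite) chart set \<Rightarrow> ('a, 'n) metric_components \<Rightarrow>
     'a \<Rightarrow> real \<Rightarrow> 'a set" where
  "riem_ball \<A> g x \<rho> = {y. riem_dist \<A> g x y < ennreal \<rho>}"

text \<open>The Borel measure equal to \<open>\<surd>det g dx\<^sub>1 \<dots> dx\<^sub>d\<close> in every chart; it is unique by second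
  countability.\<close>

definition riemannian_volume ::
    "('a::topological_space, 'n::finite) chart set \<Rightarrow> ('a, 'n) metric_components \<Rightarrow>
     'a measure \<Rightarrow> bool" where
  "riemannian_volume \<A> g vol \<longleftrightarrow> sets vol = sets borel \<and>
     (\<forall>(U, \<phi>)\<in>\<A>. \<forall>B\<in>sets borel. B \<subseteq> U \<longrightarrow>
        emeasure vol B =
          (\<integral>\<^sup>+y\<in>\<phi> ` B. ennreal (sqrt (det (g (U, \<phi>) (inv_into U \<phi> y)))) \<partial>lborel))"

definition smooth_measure ::
    "('a::topological_space, 'n::finite) chart set \<Rightarrow> ('a, 'n) metric_components \<Rightarrow>
     'a measure \<Rightarrow> bool" where
  "smooth_measure \<A> g \<mu> \<longleftrightarrow>
     (\<exists>vol h. riemannian_volume \<A> g vol \<and> smooth_fun \<A> h \<and> (\<forall>x. 0 < h x) \<and>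
        \<mu> = density vol (\<lambda>x. ennreal (h x)))"

definition preserves_measure :: "('a \<Rightarrow> 'a) \<Rightarrow> 'a measure \<Rightarrow> bool" where
  "preserves_measure f \<mu> \<longleftrightarrow> f \<in> \<mu> \<rightarrow>\<^sub>M \<mu> \<and> distr \<mu> \<mu> f = \<mu>"

section \<open>Multiple exponential mixing for Lipschitz observables\<close>

text \<open>
  Points of \<open>M\<^sup>p\<^sup>+\<^sup>1\<close> are the extensional functions on \<^term>\<open>{..p}\<close>. The product carries the sum of
  the coordinate distances; another standard product metric, or another standard form of the
  Lipschitz norm below, only changes the constant \<open>C\<close> in the definition of mixing.
\<close>

definition power_space :: "nat \<Rightarrow> (nat \<Rightarrow> 'a) set" where
  "power_space p = (\<Pi>\<^sub>E i\<in>{..p}. UNIV)"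

definition lipschitz_const_on_power ::
    "('a \<Rightarrow> 'a \<Rightarrow> ennreal) \<Rightarrow> nat \<Rightarrow> ((nat \<Rightarrow> 'a) \<Rightarrow> real) \<Rightarrow> real \<Rightarrow> bool" where
  "lipschitz_const_on_power d p F L \<longleftrightarrow> 0 \<le> L \<and>
     (\<forall>x\<in>power_space p. \<forall>y\<in>power_space p.
        ennreal \<bar>F x - F y\<bar> \<le> ennreal L * (\<Sum>i\<le>p. d (x i) (y i)))"

definition lipschitz_norm ::
    "('a \<Rightarrow> 'a \<Rightarrow> ennreal) \<Rightarrow> nat \<Rightarrow> ((nat \<Rightarrow> 'a) \<Rightarrow> real) \<Rightarrow> real" where
  "lipschitz_norm d p F =
     (SUP x\<in>power_space p. \<bar>F x\<bar>) + Inf {L. lipschitz_const_on_power d p F L}"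

text \<open>The parameter \<^term>\<open>p\<close> refers to \<open>(p+1)\<close>-fold mixing.\<close>

definition exp_mixing ::
    "('a \<Rightarrow> 'a \<Rightarrow> ennreal) \<Rightarrow> ('a \<Rightarrow> 'a) \<Rightarrow> 'a measure \<Rightarrow> nat \<Rightarrow> bool" where
  "exp_mixing d f \<mu> p \<longleftrightarrow>
     (\<exists>C \<theta>::real. 0 < C \<and> \<theta> < 1 \<and>
        (\<forall>F. (\<exists>L. lipschitz_const_on_power d p F L) \<longrightarrow>
           (\<forall>(m::nat) k::nat \<Rightarrow> nat. k 0 = 0 \<and> (\<forall>j<p. k j + m \<le> k (Suc j)) \<longrightarrow>
              \<bar>(\<integral>x. F (\<lambda>j\<in>{..p}. (f ^^ k j) x) \<partial>\<mu>) - (\<integral>x. F x \<partial>PiM {..p} (\<lambda>_. \<mu>))\<bar>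
                \<le> C * \<theta> ^ m * lipschitz_norm d p F)))"

section \<open>The local density of the measure\<close>

definition ball_density ::
    "('a::topological_space, 'n::finite) chart set \<Rightarrow> ('a, 'n) metric_components \<Rightarrow>
     'a measure \<Rightarrow> 'a \<Rightarrow> real" where
  "ball_density \<A> g \<mu> x =
     Lim (at_right 0) (\<lambda>\<rho>. measure \<mu> (riem_ball \<A> g x \<rho>) / \<rho> ^ CARD('n))"

end

theory Submission
  imports Defs
begin

text \<open>
  Write \<open>N(x)\<close> for the number of \<open>n\<close> with \<open>1 \<le> n \<le> \<tau> \<rho> powr (-d)\<close> and \<open>d(x, f\<^sup>n x) \<le> \<rho>\<close>. The law of a
  variable with values in the natural numbers is controlled by its factorial moments, through
  truncated inclusion and exclusion (\<open>bonferroni_exactly\<close>), and those of a Poisson law with parameter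
  \<open>u\<close> are \<open>u\<^sup>r\<close>. As \<open>\<gamma>\<close> is bounded, it is enough that the mean of \<open>C(N, r)\<close> tends to
  \<open>\<tau>\<^sup>r / r! \<integral>\<gamma>\<^sup>r\<close> for every \<open>r\<close> (\<open>binomial_moment_limit\<close>). That mean is the sum, over all sets of \<open>r\<close>
  times, of the measure of the points that return at all these times.

  If all gaps between consecutive times, including the gap between 0 and the first one, exceed a large
  multiple of \<open>|ln \<rho>|\<close>, then mixing of order \<open>r + 1\<close>, applied to a Lipschitz approximation of the
  indicator of joint return, replaces the points of the orbit by independent ones. For fixed \<open>x\<close> each
  of them is \<open>\<rho>\<close>-close to \<open>x\<close> with probability about \<open>\<gamma>(x) \<rho>\<^sup>d\<close> (\<open>separated_returns\<close>,
  \<open>ramp_mass_power_limit\<close>). Nearly all of the about \<open>\<tau>\<^sup>r \<rho> powr (- d r) / r!\<close> sets of times are of this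
  kind, and they give the limit.

  The other sets of times are few, but their joint returns are more likely. Two times with a short gap
  \<open>n\<close> at which the orbit is close to \<open>x\<close> produce a point that returns after \<open>n\<close> steps. Such points have
  measure at most a power of \<open>\<rho>\<close> (\<open>short_returns\<close>): for \<open>n\<close> of order \<open>|ln \<rho>|\<close> by mixing, and for
  smaller \<open>n\<close> because, \<open>f\<close> being Lipschitz, a return after \<open>n\<close> steps entails less accurate returns after
  the multiples of \<open>n\<close>. To combine this with mixing, the times are grouped into clusters. The
  observable that detects a return after \<open>n\<close> steps has Lipschitz constant of order \<open>L\<^sup>n / \<rho>\<close>, so the
  gaps between clusters have to be much larger than those within clusters. A hierarchy of \<open>r + 2\<close>
  logarithmic scales and the pigeonhole principle provide this (\<open>scale_without_gap\<close>). With \<open>q\<close> large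
  gaps the joint return then has measure at most \<open>\<rho> powr (d q + \<eta>)\<close> up to a constant
  (\<open>cluster_bound\<close>), while up to powers of \<open>ln \<rho>\<close> there are only \<open>\<rho> powr (- d q)\<close> such sets of times
  (\<open>card_small_gaps\<close>), so that their contribution vanishes (\<open>clustered_sum_limit\<close>).

  From geometry this needs that the Riemannian distance is a pseudo-metric, that \<open>f\<close> is Lipschitz,
  and that small balls have the expected measure. All of it follows from the comparison of the
  distance with the norm of \<open>g(p)\<close> in a chart around \<open>p\<close> (\<open>rdist_local\<close>): segments in the chart bound
  the distance from above, and a short curve cannot leave the chart, where its length is at least
  nearly the norm of its increment.
\<close>

section \<open>Truncated inclusion and exclusion\<close>

lemma alternating_choose_partial_sum:
  "(\<Sum>i\<le>I. (-1) ^ i * real (Suc n choose i)) = (-1) ^ I * real (n choose I)"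
  by (induction I) (auto simp: algebra_simps)

text \<open>
  The reason is \<open>C(l+i,l) C(N,l+i) = C(N,l) C(N-l,i)\<close>: the alternating sum of a row of Pascal's
  triangle, stopped at \<open>I\<close>, is a single entry of the row above it.
\<close>

lemma bonferroni_exactly:
  fixes N l I :: nat
  shows "\<bar>of_bool (N = l) - (\<Sum>i\<le>I. (-1) ^ i * real ((l + i) choose l) * real (N choose (l + i)))\<bar>
    \<le> real ((l + Suc I) choose l) * real (N choose (l + Suc I))"
proof (cases "N < l")
  case True
  then show ?thesis by (simp add: binomial_eq_0)
next
  case False
  have eq: "real ((l + i) choose l) * real (N choose (l + i)) = real (N choose l) * real ((N - l) choose i)" for i
  proof (cases "l + i \<le> N")
    case True
    have "(N choose (l + i)) * ((l + i) choose l) = (N choose l) * ((N - l) choose i)"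
      using choose_mult[of l "l + i" N] True by simp
    then show ?thesis by (metis mult.commute of_nat_mult)
  next
    case False
    then have "N < l + i" "N - l < i \<or> N < l" by linarith+
    then show ?thesis by (auto simp: binomial_eq_0)
  qed
  have sum: "(\<Sum>i\<le>I. (-1) ^ i * real ((l + i) choose l) * real (N choose (l + i)))
      = real (N choose l) * (\<Sum>i\<le>I. (-1) ^ i * real ((N - l) choose i))"
    by (simp add: mult.assoc eq sum_distrib_left mult.left_commute)
  show ?thesis
  proof (cases "N = l")
    case True
    have "(\<Sum>i\<le>I. (-1) ^ i * real (0 choose i)) = (\<Sum>i\<in>{0}. (-1) ^ i * real (0 choose i))"
      by (rule sum.mono_neutral_right) auto
    then show ?thesis using True unfolding sum by simp
  next
    case neq: False
    then obtain n where n: "N - l = Suc n" using False by (metis Suc_diff_Suc le_neq_implies_less not_le)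
    have "\<bar>real (N choose l) * ((-1) ^ I * real (n choose I))\<bar> = real (N choose l) * real (n choose I)"
      by (simp add: abs_mult power_abs)
    also have "\<dots> \<le> real (N choose l) * real (Suc n choose Suc I)"
      by (intro mult_left_mono) auto
    also have "\<dots> = real ((l + Suc I) choose l) * real (N choose (l + Suc I))"
      by (simp only: eq n)
    finally show ?thesis using neq unfolding sum n alternating_choose_partial_sum by simp
  qed
qed

section \<open>Lipschitz cut-off functions\<close>

definition ramp :: "real \<Rightarrow> real \<Rightarrow> real \<Rightarrow> real" where
  "ramp a w t = max 0 (min 1 (1 + (a - t) / w))"

lemma ramp_nonneg: "0 \<le> ramp a w t" and ramp_le_1: "ramp a w t \<le> 1"
  by (auto simp: ramp_def)

lemma ramp_eq_1: "w > 0 \<Longrightarrow> t \<le> a \<Longrightarrow> ramp a w t = 1"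
  by (auto simp: ramp_def)

lemma ramp_eq_0: "w > 0 \<Longrightarrow> a + w \<le> t \<Longrightarrow> ramp a w t = 0"
  by (auto simp: ramp_def field_simps)

lemma ramp_ge_indicator: "w > 0 \<Longrightarrow> of_bool (t \<le> a) \<le> ramp a w t"
  using ramp_nonneg[of a w t] by (auto simp: ramp_eq_1)

lemma ramp_le_indicator: "w > 0 \<Longrightarrow> ramp a w t \<le> of_bool (t < a + w)"
  using ramp_le_1[of a w t] by (auto simp: ramp_eq_0)

lemma ramp_lipschitz:
  assumes "w > 0"
  shows "\<bar>ramp a w s - ramp a w t\<bar> \<le> \<bar>s - t\<bar> / w"
proof -
  have "\<bar>ramp a w s - ramp a w t\<bar> \<le> \<bar>(a - s) / w - (a - t) / w\<bar>"
    unfolding ramp_def by linarith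
  also have "\<dots> = \<bar>s - t\<bar> / w" using assms by (simp add: diff_divide_distrib[symmetric])
  finally show ?thesis .
qed

lemma ramp_measurable [measurable]: "ramp a w \<in> borel_measurable borel"
  unfolding ramp_def by measurable

section \<open>Multiply mixing maps of a metric probability space\<close>

text \<open>
  Observables with values in \<open>[0, 1]\<close> suffice, and for them \<open>1 + K\<close> bounds the Lipschitz norm when \<open>K\<close>
  is a Lipschitz constant.
\<close>

definition mixes :: "('a \<Rightarrow> 'a \<Rightarrow> real) \<Rightarrow> ('a \<Rightarrow> 'a) \<Rightarrow> 'a measure \<Rightarrow> nat \<Rightarrow> real \<Rightarrow> real \<Rightarrow> bool" where
  "mixes D f M p C \<theta> \<longleftrightarrow> (\<forall>F K m k. 0 \<le> K \<longrightarrow> (\<forall>x. 0 \<le> F x \<and> F x \<le> 1) \<longrightarrow>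
     (\<forall>x y. \<bar>F x - F y\<bar> \<le> K * (\<Sum>i\<le>p. D (x i) (y i))) \<longrightarrow>
     k 0 = 0 \<longrightarrow> (\<forall>j<p. k j + m \<le> k (Suc j)) \<longrightarrow>
     \<bar>(\<integral>x. F (\<lambda>j\<in>{..p}. (f ^^ k j) x) \<partial>M) - (\<integral>x. F x \<partial>PiM {..p} (\<lambda>_. M))\<bar> \<le> C * \<theta> ^ m * (1 + K))"

lemma mixesD:
  assumes "mixes D f M p C \<theta>" "0 \<le> K" "\<And>x. 0 \<le> F x \<and> F x \<le> 1"
    "\<And>x y. \<bar>F x - F y\<bar> \<le> K * (\<Sum>i\<le>p. D (x i) (y i))" "k 0 = 0" "\<And>j. j < p \<Longrightarrow> k j + m \<le> k (Suc j)"
  shows "\<bar>(\<integral>x. F (\<lambda>j\<in>{..p}. (f ^^ k j) x) \<partial>M) - (\<integral>x. F x \<partial>PiM {..p} (\<lambda>_. M))\<bar> \<le> C * \<theta> ^ m * (1 + K)"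
  using assms unfolding mixes_def by blast

lemma mixes_mono:
  assumes P: "mixes D f M p C \<theta>" and le: "0 < C" "C \<le> C'" "0 < \<theta>" "\<theta> \<le> \<theta>'"
  shows "mixes D f M p C' \<theta>'"
  unfolding mixes_def
proof (intro allI impI)
  fix F K and m :: nat and k :: "nat \<Rightarrow> nat"
  assume a: "0 \<le> (K::real)" "\<forall>x. 0 \<le> F x \<and> F x \<le> 1"
    "\<forall>x y. \<bar>F x - F y\<bar> \<le> K * (\<Sum>i\<le>p. D (x i) (y i))" "k 0 = 0" "\<forall>j<p. k j + m \<le> k (Suc j)"
  have "\<bar>(\<integral>x. F (\<lambda>j\<in>{..p}. (f ^^ k j) x) \<partial>M) - (\<integral>x. F x \<partial>PiM {..p} (\<lambda>_. M))\<bar> \<le> C * \<theta> ^ m * (1 + K)"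
    using P a unfolding mixes_def by blast
  also have "\<dots> \<le> C' * \<theta>' ^ m * (1 + K)"
    using le a by (intro mult_mono power_mono) auto
  finally show "\<bar>(\<integral>x. F (\<lambda>j\<in>{..p}. (f ^^ k j) x) \<partial>M) - (\<integral>x. F x \<partial>PiM {..p} (\<lambda>_. M))\<bar>
      \<le> C' * \<theta>' ^ m * (1 + K)" .
qed

text \<open>
  All that the counting of returns has to know about the manifold: a pseudo-metric, real-valued, in
  which \<open>f\<close> is Lipschitz, and balls of radius \<open>\<rho>\<close> whose measure is asymptotic to \<open>\<gamma>(x) \<rho>\<^sup>d\<close> at each
  point and bounded by a uniform multiple of \<open>\<rho>\<^sup>d\<close>.
\<close>

locale mixing_returns = prob_space M for M :: "'a measure" +
  fixes D :: "'a \<Rightarrow> 'a \<Rightarrow> real" and f :: "'a \<Rightarrow> 'a" and L B :: real and d :: nat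
    and \<gamma> :: "'a \<Rightarrow> real"
  assumes space_UNIV: "space M = UNIV"
    and D_nonneg: "0 \<le> D x y" and D_refl: "D x x = 0" and D_sym: "D x y = D y x"
    and D_triangle: "D x z \<le> D x y + D y z"
    and D_measurable: "case_prod D \<in> borel_measurable (M \<Otimes>\<^sub>M M)"
    and f_measurable: "f \<in> M \<rightarrow>\<^sub>M M"
    and L_ge_1: "1 \<le> L" and f_lipschitz: "D (f x) (f y) \<le> L * D x y"
    and d_pos: "1 \<le> d" and B_pos: "0 < B"
    and ball_bound: "0 < \<rho> \<Longrightarrow> measure M {y. D x y < \<rho>} \<le> B * \<rho> ^ d"
    and ball_asymp: "((\<lambda>\<rho>. measure M {y. D x y < \<rho>} / \<rho> ^ d) \<longlongrightarrow> \<gamma> x) (at_right 0)"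
    and mixing: "1 \<le> p \<Longrightarrow> \<exists>C \<theta>. 0 < C \<and> 0 < \<theta> \<and> \<theta> < 1 \<and> mixes D f M p C \<theta>"
begin

lemmas [measurable] = f_measurable

lemma D_measurable_comp [measurable (raw)]:
  assumes "u \<in> N \<rightarrow>\<^sub>M M" "v \<in> N \<rightarrow>\<^sub>M M"
  shows "(\<lambda>x. D (u x) (v x)) \<in> borel_measurable N"
proof -
  have "(\<lambda>x. (u x, v x)) \<in> N \<rightarrow>\<^sub>M M \<Otimes>\<^sub>M M" using assms by measurable
  from measurable_compose[OF this D_measurable] show ?thesis by simp
qed

lemma funpow_measurable [measurable]: "(f ^^ n) \<in> M \<rightarrow>\<^sub>M M"
  by (induction n) (auto simp: f_measurable intro: measurable_comp)

lemma funpow_lipschitz: "D ((f ^^ n) x) ((f ^^ n) y) \<le> L ^ n * D x y"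
proof (induction n)
  case (Suc n)
  have "D ((f ^^ Suc n) x) ((f ^^ Suc n) y) \<le> L * D ((f ^^ n) x) ((f ^^ n) y)"
    using f_lipschitz by simp
  also have "\<dots> \<le> L * (L ^ n * D x y)" using Suc L_ge_1 by (intro mult_left_mono) auto
  finally show ?case by (simp add: algebra_simps)
qed simp

lemma D_reverse_triangle: "\<bar>D x y - D x' y'\<bar> \<le> D x x' + D y y'"
  using D_triangle[of x y x'] D_triangle[of x' y y'] D_triangle[of x' y' x] D_triangle[of x y' y]
    D_sym[of x x'] D_sym[of y y'] by linarith

text \<open>All orders of mixing up to \<open>r\<close> share one rate, the slowest of them.\<close>

lemma uniform_mixing:
  obtains C \<theta> where "0 < C" "0 < \<theta>" "\<theta> < 1" "\<And>p. 1 \<le> p \<Longrightarrow> p \<le> r \<Longrightarrow> mixes D f M p C \<theta>"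
proof -
  have "\<exists>C \<theta>. 0 < C \<and> 0 < \<theta> \<and> \<theta> < 1 \<and> (\<forall>p. 1 \<le> p \<and> p \<le> r \<longrightarrow> mixes D f M p C \<theta>)"
  proof (induction r)
    case 0
    show ?case by (rule exI[of _ 1], rule exI[of _ "1/2"]) auto
  next
    case (Suc r)
    then obtain C \<theta> where 1: "0 < C" "0 < \<theta>" "\<theta> < 1" "\<And>p. 1 \<le> p \<Longrightarrow> p \<le> r \<Longrightarrow> mixes D f M p C \<theta>" by blast
    obtain C' \<theta>' where 2: "0 < C'" "0 < \<theta>'" "\<theta>' < 1" "mixes D f M (Suc r) C' \<theta>'"
      using mixing[of "Suc r"] by auto
    show ?case
    proof (intro exI conjI allI impI)
      show "0 < max C C'" "0 < max \<theta> \<theta>'" "max \<theta> \<theta>' < 1" using 1 2 by auto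
      fix p assume "1 \<le> p \<and> p \<le> Suc r"
      then consider "1 \<le> p" "p \<le> r" | "p = Suc r" by linarith
      then show "mixes D f M p (max C C') (max \<theta> \<theta>')"
      proof cases
        case a: 1
        show ?thesis by (rule mixes_mono[OF 1(4)[OF a] 1(1) _ 1(2)]) auto
      next
        case b: 2
        show ?thesis unfolding b by (rule mixes_mono[OF 2(4) 2(1) _ 2(2)]) auto
      qed
    qed
  qed
  then show ?thesis using that by blast
qed

text \<open>
  The observable that detects approximate returns of the points \<open>x\<^sub>1, \<dots>, x\<^sub>p\<close> to \<open>x\<^sub>0\<close>, weighted by
  a function of one of the points.
\<close>

definition obs :: "nat \<Rightarrow> nat \<Rightarrow> ('a \<Rightarrow> real) \<Rightarrow> real \<Rightarrow> real \<Rightarrow> (nat \<Rightarrow> 'a) \<Rightarrow> real" where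
  "obs p c \<psi> a w x = \<psi> (x c) * (\<Prod>i\<in>{1..p}. ramp a w (D (x 0) (x i)))"

lemma obs_bounds:
  assumes "\<And>x. 0 \<le> \<psi> x \<and> \<psi> x \<le> 1"
  shows "0 \<le> obs p c \<psi> a w x \<and> obs p c \<psi> a w x \<le> 1"
  unfolding obs_def using assms
  by (auto intro!: mult_nonneg_nonneg prod_nonneg mult_le_one prod_le_1 simp: ramp_nonneg ramp_le_1)

lemma obs_lipschitz:
  assumes \<psi>: "\<And>x. 0 \<le> \<psi> x \<and> \<psi> x \<le> 1" and K: "0 \<le> K" "\<And>x y. \<bar>\<psi> x - \<psi> y\<bar> \<le> K * D x y"
    and w: "0 < w" and c: "c \<le> p"
  shows "\<bar>obs p c \<psi> a w x - obs p c \<psi> a w y\<bar> \<le> (real p / w + K) * (\<Sum>i\<le>p. D (x i) (y i))"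
proof -
  let ?S = "\<Sum>i\<le>p. D (x i) (y i)"
  have le_S: "D (x i) (y i) \<le> ?S" if "i \<le> p" for i
    using that by (intro member_le_sum) (auto simp: D_nonneg)
  have le_S2: "D (x 0) (y 0) + D (x i) (y i) \<le> ?S" if "i \<in> {1..p}" for i
  proof -
    have "D (x 0) (y 0) + D (x i) (y i) = (\<Sum>i\<in>{0, i}. D (x i) (y i))" using that by simp
    also have "\<dots> \<le> ?S" using that by (intro sum_mono2) (auto simp: D_nonneg)
    finally show ?thesis .
  qed
  define P where "P x = (\<Prod>i\<in>{1..p}. ramp a w (D (x 0) (x i)))" for x
  have P: "0 \<le> P x \<and> P x \<le> 1" for x
    unfolding P_def by (auto intro!: prod_nonneg prod_le_1 simp: ramp_nonneg ramp_le_1)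
  have "\<bar>P x - P y\<bar> \<le> (\<Sum>i\<in>{1..p}. \<bar>ramp a w (D (x 0) (x i)) - ramp a w (D (y 0) (y i))\<bar>)"
    unfolding P_def real_norm_def[symmetric]
    by (rule norm_prod_diff) (auto simp: ramp_nonneg ramp_le_1)
  also have "\<dots> \<le> (\<Sum>i\<in>{1..p}. ?S / w)"
  proof (rule sum_mono)
    fix i assume i: "i \<in> {1..p}"
    have "\<bar>ramp a w (D (x 0) (x i)) - ramp a w (D (y 0) (y i))\<bar> \<le> \<bar>D (x 0) (x i) - D (y 0) (y i)\<bar> / w"
      using w by (rule ramp_lipschitz)
    also have "\<dots> \<le> ?S / w"
      using D_reverse_triangle[of "x 0" "x i" "y 0" "y i"] le_S2[OF i] w by (intro divide_right_mono) auto
    finally show "\<bar>ramp a w (D (x 0) (x i)) - ramp a w (D (y 0) (y i))\<bar> \<le> ?S / w" .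
  qed
  finally have 1: "\<bar>P x - P y\<bar> \<le> real p / w * ?S" by simp
  have 2: "\<bar>\<psi> (x c) - \<psi> (y c)\<bar> \<le> K * ?S"
    using K(2)[of "x c" "y c"] mult_left_mono[OF le_S[OF c] K(1)] by linarith
  have "\<bar>\<psi> (x c) * P x - \<psi> (y c) * P y\<bar> = \<bar>(\<psi> (x c) - \<psi> (y c)) * P x + \<psi> (y c) * (P x - P y)\<bar>"
    by (simp add: algebra_simps)
  also have "\<dots> \<le> \<bar>\<psi> (x c) - \<psi> (y c)\<bar> * P x + \<psi> (y c) * \<bar>P x - P y\<bar>"
    using P[of x] \<psi>[of "y c"] by (intro order_trans[OF abs_triangle_ineq]) (auto simp: abs_mult)
  also have "\<dots> \<le> \<bar>\<psi> (x c) - \<psi> (y c)\<bar> * 1 + 1 * \<bar>P x - P y\<bar>"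
    using P[of x] \<psi>[of "y c"] by (intro add_mono mult_left_mono mult_right_mono) auto
  also have "\<dots> \<le> (real p / w + K) * ?S" using 1 2 by (simp add: algebra_simps)
  finally show ?thesis unfolding obs_def P_def .
qed


section \<open>Observables integrated over the product measure\<close>

text \<open>Given the first coordinate, the other coordinates are independent.\<close>

lemma integral_star:
  fixes H :: "'a \<Rightarrow> real" and G :: "nat \<Rightarrow> 'a \<Rightarrow> 'a \<Rightarrow> real"
  assumes H: "H \<in> borel_measurable M" "\<And>x. 0 \<le> H x \<and> H x \<le> 1"
    and G: "\<And>i. case_prod (G i) \<in> borel_measurable (M \<Otimes>\<^sub>M M)" "\<And>i x y. 0 \<le> G i x y \<and> G i x y \<le> 1"
  shows "(\<integral>x. H (x 0) * (\<Prod>i\<in>{1..p}. G i (x 0) (x i)) \<partial>PiM {..p} (\<lambda>_. M))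
    = (\<integral>x. H x * (\<Prod>i\<in>{1..p}. \<integral>y. G i x y \<partial>M) \<partial>M)"
proof -
  interpret P: product_sigma_finite "\<lambda>_::nat. M" by standard
  interpret PP: prob_space "PiM {..p} (\<lambda>_. M)" by (intro prob_space_PiM) (rule prob_space_axioms)
  let ?F = "\<lambda>x. H (x 0) * (\<Prod>i\<in>{1..p}. G i (x 0) (x i))"
  have eq: "{..p} = {0} \<union> {1..p}" by auto
  have meas: "?F \<in> borel_measurable (PiM {..p} (\<lambda>_. M))"
  proof (intro borel_measurable_times borel_measurable_prod)
    show "(\<lambda>x. H (x 0)) \<in> borel_measurable (PiM {..p} (\<lambda>_. M))"
      by (intro measurable_compose[of "\<lambda>x. x 0" _ M H] measurable_component_singleton H) auto
    fix i assume i: "i \<in> {1..p}"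
    have "(\<lambda>x. (x 0, x i)) \<in> PiM {..p} (\<lambda>_. M) \<rightarrow>\<^sub>M M \<Otimes>\<^sub>M M"
      using i by (intro measurable_Pair measurable_component_singleton) auto
    from measurable_compose[OF this G(1)[of i]]
    show "(\<lambda>x. G i (x 0) (x i)) \<in> borel_measurable (PiM {..p} (\<lambda>_. M))" by simp
  qed
  have bound: "0 \<le> ?F x \<and> ?F x \<le> 1" for x
    using H(2) G(2) by (auto intro!: mult_nonneg_nonneg prod_nonneg mult_le_one prod_le_1)
  have int: "integrable (PiM ({0} \<union> {1..p}) (\<lambda>_. M)) ?F"
    using meas bound unfolding eq[symmetric] by (intro PP.integrable_const_bound[of _ 1]) auto
  have "(\<integral>x. ?F x \<partial>PiM {..p} (\<lambda>_. M)) = (\<integral>x. (\<integral>y. ?F (merge {0} {1..p} (x, y)) \<partial>PiM {1..p} (\<lambda>_. M)) \<partial>PiM {0::nat} (\<lambda>_. M))"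
    unfolding eq by (rule P.product_integral_fold) (use int in auto)
  also have "\<dots> = (\<integral>x. H (x 0) * (\<Prod>i\<in>{1..p}. \<integral>y. G i (x 0) y \<partial>M) \<partial>PiM {0::nat} (\<lambda>_. M))"
  proof (rule Bochner_Integration.integral_cong, rule refl)
    fix x :: "nat \<Rightarrow> 'a"
    have "(\<integral>y. ?F (merge {0} {1..p} (x, y)) \<partial>PiM {1..p} (\<lambda>_. M))
        = (\<integral>y. H (x 0) * (\<Prod>i\<in>{1..p}. G i (x 0) (y i)) \<partial>PiM {1..p} (\<lambda>_. M))"
      by (intro Bochner_Integration.integral_cong refl arg_cong2[where f="(*)"] prod.cong)
        (auto simp: merge_def)
    also have "\<dots> = H (x 0) * (\<Prod>i\<in>{1..p}. \<integral>y. G i (x 0) y \<partial>M)"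
    proof -
      have "G i (x 0) \<in> borel_measurable M" for i
        using measurable_compose[of "\<lambda>y. (x 0, y)" M, OF _ G(1)[of i]] by (simp add: space_UNIV)
      then have "integrable M (G i (x 0))" for i
        using G(2) by (intro integrable_const_bound[of _ 1]) auto
      then show ?thesis using P.product_integral_prod[of "{1..p}" "\<lambda>i. G i (x 0)"] by simp
    qed
    finally show "(\<integral>y. ?F (merge {0} {1..p} (x, y)) \<partial>PiM {1..p} (\<lambda>_. M))
        = H (x 0) * (\<Prod>i\<in>{1..p}. \<integral>y. G i (x 0) y \<partial>M)" .
  qed
  also have "\<dots> = (\<integral>x. H x * (\<Prod>i\<in>{1..p}. \<integral>y. G i x y \<partial>M) \<partial>M)"
  proof -
    have "(\<lambda>x. \<integral>y. G i x y \<partial>M) \<in> borel_measurable M" for i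
      using borel_measurable_lebesgue_integral[OF G(1)[of i]] by simp
    then have "(\<lambda>x. H x * (\<Prod>i\<in>{1..p}. \<integral>y. G i x y \<partial>M)) \<in> borel_measurable M"
      using H(1) by (intro borel_measurable_times borel_measurable_prod) auto
    from P.product_integral_singleton[of "\<lambda>x. H x * (\<Prod>i\<in>{1..p}. \<integral>y. G i x y \<partial>M)" 0, OF this]
    show ?thesis .
  qed
  finally show ?thesis .
qed

text \<open>A smoothed measure of the ball with centre \<open>x\<close> and radius between \<open>a\<close> and \<open>a + w\<close>.\<close>

definition ramp_mass :: "real \<Rightarrow> real \<Rightarrow> 'a \<Rightarrow> real" where
  "ramp_mass a w x = (\<integral>y. ramp a w (D x y) \<partial>M)"

lemma D_measurable_right [measurable]: "D x \<in> borel_measurable M"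
proof -
  have "(\<lambda>y. (x, y)) \<in> M \<rightarrow>\<^sub>M M \<Otimes>\<^sub>M M"
    by (rule measurable_Pair1') (simp add: space_UNIV)
  from measurable_compose[OF this D_measurable] show ?thesis by simp
qed

lemma ramp_D_measurable: "case_prod (\<lambda>x y. ramp a w (D x y)) \<in> borel_measurable (M \<Otimes>\<^sub>M M)"
  using measurable_compose[OF D_measurable ramp_measurable] by (simp add: split_beta')

lemma ramp_mass_measurable [measurable]: "ramp_mass a w \<in> borel_measurable M"
  unfolding ramp_mass_def using borel_measurable_lebesgue_integral[OF ramp_D_measurable] by simp

lemma ramp_D_integrable: "integrable M (\<lambda>y. ramp a w (D x y))"
  by (intro integrable_const_bound[of _ 1]) (auto simp: ramp_nonneg ramp_le_1)

lemma ball_sets [measurable]: "{y. D x y < \<rho>} \<in> sets M" "{y. D x y \<le> \<rho>} \<in> sets M"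
proof -
  have "{y\<in>space M. D x y < \<rho>} \<in> sets M" "{y\<in>space M. D x y \<le> \<rho>} \<in> sets M" by measurable
  then show "{y. D x y < \<rho>} \<in> sets M" "{y. D x y \<le> \<rho>} \<in> sets M" by (simp_all add: space_UNIV)
qed

lemma measure_as_integral:
  assumes "{x. P x} \<in> sets M"
  shows "measure M {x. P x} = (\<integral>x. of_bool (P x) \<partial>M)"
proof -
  have "(\<lambda>x. of_bool (P x) :: real) = indicator {x. P x}" by (auto simp: indicator_def)
  then show ?thesis using assms by (simp add: space_UNIV)
qed

lemma integrable_of_bool:
  assumes "{x. P x} \<in> sets M"
  shows "integrable M (\<lambda>x. of_bool (P x) :: real)"
proof -
  have "(\<lambda>x. of_bool (P x) :: real) = indicator {x. P x}" by (auto simp: indicator_def)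
  then show ?thesis using assms by (simp add: emeasure_eq_measure)
qed

lemma ramp_mass_nonneg: "0 \<le> ramp_mass a w x"
  unfolding ramp_mass_def by (simp add: ramp_nonneg)

lemma ramp_mass_le_ball: "0 < w \<Longrightarrow> ramp_mass a w x \<le> measure M {y. D x y < a + w}"
  unfolding ramp_mass_def measure_as_integral[OF ball_sets(1)]
  by (intro integral_mono ramp_D_integrable integrable_of_bool ball_sets ramp_le_indicator)

lemma ball_le_ramp_mass:
  assumes "0 < w"
  shows "measure M {y. D x y < a} \<le> ramp_mass a w x"
proof -
  have "measure M {y. D x y < a} \<le> (\<integral>y. of_bool (D x y \<le> a) \<partial>M)"
    unfolding measure_as_integral[OF ball_sets(1)]
    by (intro integral_mono integrable_of_bool ball_sets) auto
  also have "\<dots> \<le> ramp_mass a w x" unfolding ramp_mass_def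
    using assms by (intro integral_mono ramp_D_integrable integrable_of_bool ball_sets ramp_ge_indicator)
  finally show ?thesis .
qed

lemma ramp_mass_le_1: "ramp_mass a w x \<le> 1"
  unfolding ramp_mass_def by (intro integral_le_const ramp_D_integrable) (auto simp: ramp_le_1)

lemma ramp_mass_bound: "0 < w \<Longrightarrow> 0 < a + w \<Longrightarrow> ramp_mass a w x \<le> B * (a + w) ^ d"
  using ramp_mass_le_ball[of w a x] ball_bound[of "a + w" x] by simp

lemma obs_integral_unweighted:
  "(\<integral>x. obs p c (\<lambda>_. 1) a w x \<partial>PiM {..p} (\<lambda>_. M)) = (\<integral>x. ramp_mass a w x ^ p \<partial>M)"
  unfolding obs_def
  using integral_star[of "\<lambda>_. 1" "\<lambda>i x y. ramp a w (D x y)" p] ramp_D_measurable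
  by (simp add: ramp_mass_def ramp_nonneg ramp_le_1)

text \<open>
  If the weight sits on a point other than the first one, that point is integrated last: by symmetry of
  the distance the first point is as likely to be close to it as conversely. Thus the weight is
  integrated against \<open>M\<close> in every case.
\<close>

lemma obs_integral_weighted:
  assumes \<psi>: "\<psi> \<in> borel_measurable M" "\<And>x. 0 \<le> \<psi> x \<and> \<psi> x \<le> 1"
    and b: "\<And>x. ramp_mass a w x \<le> b" and c: "c \<le> p"
  shows "(\<integral>x. obs p c \<psi> a w x \<partial>PiM {..p} (\<lambda>_. M)) \<le> b ^ p * (\<integral>x. \<psi> x \<partial>M)"
proof -
  note [measurable] = \<psi>(1)
  have b0: "0 \<le> b" using b ramp_mass_nonneg order_trans by blast
  have int\<psi>: "integrable M \<psi>" using \<psi> by (intro integrable_const_bound[of _ 1]) auto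
  show ?thesis
  proof (cases "c = 0")
    case True
    have "(\<integral>x. obs p c \<psi> a w x \<partial>PiM {..p} (\<lambda>_. M)) = (\<integral>x. \<psi> x * ramp_mass a w x ^ p \<partial>M)"
      unfolding obs_def True
      using integral_star[of \<psi> "\<lambda>i x y. ramp a w (D x y)" p] ramp_D_measurable \<psi>
      by (simp add: ramp_mass_def ramp_nonneg ramp_le_1)
    also have "\<dots> \<le> (\<integral>x. \<psi> x * b ^ p \<partial>M)"
    proof (intro integral_mono mult_left_mono power_mono b ramp_mass_nonneg)
      show "integrable M (\<lambda>x. \<psi> x * ramp_mass a w x ^ p)"
        using \<psi>(2) ramp_mass_nonneg ramp_mass_le_1
        by (intro integrable_const_bound[of _ 1]) (auto intro!: mult_le_one power_le_one simp: abs_mult)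
      show "integrable M (\<lambda>x. \<psi> x * b ^ p)" using int\<psi> by simp
      show "0 \<le> \<psi> x" for x using \<psi>(2) by simp
    qed
    finally show ?thesis by (simp add: mult.commute)
  next
    case False
    define q where "q = p - 1"
    have p: "p = Suc q" using False c by (simp add: q_def)
    define G where "G i x y = ramp a w (D x y) * (if i = c then \<psi> y else 1)" for i :: nat and x y
    have G01: "0 \<le> G i x y \<and> G i x y \<le> 1" for i x y
      unfolding G_def using \<psi>(2) by (auto simp: ramp_nonneg ramp_le_1 intro!: mult_le_one)
    have Gmeas: "case_prod (G i) \<in> borel_measurable (M \<Otimes>\<^sub>M M)" for i
      unfolding G_def split_beta' by (cases "i = c") (simp_all, measurable)
    have obs: "obs p c \<psi> a w x = 1 * (\<Prod>i\<in>{1..p}. G i (x 0) (x i))" for x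
    proof -
      have "(\<Prod>i\<in>{1..p}. if i = c then \<psi> (x i) else 1) = \<psi> (x c)"
        using c False by (subst prod.delta) auto
      then show ?thesis unfolding obs_def G_def prod.distrib by simp
    qed
    define W where "W x = (\<integral>y. ramp a w (D x y) * \<psi> y \<partial>M)" for x
    have "(\<lambda>(x, y). ramp a w (D x y) * \<psi> y) \<in> borel_measurable (M \<Otimes>\<^sub>M M)"
      unfolding split_beta' by measurable
    from borel_measurable_lebesgue_integral[OF this]
    have [measurable]: "W \<in> borel_measurable M" unfolding W_def by simp
    have W0: "0 \<le> W x" for x unfolding W_def using \<psi>(2) by (simp add: ramp_nonneg)
    have W1: "W x \<le> 1" for x unfolding W_def
      using \<psi>(2) by (intro integral_le_const integrable_const_bound[of _ 1])
        (auto intro!: mult_le_one simp: ramp_nonneg ramp_le_1 abs_mult)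
    have intW: "integrable M W" using W0 W1 by (intro integrable_const_bound[of _ 1]) auto
    have prod: "(\<Prod>i\<in>{1..p}. \<integral>y. G i x y \<partial>M) = W x * ramp_mass a w x ^ q" for x
    proof -
      have "(\<Prod>i\<in>{1..p}. \<integral>y. G i x y \<partial>M) = (\<integral>y. G c x y \<partial>M) * (\<Prod>i\<in>{1..p} - {c}. \<integral>y. G i x y \<partial>M)"
        using c False by (intro prod.remove) auto
      also have "(\<Prod>i\<in>{1..p} - {c}. \<integral>y. G i x y \<partial>M) = (\<Prod>i\<in>{1..p} - {c}. ramp_mass a w x)"
        by (intro prod.cong) (auto simp: G_def ramp_mass_def)
      also have "\<dots> = ramp_mass a w x ^ q" using c False p by (simp add: card_Diff_subset)
      finally show ?thesis by (simp add: G_def W_def)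
    qed
    have "(\<integral>x. obs p c \<psi> a w x \<partial>PiM {..p} (\<lambda>_. M)) = (\<integral>x. 1 * (\<Prod>i\<in>{1..p}. \<integral>y. G i x y \<partial>M) \<partial>M)"
      unfolding obs using Gmeas G01 by (intro integral_star) auto
    also have "\<dots> = (\<integral>x. W x * ramp_mass a w x ^ q \<partial>M)" unfolding prod by simp
    also have "\<dots> \<le> (\<integral>x. W x * b ^ q \<partial>M)"
    proof (intro integral_mono mult_left_mono power_mono b ramp_mass_nonneg W0)
      show "integrable M (\<lambda>x. W x * ramp_mass a w x ^ q)"
        using W0 W1 ramp_mass_nonneg ramp_mass_le_1
        by (intro integrable_const_bound[of _ 1]) (auto intro!: mult_le_one power_le_one simp: abs_mult)
      show "integrable M (\<lambda>x. W x * b ^ q)" using intW by simp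
    qed
    also have "\<dots> = (\<integral>x. W x \<partial>M) * b ^ q" by simp
    also have "(\<integral>x. W x \<partial>M) = (\<integral>y. (\<integral>x. ramp a w (D x y) * \<psi> y \<partial>M) \<partial>M)"
    proof -
      interpret PM: pair_sigma_finite M M ..
      interpret PP: prob_space "M \<Otimes>\<^sub>M M" by (intro prob_space_pair) (rule prob_space_axioms)+
      have "integrable (M \<Otimes>\<^sub>M M) (\<lambda>(x, y). ramp a w (D x y) * \<psi> y)"
      proof (rule PP.integrable_const_bound[of _ 1])
        show "(\<lambda>(x, y). ramp a w (D x y) * \<psi> y) \<in> borel_measurable (M \<Otimes>\<^sub>M M)" by fact
        have "norm (ramp a w (D x y) * \<psi> y) \<le> 1" for x y
          using \<psi>(2) by (auto intro!: mult_le_one simp: ramp_nonneg ramp_le_1 abs_mult)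
        then show "AE x in M \<Otimes>\<^sub>M M. norm (case x of (x, y) \<Rightarrow> ramp a w (D x y) * \<psi> y) \<le> 1"
          by (intro AE_I2) (simp add: split_beta')
      qed
      from PM.Fubini_integral[OF this] show ?thesis unfolding W_def by simp
    qed
    also have "\<dots> = (\<integral>y. ramp_mass a w y * \<psi> y \<partial>M)"
      unfolding ramp_mass_def using D_sym by simp
    also have "\<dots> \<le> (\<integral>y. b * \<psi> y \<partial>M)"
    proof (intro integral_mono mult_right_mono b)
      show "integrable M (\<lambda>y. ramp_mass a w y * \<psi> y)"
        using \<psi>(2) ramp_mass_nonneg ramp_mass_le_1
        by (intro integrable_const_bound[of _ 1]) (auto intro!: mult_le_one simp: abs_mult)
      show "integrable M (\<lambda>y. b * \<psi> y)" using int\<psi> by simp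
      show "0 \<le> \<psi> x" for x using \<psi>(2) by simp
    qed
    also have "\<dots> = b * (\<integral>y. \<psi> y \<partial>M)" by simp
    finally show ?thesis using b0 by (simp add: p algebra_simps mult_right_mono)
  qed
qed

lemma obs_along_orbit:
  assumes "c \<le> p" "k 0 = 0"
  shows "obs p c \<psi> a w (\<lambda>j\<in>{..p}. (f ^^ k j) x)
    = \<psi> ((f ^^ k c) x) * (\<Prod>i\<in>{1..p}. ramp a w (D x ((f ^^ k i) x)))"
  unfolding obs_def using assms by (auto intro!: prod.cong)

lemma return_sets [measurable]: "{x. D x ((f ^^ n) x) \<le> \<rho>} \<in> sets M"
proof -
  have "{x\<in>space M. D x ((f ^^ n) x) \<le> \<rho>} \<in> sets M" by measurable
  then show ?thesis by (simp add: space_UNIV)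
qed

lemma joint_return_sets [measurable]: "{x. \<forall>i\<in>{1..p::nat}. D x ((f ^^ k i) x) \<le> \<rho>} \<in> sets M"
proof -
  have "{x\<in>space M. \<forall>i\<in>{1..p}. D x ((f ^^ k i) x) \<le> \<rho>} \<in> sets M" by measurable
  then show ?thesis by (simp add: space_UNIV)
qed

lemma prod_ramp_ge:
  assumes "0 < w"
  shows "of_bool (\<forall>i\<in>{1..p::nat}. u i \<le> a) \<le> (\<Prod>i\<in>{1..p}. ramp a w (u i))"
  using assms by (auto simp: ramp_eq_1 ramp_nonneg intro!: prod_nonneg)

lemma prod_ramp_le:
  assumes "0 < w"
  shows "(\<Prod>i\<in>{1..p::nat}. ramp a w (u i)) \<le> of_bool (\<forall>i\<in>{1..p}. u i \<le> a + w)"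
proof (cases "\<forall>i\<in>{1..p}. u i \<le> a + w")
  case True
  moreover have "(\<Prod>i\<in>{1..p}. ramp a w (u i)) \<le> 1" by (auto intro!: prod_le_1 simp: ramp_nonneg ramp_le_1)
  ultimately show ?thesis by simp
next
  case False
  then obtain i where "i \<in> {1..p}" "\<not> u i \<le> a + w" by blast
  then have "(\<Prod>i\<in>{1..p}. ramp a w (u i)) = 0"
    using assms ramp_eq_0[of w a "u i"] by (intro prod_zero) auto
  then show ?thesis by (metis of_bool_def zero_le_one order_refl)
qed

lemma prod_ramp_integrable: "integrable M (\<lambda>x. \<Prod>i\<in>{1..p::nat}. ramp a w (D x ((f ^^ k i) x)))"
  by (intro integrable_const_bound[of _ 1]) 
    (auto intro!: prod_le_1 AE_I2 simp: ramp_nonneg ramp_le_1 abs_prod)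


section \<open>Short returns\<close>

text \<open>
  If \<open>x\<close> returns after \<open>k\<close> steps then, \<open>f\<close> being Lipschitz, it also returns, less accurately, after
  any multiple of \<open>k\<close>.
\<close>

lemma iterated_return:
  assumes "D x ((f ^^ k) x) \<le> \<rho>" "0 \<le> \<rho>"
  shows "D x ((f ^^ (Suc j * k)) x) \<le> real (Suc j) * L ^ (j * k) * \<rho>"
proof (induction j)
  case 0
  then show ?case using assms by simp
next
  case (Suc j)
  have L1: "1 \<le> L ^ n" for n using L_ge_1 by simp
  have "D x ((f ^^ (Suc (Suc j) * k)) x)
      \<le> D x ((f ^^ (Suc j * k)) x) + D ((f ^^ (Suc j * k)) x) ((f ^^ (Suc (Suc j) * k)) x)"
    by (rule D_triangle)
  also have "D ((f ^^ (Suc j * k)) x) ((f ^^ (Suc (Suc j) * k)) x) \<le> L ^ (Suc j * k) * D x ((f ^^ k) x)"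
  proof -
    have "(f ^^ (Suc (Suc j) * k)) x = (f ^^ (Suc j * k)) ((f ^^ k) x)"
      using funpow_add[of "Suc j * k" k f] by (simp add: add.commute)
    then show ?thesis using funpow_lipschitz by metis
  qed
  also have "\<dots> \<le> L ^ (Suc j * k) * \<rho>" using assms L1 L_ge_1 by (intro mult_left_mono) auto
  also have "D x ((f ^^ (Suc j * k)) x) \<le> real (Suc j) * L ^ (Suc j * k) * \<rho>"
  proof -
    have "real (Suc j) * L ^ (j * k) * \<rho> \<le> real (Suc j) * L ^ (Suc j * k) * \<rho>"
      using assms L_ge_1 by (intro mult_right_mono mult_left_mono power_increasing) auto
    then show ?thesis using Suc by linarith
  qed
  finally show ?case by (simp add: algebra_simps)
qed

text \<open>
  For \<open>n\<close> of the order of \<open>|ln \<rho>|\<close> mixing bounds the measure of the points that return within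
  \<open>\<rho>\<close> after \<open>n\<close> steps by a power of \<open>\<rho>\<close>. A smaller return time has a multiple of that order, chosen
  so that the loss of accuracy in passing to the multiple is at most \<open>\<rho> powr (-1/2)\<close>.
\<close>

lemma short_returns:
  obtains C \<eta> where "1 \<le> C" "0 < \<eta>"
    "\<And>\<rho> k. 0 < \<rho> \<Longrightarrow> 1 \<le> k \<Longrightarrow> measure M {x. D x ((f ^^ k) x) \<le> \<rho>} \<le> C * \<rho> powr \<eta>"
proof -
  obtain C0 \<theta> where C0: "0 < C0" and \<theta>: "0 < \<theta>" "\<theta> < 1" and
    mix: "\<And>p. 1 \<le> p \<Longrightarrow> p \<le> 1 \<Longrightarrow> mixes D f M p C0 \<theta>"
    by (rule uniform_mixing[of 1]) blast
  define C1 where "C1 = B * 2 ^ d + 2 * C0"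
  have C1: "0 < C1" using B_pos C0 by (simp add: C1_def add_pos_pos)
  have two_point: "measure M {x. D x ((f ^^ n) x) \<le> s} \<le> C1 * (s + \<theta> ^ n / s)"
    if s: "0 < s" "s \<le> 1" for n s
  proof -
    let ?k = "\<lambda>j::nat. j * n"
    let ?F = "obs 1 0 (\<lambda>_. 1) s s"
    have "measure M {x. D x ((f ^^ n) x) \<le> s} = (\<integral>x. of_bool (D x ((f ^^ n) x) \<le> s) \<partial>M)"
      by (rule measure_as_integral) (rule return_sets)
    also have "\<dots> \<le> (\<integral>x. (\<Prod>i\<in>{1..1}. ramp s s (D x ((f ^^ ?k i) x))) \<partial>M)"
      by (intro integral_mono integrable_of_bool return_sets prod_ramp_integrable)
        (use s(1) in \<open>simp add: ramp_ge_indicator\<close>)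
    also have "\<dots> = (\<integral>x. ?F (\<lambda>j\<in>{..1}. (f ^^ ?k j) x) \<partial>M)"
      using obs_along_orbit[of 0 1 ?k "\<lambda>_. 1" s s] by simp
    also have "\<dots> \<le> (\<integral>x. ?F x \<partial>PiM {..1} (\<lambda>_. M)) + C0 * \<theta> ^ n * (1 + 1 / s)"
    proof -
      have "\<bar>(\<integral>x. ?F (\<lambda>j\<in>{..1}. (f ^^ ?k j) x) \<partial>M) - (\<integral>x. ?F x \<partial>PiM {..1} (\<lambda>_. M))\<bar>
        \<le> C0 * \<theta> ^ n * (1 + 1 / s)"
      proof (rule mixesD[OF mix])
        show "0 \<le> ?F x \<and> ?F x \<le> 1" for x by (rule obs_bounds) simp
        show "\<bar>?F x - ?F y\<bar> \<le> 1 / s * (\<Sum>i\<le>1. D (x i) (y i))" for x y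
          using obs_lipschitz[of "\<lambda>_. 1" 0 s 0 1 s x y] s by simp
      qed (use s in auto)
      then show ?thesis by linarith
    qed
    also have "(\<integral>x. ?F x \<partial>PiM {..1} (\<lambda>_. M)) \<le> B * (s + s) ^ d"
    proof -
      have "(\<integral>x. ramp_mass s s x ^ 1 \<partial>M) \<le> B * (s + s) ^ d"
        using s ramp_mass_bound[of s s]
        by (intro integral_le_const integrable_const_bound[of _ 1] AE_I2)
          (auto simp: ramp_mass_nonneg ramp_mass_le_1)
      then show ?thesis by (simp only: obs_integral_unweighted)
    qed
    also have "B * (s + s) ^ d \<le> B * 2 ^ d * s"
    proof -
      have "s ^ d \<le> s ^ 1" using s d_pos by (intro power_decreasing) auto
      then show ?thesis using B_pos by (simp add: mult_2[symmetric] power_mult_distrib)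
    qed
    also have "C0 * \<theta> ^ n * (1 + 1 / s) \<le> C0 * \<theta> ^ n * (2 / s)"
      using s C0 \<theta> by (intro mult_left_mono) (auto simp: field_simps)
    also have "B * 2 ^ d * s + C0 * \<theta> ^ n * (2 / s) \<le> C1 * (s + \<theta> ^ n / s)"
      using s C0 \<theta> B_pos by (simp add: C1_def algebra_simps)
    finally show ?thesis by simp
  qed
  have shift: "measure M {x. D x ((f ^^ k) x) \<le> \<rho>} \<le> C1 * (s + \<theta> ^ N / s)"
    if "0 < \<rho>" "1 \<le> k" "\<rho> * (2 * L) ^ N \<le> s" "s \<le> 1" for \<rho> k N s
  proof -
    \<comment> \<open>\<open>Suc j * k\<close> is the first multiple of \<open>k\<close> beyond \<open>N\<close>.\<close>
    define j where "j = N div k"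
    have jk: "j * k \<le> N" "N \<le> Suc j * k"
      using that(2) by (auto simp: j_def) (metis add.commute div_mult_mod_eq mod_le_divisor add_left_mono le_eq_less_or_eq less_eq_Suc_le One_nat_def)
    have "j \<le> N" unfolding j_def by simp
    have "Suc j \<le> 2 ^ N"
    proof -
      have "Suc N \<le> 2 ^ N" by (induction N) auto
      then show ?thesis using \<open>j \<le> N\<close> by linarith
    qed
    then have "real (Suc j) \<le> 2 ^ N" by (metis of_nat_le_iff of_nat_numeral of_nat_power)
    then have "real (Suc j) * L ^ (j * k) * \<rho> \<le> 2 ^ N * L ^ N * \<rho>"
      using jk(1) L_ge_1 that by (intro mult_right_mono mult_mono power_increasing) auto
    also have "\<dots> \<le> s" using that by (simp add: power_mult_distrib mult.commute)
    finally have "{x. D x ((f ^^ k) x) \<le> \<rho>} \<subseteq> {x. D x ((f ^^ (Suc j * k)) x) \<le> s}"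
      using iterated_return[of _ k \<rho> j] that by force
    then have "measure M {x. D x ((f ^^ k) x) \<le> \<rho>} \<le> measure M {x. D x ((f ^^ (Suc j * k)) x) \<le> s}"
      by (intro finite_measure_mono return_sets)
    also have "\<dots> \<le> C1 * (s + \<theta> ^ (Suc j * k) / s)"
    proof (rule two_point)
      have "0 < \<rho> * (2 * L) ^ N" using that L_ge_1 by auto
      then show "0 < s" "s \<le> 1" using that by linarith+
    qed
    also have "\<dots> \<le> C1 * (s + \<theta> ^ N / s)"
    proof -
      have "0 < \<rho> * (2 * L) ^ N" using that L_ge_1 by auto
      then have "0 < s" using that by linarith
      then show ?thesis using jk(2) \<theta> C1
        by (intro mult_left_mono add_left_mono divide_right_mono power_decreasing) auto
    qed
    finally show ?thesis .
  qed
  define \<Lambda> where "\<Lambda> = 2 * L"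
  have \<Lambda>: "2 \<le> \<Lambda>" "0 < ln \<Lambda>" using L_ge_1 by (auto simp: \<Lambda>_def)
  \<comment> \<open>Up to a constant, \<open>\<theta> ^ N\<close> will be at most \<open>\<rho> powr (2 \<eta>)\<close>; dividing by \<open>s = \<rho> powr \<eta>\<close> leaves \<open>\<rho> powr \<eta>\<close>.\<close>
  define \<eta> where "\<eta> = min (1/2) (ln (1 / \<theta>) / (4 * ln \<Lambda>))"
  have ln\<theta>: "0 < ln (1 / \<theta>)" using \<theta> by simp
  have \<eta>: "0 < \<eta>" "\<eta> \<le> 1/2" "2 * \<eta> \<le> ln (1 / \<theta>) / (2 * ln \<Lambda>)"
    using \<Lambda> ln\<theta> by (auto simp: \<eta>_def min_def)
  have small: "measure M {x. D x ((f ^^ k) x) \<le> \<rho>} \<le> C1 * (1 + 1 / \<theta>) * \<rho> powr \<eta>"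
    if \<rho>: "0 < \<rho>" "\<rho> < 1" and k: "1 \<le> k" for \<rho> k
  proof -
    define u where "u = ln (1 / \<rho>) / (2 * ln \<Lambda>)"
    \<comment> \<open>About the largest \<open>N\<close> for which \<open>\<rho> \<Lambda> ^ N\<close> is still at most \<open>\<rho> powr (1/2)\<close>.\<close>
    define N where "N = nat \<lfloor>u\<rfloor>"
    have u0: "0 \<le> u" using \<rho> \<Lambda> by (simp add: u_def)
    have N: "real N \<le> u" "u - 1 \<le> real N" using u0 by (auto simp: N_def)
    have "\<Lambda> ^ N = \<Lambda> powr real N" using \<Lambda> by (simp add: powr_realpow)
    also have "\<dots> \<le> \<Lambda> powr u" using N \<Lambda> by (intro powr_mono) auto
    also have "\<dots> = \<rho> powr (- 1/2)"
      using \<Lambda> \<rho> by (simp add: powr_def u_def ln_div)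
    finally have "\<rho> * \<Lambda> ^ N \<le> \<rho> powr 1 * \<rho> powr (- 1/2)" using \<rho> by simp
    also have "\<dots> = \<rho> powr (1/2)" by (subst powr_add[symmetric]) simp
    also have "\<dots> \<le> \<rho> powr \<eta>" using \<rho> \<eta> by (intro powr_mono') auto
    finally have 1: "\<rho> * (2 * L) ^ N \<le> \<rho> powr \<eta>" by (simp add: \<Lambda>_def)
    have "\<theta> ^ N = \<theta> powr real N" using \<theta> by (simp add: powr_realpow)
    also have "\<dots> \<le> \<theta> powr (u - 1)" using N \<theta> by (intro powr_mono') auto
    also have "\<dots> = \<theta> powr u / \<theta>" using \<theta> by (simp add: powr_diff)
    also have "\<theta> powr u = \<rho> powr (ln (1 / \<theta>) / (2 * ln \<Lambda>))"
      using \<theta> \<rho> by (simp add: powr_def u_def ln_div)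
    also have "\<dots> \<le> \<rho> powr (2 * \<eta>)" using \<rho> \<eta> by (intro powr_mono') auto
    finally have 2: "\<theta> ^ N \<le> \<rho> powr (2 * \<eta>) / \<theta>" using \<theta> by (simp add: divide_right_mono)
    have "measure M {x. D x ((f ^^ k) x) \<le> \<rho>} \<le> C1 * (\<rho> powr \<eta> + \<theta> ^ N / \<rho> powr \<eta>)"
    proof (rule shift[OF \<rho>(1) k 1])
      show "\<rho> powr \<eta> \<le> 1" using \<rho> \<eta> by (simp add: powr_le1)
    qed
    also have "\<dots> \<le> C1 * (\<rho> powr \<eta> + (\<rho> powr (2 * \<eta>) / \<theta>) / \<rho> powr \<eta>)"
      using C1 2 \<rho> by (intro mult_left_mono add_left_mono divide_right_mono) auto
    also have "(\<rho> powr (2 * \<eta>) / \<theta>) / \<rho> powr \<eta> = \<rho> powr \<eta> / \<theta>"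
      using \<rho> \<theta> powr_add[of \<rho> \<eta> \<eta>] by (simp add: field_simps)
    finally show ?thesis by (simp add: algebra_simps)
  qed
  show ?thesis
  proof (rule that)
    show "1 \<le> max 1 (C1 * (1 + 1 / \<theta>))" by simp
    show "0 < \<eta>" by fact
    fix \<rho> :: real and k :: nat assume \<rho>: "0 < \<rho>" and k: "1 \<le> k"
    show "measure M {x. D x ((f ^^ k) x) \<le> \<rho>} \<le> max 1 (C1 * (1 + 1 / \<theta>)) * \<rho> powr \<eta>"
    proof (cases "\<rho> < 1")
      case True
      have "C1 * (1 + 1 / \<theta>) * \<rho> powr \<eta> \<le> max 1 (C1 * (1 + 1 / \<theta>)) * \<rho> powr \<eta>"
        by (intro mult_right_mono) auto
      then show ?thesis using small[OF \<rho> True k] by linarith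
    next
      case False
      then have "1 \<le> \<rho> powr \<eta>" using \<eta> by (simp add: ge_one_powr_ge_zero)
      then have "1 * 1 \<le> max 1 (C1 * (1 + 1 / \<theta>)) * \<rho> powr \<eta>" by (intro mult_mono) auto
      then show ?thesis using prob_le_1[of "{x. D x ((f ^^ k) x) \<le> \<rho>}"] by linarith
    qed
  qed
qed


section \<open>Clustered and separated returns\<close>

text \<open>
  One return among widely separated times costs a factor \<open>\<rho>\<^sup>d\<close>. A further return shortly after one
  of these times costs an additional power of \<open>\<rho>\<close>; the observable that detects it has a Lipschitz
  constant exponentially large in the short time, which has to be compensated by \<open>\<theta> ^ m\<close>.
\<close>

lemma cluster_bound:
  obtains C \<eta> \<theta> where "0 < C" "0 < \<eta>" "0 < \<theta>" "\<theta> < 1"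
    "\<And>p c k m n \<rho>. p \<le> r \<Longrightarrow> c \<le> p \<Longrightarrow> 1 \<le> n \<Longrightarrow> 0 < \<rho> \<Longrightarrow> \<rho> \<le> 1 \<Longrightarrow> k 0 = 0 \<Longrightarrow>
        (\<And>j. j < p \<Longrightarrow> k j + m \<le> k (Suc j)) \<Longrightarrow>
        measure M {x. (\<forall>i\<in>{1..p}. D x ((f ^^ k i) x) \<le> \<rho>) \<and>
            D ((f ^^ k c) x) ((f ^^ n) ((f ^^ k c) x)) \<le> 2 * \<rho>}
          \<le> C * (\<rho> ^ (d * p) * \<rho> powr \<eta> + \<theta> ^ m * L ^ n / \<rho>)"
proof -
  obtain C1 \<eta> where C1: "1 \<le> C1" "0 < \<eta>" and
    short: "\<And>\<rho> k. 0 < \<rho> \<Longrightarrow> 1 \<le> k \<Longrightarrow> measure M {x. D x ((f ^^ k) x) \<le> \<rho>} \<le> C1 * \<rho> powr \<eta>"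
    by (rule short_returns) blast
  obtain C0 \<theta> where C0: "0 < C0" and \<theta>: "0 < \<theta>" "\<theta> < 1" and
    mix: "\<And>p. 1 \<le> p \<Longrightarrow> p \<le> r \<Longrightarrow> mixes D f M p C0 \<theta>"
    by (rule uniform_mixing[of r]) blast
  define Bd where "Bd = max 1 (B * 2 ^ d)"
  define C where "C = Bd ^ r * (C1 * 4 powr \<eta>) + C0 * (real r + 2)"
  have Bd: "1 \<le> Bd" "B * 2 ^ d \<le> Bd" by (auto simp: Bd_def)
  have Cpos: "0 < C" unfolding C_def using Bd C0 C1 by (intro add_nonneg_pos mult_pos_pos) auto
  have main: "measure M {x. (\<forall>i\<in>{1..p}. D x ((f ^^ k i) x) \<le> \<rho>) \<and>
            D ((f ^^ k c) x) ((f ^^ n) ((f ^^ k c) x)) \<le> 2 * \<rho>}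
          \<le> C * (\<rho> ^ (d * p) * \<rho> powr \<eta> + \<theta> ^ m * L ^ n / \<rho>)" (is "measure M ?E \<le> _")
    if p: "p \<le> r" and c: "c \<le> p" and n: "1 \<le> n" and \<rho>: "0 < \<rho>" "\<rho> \<le> 1" and k0: "k 0 = 0"
      and gap: "\<And>j. j < p \<Longrightarrow> k j + m \<le> k (Suc j)" for p c k m n \<rho>
  proof -
    \<comment> \<open>The weight is 1 where the return after \<open>n\<close> steps is within \<open>2 \<rho>\<close>, and 0 beyond \<open>4 \<rho>\<close>.\<close>
    define \<psi> where "\<psi> x = ramp (2 * \<rho>) (2 * \<rho>) (D x ((f ^^ n) x))" for x
    have \<psi>01: "0 \<le> \<psi> x \<and> \<psi> x \<le> 1" for x by (simp add: \<psi>_def ramp_nonneg ramp_le_1)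
    have [measurable]: "\<psi> \<in> borel_measurable M"
      unfolding \<psi>_def by (intro measurable_compose[OF _ ramp_measurable]) measurable
    have int\<psi>: "integrable M \<psi>" using \<psi>01 by (intro integrable_const_bound[of _ 1]) auto
    have L1: "1 \<le> L ^ n" using L_ge_1 by simp
    define K where "K = (1 + L ^ n) / (2 * \<rho>)"
    have K0: "0 \<le> K" using \<rho> L1 by (simp add: K_def)
    have \<psi>lip: "\<bar>\<psi> x - \<psi> y\<bar> \<le> K * D x y" for x y
    proof -
      have "\<bar>\<psi> x - \<psi> y\<bar> \<le> \<bar>D x ((f ^^ n) x) - D y ((f ^^ n) y)\<bar> / (2 * \<rho>)"
        unfolding \<psi>_def using \<rho> by (intro ramp_lipschitz) auto
      also have "\<dots> \<le> (D x y + L ^ n * D x y) / (2 * \<rho>)"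
        using D_reverse_triangle[of x "(f ^^ n) x" y "(f ^^ n) y"] funpow_lipschitz[of n x y] \<rho>
        by (intro divide_right_mono) auto
      finally show ?thesis by (simp add: K_def algebra_simps add_divide_distrib)
    qed
    have int_\<psi>_le: "(\<integral>x. \<psi> x \<partial>M) \<le> C1 * 4 powr \<eta> * \<rho> powr \<eta>"
    proof -
      have "(\<integral>x. \<psi> x \<partial>M) \<le> (\<integral>x. of_bool (D x ((f ^^ n) x) \<le> 4 * \<rho>) \<partial>M)"
      proof (intro integral_mono int\<psi> integrable_of_bool return_sets)
        fix x
        have "\<psi> x \<le> of_bool (D x ((f ^^ n) x) < 2 * \<rho> + 2 * \<rho>)"
          unfolding \<psi>_def using \<rho> by (intro ramp_le_indicator) auto
        also have "\<dots> \<le> of_bool (D x ((f ^^ n) x) \<le> 4 * \<rho>)" by auto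
        finally show "\<psi> x \<le> of_bool (D x ((f ^^ n) x) \<le> 4 * \<rho>)" .
      qed
      also have "\<dots> = measure M {x. D x ((f ^^ n) x) \<le> 4 * \<rho>}"
        by (rule measure_as_integral[symmetric]) (rule return_sets)
      also have "\<dots> \<le> C1 * (4 * \<rho>) powr \<eta>" using \<rho> n by (intro short) auto
      finally show ?thesis using \<rho> by (simp add: powr_mult)
    qed
    have E_sets: "?E \<in> sets M"
    proof -
      have "{x\<in>space M. (\<forall>i\<in>{1..p}. D x ((f ^^ k i) x) \<le> \<rho>) \<and>
            D ((f ^^ k c) x) ((f ^^ n) ((f ^^ k c) x)) \<le> 2 * \<rho>} \<in> sets M" by measurable
      then show ?thesis by (simp add: space_UNIV)
    qed
    let ?P = "\<lambda>x. \<Prod>i\<in>{1..p}. ramp \<rho> \<rho> (D x ((f ^^ k i) x))"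
    have P01: "0 \<le> ?P x \<and> ?P x \<le> 1" for x
      by (auto intro!: prod_nonneg prod_le_1 simp: ramp_nonneg ramp_le_1)
    have "measure M ?E = (\<integral>x. of_bool ((\<forall>i\<in>{1..p}. D x ((f ^^ k i) x) \<le> \<rho>) \<and>
            D ((f ^^ k c) x) ((f ^^ n) ((f ^^ k c) x)) \<le> 2 * \<rho>) \<partial>M)"
      by (rule measure_as_integral) (rule E_sets)
    also have "\<dots> \<le> (\<integral>x. \<psi> ((f ^^ k c) x) * ?P x \<partial>M)"
    proof (intro integral_mono integrable_of_bool E_sets)
      show "integrable M (\<lambda>x. \<psi> ((f ^^ k c) x) * ?P x)"
      proof (rule integrable_const_bound[of _ 1])
        show "AE x in M. norm (\<psi> ((f ^^ k c) x) * ?P x) \<le> 1"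
          using \<psi>01 P01 by (intro AE_I2) (auto intro!: mult_le_one simp: abs_mult)
        show "(\<lambda>x. \<psi> ((f ^^ k c) x) * ?P x) \<in> borel_measurable M"
          by (intro borel_measurable_times measurable_compose[OF funpow_measurable \<open>\<psi> \<in> borel_measurable M\<close>]
              borel_measurable_integrable[OF prod_ramp_integrable])
      qed
      fix x
      have "of_bool (\<forall>i\<in>{1..p}. D x ((f ^^ k i) x) \<le> \<rho>) \<le> ?P x"
        by (rule prod_ramp_ge) (use \<rho> in auto)
      moreover have "of_bool (D ((f ^^ k c) x) ((f ^^ n) ((f ^^ k c) x)) \<le> 2 * \<rho>) \<le> \<psi> ((f ^^ k c) x)"
        unfolding \<psi>_def by (rule ramp_ge_indicator) (use \<rho> in auto)
      ultimately have "of_bool (D ((f ^^ k c) x) ((f ^^ n) ((f ^^ k c) x)) \<le> 2 * \<rho>) *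
          of_bool (\<forall>i\<in>{1..p}. D x ((f ^^ k i) x) \<le> \<rho>) \<le> \<psi> ((f ^^ k c) x) * ?P x"
        using \<psi>01 by (intro mult_mono) (auto simp del: of_bool_eq_0_iff)
      then show "of_bool ((\<forall>i\<in>{1..p}. D x ((f ^^ k i) x) \<le> \<rho>) \<and>
            D ((f ^^ k c) x) ((f ^^ n) ((f ^^ k c) x)) \<le> 2 * \<rho>) \<le> \<psi> ((f ^^ k c) x) * ?P x"
        by (simp only: of_bool_conj mult.commute)
    qed
    also have "\<dots> \<le> Bd ^ r * (C1 * 4 powr \<eta>) * (\<rho> ^ (d * p) * \<rho> powr \<eta>) + C0 * (real r + 2) * (\<theta> ^ m * L ^ n / \<rho>)"
    \<comment> \<open>Without large gaps there is nothing to decorrelate: the starting point itself returns early.\<close>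
    proof (cases "p = 0")
      case True
      have "(\<integral>x. \<psi> ((f ^^ k c) x) * ?P x \<partial>M) = (\<integral>x. \<psi> x \<partial>M)"
        using True c k0 by simp
      also have "\<dots> \<le> 1 * (C1 * 4 powr \<eta>) * (\<rho> ^ (d * p) * \<rho> powr \<eta>)"
        using int_\<psi>_le True by simp
      also have "\<dots> \<le> Bd ^ r * (C1 * 4 powr \<eta>) * (\<rho> ^ (d * p) * \<rho> powr \<eta>)"
        using Bd C1 \<rho> by (intro mult_right_mono) auto
      also have "\<dots> \<le> \<dots> + C0 * (real r + 2) * (\<theta> ^ m * L ^ n / \<rho>)"
        using C0 \<theta> \<rho> L1 by auto
      finally show ?thesis .
    next
      case False
      let ?F = "obs p c \<psi> \<rho> \<rho>"
      have "(\<integral>x. \<psi> ((f ^^ k c) x) * ?P x \<partial>M) = (\<integral>x. ?F (\<lambda>j\<in>{..p}. (f ^^ k j) x) \<partial>M)"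
        using obs_along_orbit[OF c, of k, OF k0] by simp
      also have "\<dots> \<le> (\<integral>x. ?F x \<partial>PiM {..p} (\<lambda>_. M)) + C0 * \<theta> ^ m * (1 + (real p / \<rho> + K))"
      proof -
        have "\<bar>(\<integral>x. ?F (\<lambda>j\<in>{..p}. (f ^^ k j) x) \<partial>M) - (\<integral>x. ?F x \<partial>PiM {..p} (\<lambda>_. M))\<bar>
            \<le> C0 * \<theta> ^ m * (1 + (real p / \<rho> + K))"
        proof (rule mixesD[OF mix])
          show "0 \<le> ?F x \<and> ?F x \<le> 1" for x by (rule obs_bounds) (rule \<psi>01)
          show "\<bar>?F x - ?F y\<bar> \<le> (real p / \<rho> + K) * (\<Sum>i\<le>p. D (x i) (y i))" for x y
            by (rule obs_lipschitz[OF \<psi>01 K0 \<psi>lip \<rho>(1) c])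
        qed (use False p \<rho> K0 k0 gap in auto)
        then show ?thesis by linarith
      qed
      also have "(\<integral>x. ?F x \<partial>PiM {..p} (\<lambda>_. M)) \<le> Bd ^ r * (C1 * 4 powr \<eta>) * (\<rho> ^ (d * p) * \<rho> powr \<eta>)"
      proof -
        have "(\<integral>x. ?F x \<partial>PiM {..p} (\<lambda>_. M)) \<le> (Bd * \<rho> ^ d) ^ p * (\<integral>x. \<psi> x \<partial>M)"
        proof (rule obs_integral_weighted[OF _ \<psi>01 _ c])
          show "ramp_mass \<rho> \<rho> x \<le> Bd * \<rho> ^ d" for x
          proof -
            have "ramp_mass \<rho> \<rho> x \<le> B * (\<rho> + \<rho>) ^ d" using \<rho> by (intro ramp_mass_bound) auto
            also have "\<dots> = B * 2 ^ d * \<rho> ^ d" by (simp add: mult_2[symmetric] power_mult_distrib)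
            also have "\<dots> \<le> Bd * \<rho> ^ d" using Bd \<rho> by (intro mult_right_mono) auto
            finally show ?thesis .
          qed
        qed measurable
        also have "\<dots> \<le> (Bd * \<rho> ^ d) ^ p * (C1 * 4 powr \<eta> * \<rho> powr \<eta>)"
          using int_\<psi>_le Bd \<rho> by (intro mult_left_mono) auto
        also have "\<dots> = Bd ^ p * (C1 * 4 powr \<eta>) * (\<rho> ^ (d * p) * \<rho> powr \<eta>)"
          by (simp add: power_mult_distrib power_mult algebra_simps)
        also have "\<dots> \<le> Bd ^ r * (C1 * 4 powr \<eta>) * (\<rho> ^ (d * p) * \<rho> powr \<eta>)"
          using Bd C1 \<rho> p by (intro mult_right_mono power_increasing) auto
        finally show ?thesis .
      qed
      also have "C0 * \<theta> ^ m * (1 + (real p / \<rho> + K)) \<le> C0 * (real r + 2) * (\<theta> ^ m * L ^ n / \<rho>)"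
      proof -
        have "1 + (real p / \<rho> + K) \<le> (real r + 2) * L ^ n / \<rho>"
        proof -
          have "1 \<le> L ^ n / \<rho>" using \<rho> L1 by (simp add: field_simps)
          moreover have "real p / \<rho> \<le> real r * L ^ n / \<rho>"
            using p L1 \<rho> mult_mono[of "real p" "real r" 1 "L ^ n"] by (intro divide_right_mono) auto
          moreover have "K \<le> L ^ n / \<rho>" unfolding K_def using L1 \<rho> by (simp add: field_simps)
          ultimately show ?thesis by (simp add: add_divide_distrib algebra_simps)
        qed
        then have "C0 * \<theta> ^ m * (1 + (real p / \<rho> + K)) \<le> C0 * \<theta> ^ m * ((real r + 2) * L ^ n / \<rho>)"
          using C0 \<theta> by (intro mult_left_mono) auto
        also have "\<dots> = C0 * (real r + 2) * (\<theta> ^ m * L ^ n / \<rho>)" by (simp add: ac_simps)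
        finally show ?thesis .
      qed
      finally show ?thesis by simp
    qed
    also have "\<dots> \<le> C * (\<rho> ^ (d * p) * \<rho> powr \<eta> + \<theta> ^ m * L ^ n / \<rho>)"
    proof -
      have "Bd ^ r * (C1 * 4 powr \<eta>) * (\<rho> ^ (d * p) * \<rho> powr \<eta>) \<le> C * (\<rho> ^ (d * p) * \<rho> powr \<eta>)"
        unfolding C_def using C0 \<rho> by (intro mult_right_mono) auto
      moreover have "C0 * (real r + 2) * (\<theta> ^ m * L ^ n / \<rho>) \<le> C * (\<theta> ^ m * L ^ n / \<rho>)"
        unfolding C_def using Bd C1 \<rho> \<theta> L1 by (intro mult_right_mono) auto
      ultimately show ?thesis by (simp only: distrib_left add_mono)
    qed
    finally show ?thesis .
  qed
  show ?thesis by (rule that[OF Cpos C1(2) \<theta> main])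
qed

text \<open>Widely separated returns behave like independent ones, given the starting point.\<close>

lemma separated_returns:
  obtains C \<theta> where "0 < C" "0 < \<theta>" "\<theta> < 1"
    "\<And>k m \<rho> w. 0 < w \<Longrightarrow> k 0 = 0 \<Longrightarrow> (\<And>j. j < r \<Longrightarrow> k j + m \<le> k (Suc j)) \<Longrightarrow>
        measure M {x. \<forall>i\<in>{1..r}. D x ((f ^^ k i) x) \<le> \<rho>}
          \<le> (\<integral>x. ramp_mass \<rho> w x ^ r \<partial>M) + C * \<theta> ^ m * (1 + real r / w)"
    "\<And>k m \<rho> w. 0 < w \<Longrightarrow> k 0 = 0 \<Longrightarrow> (\<And>j. j < r \<Longrightarrow> k j + m \<le> k (Suc j)) \<Longrightarrow>
        (\<integral>x. ramp_mass (\<rho> - w) w x ^ r \<partial>M) - C * \<theta> ^ m * (1 + real r / w)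
          \<le> measure M {x. \<forall>i\<in>{1..r}. D x ((f ^^ k i) x) \<le> \<rho>}"
proof -
  obtain C0 \<theta> where C0: "0 < C0" and \<theta>: "0 < \<theta>" "\<theta> < 1" and
    mix: "\<And>p. 1 \<le> p \<Longrightarrow> p \<le> r \<Longrightarrow> mixes D f M p C0 \<theta>"
    by (rule uniform_mixing[of r]) blast
  have compare: "\<bar>(\<integral>x. (\<Prod>i\<in>{1..r}. ramp a w (D x ((f ^^ k i) x))) \<partial>M) - (\<integral>x. ramp_mass a w x ^ r \<partial>M)\<bar>
      \<le> C0 * \<theta> ^ m * (1 + real r / w)"
    if w: "0 < w" and k0: "k 0 = 0" and gap: "\<And>j. j < r \<Longrightarrow> k j + m \<le> k (Suc j)" for a w k m
  proof (cases "r = 0")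
    case True
    then show ?thesis using C0 \<theta> by (simp add: prob_space)
  next
    case False
    let ?F = "obs r 0 (\<lambda>_. 1) a w"
    have "\<bar>(\<integral>x. ?F (\<lambda>j\<in>{..r}. (f ^^ k j) x) \<partial>M) - (\<integral>x. ?F x \<partial>PiM {..r} (\<lambda>_. M))\<bar>
        \<le> C0 * \<theta> ^ m * (1 + real r / w)"
    proof (rule mixesD[OF mix])
      show "0 \<le> ?F x \<and> ?F x \<le> 1" for x by (rule obs_bounds) simp
      show "\<bar>?F x - ?F y\<bar> \<le> real r / w * (\<Sum>i\<le>r. D (x i) (y i))" for x y
        using obs_lipschitz[of "\<lambda>_. 1" 0 w 0 r a x y] w by simp
    qed (use False w k0 gap in auto)
    then show ?thesis
      using obs_along_orbit[of 0 r k "\<lambda>_. 1" a w] k0 by (simp add: obs_integral_unweighted)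
  qed
  show ?thesis
  proof (rule that[OF C0 \<theta>])
    fix k :: "nat \<Rightarrow> nat" and m :: nat and \<rho> w :: real
    assume w: "0 < w" and k: "k 0 = 0" "\<And>j. j < r \<Longrightarrow> k j + m \<le> k (Suc j)"
    have "measure M {x. \<forall>i\<in>{1..r}. D x ((f ^^ k i) x) \<le> \<rho>}
        \<le> (\<integral>x. (\<Prod>i\<in>{1..r}. ramp \<rho> w (D x ((f ^^ k i) x))) \<partial>M)"
      unfolding measure_as_integral[OF joint_return_sets]
      by (intro integral_mono integrable_of_bool joint_return_sets prod_ramp_integrable prod_ramp_ge w)
    then show "measure M {x. \<forall>i\<in>{1..r}. D x ((f ^^ k i) x) \<le> \<rho>}
          \<le> (\<integral>x. ramp_mass \<rho> w x ^ r \<partial>M) + C0 * \<theta> ^ m * (1 + real r / w)"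
      using compare[OF w k, of \<rho>] by linarith
    have "(\<integral>x. (\<Prod>i\<in>{1..r}. ramp (\<rho> - w) w (D x ((f ^^ k i) x))) \<partial>M)
        \<le> measure M {x. \<forall>i\<in>{1..r}. D x ((f ^^ k i) x) \<le> \<rho>}"
      unfolding measure_as_integral[OF joint_return_sets]
      using prod_ramp_le[OF w, where a = "\<rho> - w" and p = r]
      by (intro integral_mono integrable_of_bool joint_return_sets prod_ramp_integrable) simp
    then show "(\<integral>x. ramp_mass (\<rho> - w) w x ^ r \<partial>M) - C0 * \<theta> ^ m * (1 + real r / w)
          \<le> measure M {x. \<forall>i\<in>{1..r}. D x ((f ^^ k i) x) \<le> \<rho>}"
      using compare[OF w k, of "\<rho> - w"] by linarith
  qed
qed

lemma \<gamma>_nonneg: "0 \<le> \<gamma> x"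
  by (rule tendsto_lowerbound[OF ball_asymp]) 
    (auto simp: eventually_at_right_field intro!: exI[of _ 1])

lemma \<gamma>_le_B: "\<gamma> x \<le> B"
proof (rule tendsto_upperbound[OF ball_asymp])
  show "\<forall>\<^sub>F \<rho> in at_right 0. measure M {y. D x y < \<rho>} / \<rho> ^ d \<le> B"
    unfolding eventually_at_right_field
    using ball_bound by (auto intro!: exI[of _ 1] simp: divide_le_eq)
qed auto

lemma ball_mass_measurable [measurable]: "(\<lambda>x. measure M {y. D x y < \<rho>}) \<in> borel_measurable M"
proof -
  have "{z. case_prod D z < \<rho>} \<in> sets (M \<Otimes>\<^sub>M M)"
  proof -
    have "{z \<in> space (M \<Otimes>\<^sub>M M). case_prod D z < \<rho>} \<in> sets (M \<Otimes>\<^sub>M M)"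
      using D_measurable by measurable
    then show ?thesis by (simp add: space_pair_measure space_UNIV)
  qed
  from measurable_emeasure_Pair[OF this]
  have "(\<lambda>x. emeasure M {y. D x y < \<rho>}) \<in> borel_measurable M" by (simp add: vimage_def)
  then show ?thesis unfolding measure_def by measurable
qed

lemma \<gamma>_measurable [measurable]: "\<gamma> \<in> borel_measurable M"
proof (rule borel_measurable_LIMSEQ_real)
  let ?u = "\<lambda>n. inverse (real (Suc n))"
  have "filterlim ?u (at_right 0) sequentially"
    unfolding filterlim_at using LIMSEQ_inverse_real_of_nat by simp
  from filterlim_compose[OF ball_asymp this]
  show "(\<lambda>n. measure M {y. D x y < ?u n} / ?u n ^ d) \<longlonglongrightarrow> \<gamma> x" for x .
  show "(\<lambda>x. measure M {y. D x y < ?u n} / ?u n ^ d) \<in> borel_measurable M" for n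
    by measurable
qed

text \<open>
  The bound on the measure of balls gives a dominating constant, so that pointwise asymptotics
  suffice. Radii \<open>\<rho> + O(\<rho>\<^sup>2)\<close> have the same asymptotics as \<open>\<rho>\<close>.
\<close>

lemma ramp_mass_power_limit:
  assumes \<alpha>: "\<alpha> = 0 \<or> \<alpha> = (1::real)"
  shows "((\<lambda>\<rho>. (\<integral>x. ramp_mass (\<rho> - \<alpha> * \<rho>\<^sup>2) (\<rho>\<^sup>2) x ^ r \<partial>M) / \<rho> ^ (d * r)) \<longlongrightarrow> (\<integral>x. \<gamma> x ^ r \<partial>M)) (at_right 0)"
proof -
  let ?m = "\<lambda>\<rho> x. ramp_mass (\<rho> - \<alpha> * \<rho>\<^sup>2) (\<rho>\<^sup>2) x"
  have sq: "\<rho>\<^sup>2 < \<rho>" if "0 < \<rho>" "\<rho> < 1" for \<rho> :: real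
    using that by (simp add: power2_eq_square)
  have scaled: "((\<lambda>\<rho>. measure M {y. D x y < \<rho> + \<beta> * \<rho>\<^sup>2} / \<rho> ^ d) \<longlongrightarrow> \<gamma> x) (at_right 0)"
    if \<beta>: "\<bar>\<beta>\<bar> \<le> 1" for x \<beta>
  proof -
    have pos: "0 < \<rho> + \<beta> * \<rho>\<^sup>2" if "0 < \<rho>" "\<rho> < 1" for \<rho> :: real
    proof -
      have "\<bar>\<beta> * \<rho>\<^sup>2\<bar> \<le> 1 * \<rho>\<^sup>2" unfolding abs_mult using \<beta> by (intro mult_mono) auto
      then show ?thesis using sq[OF that] by linarith
    qed
    have "((\<lambda>\<rho>. \<rho> + \<beta> * \<rho>\<^sup>2) \<longlongrightarrow> 0 + \<beta> * 0\<^sup>2) (at_right 0)" by (intro tendsto_intros)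
    moreover have "\<forall>\<^sub>F \<rho> in at_right 0. 0 < \<rho> + \<beta> * \<rho>\<^sup>2"
      using pos unfolding eventually_at_right_field by (intro exI[of _ 1]) auto
    ultimately have "filterlim (\<lambda>\<rho>. \<rho> + \<beta> * \<rho>\<^sup>2) (at_right 0) (at_right 0)"
      by (auto simp: filterlim_at elim!: eventually_mono)
    from filterlim_compose[OF ball_asymp this]
    have 1: "((\<lambda>\<rho>. measure M {y. D x y < \<rho> + \<beta> * \<rho>\<^sup>2} / (\<rho> + \<beta> * \<rho>\<^sup>2) ^ d) \<longlongrightarrow> \<gamma> x) (at_right 0)" .
    have "((\<lambda>\<rho>. (1 + \<beta> * \<rho>) ^ d) \<longlongrightarrow> (1 + \<beta> * 0) ^ d) (at_right 0)" by (intro tendsto_intros)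
    from tendsto_mult[OF 1 this]
    have "((\<lambda>\<rho>. measure M {y. D x y < \<rho> + \<beta> * \<rho>\<^sup>2} / (\<rho> + \<beta> * \<rho>\<^sup>2) ^ d * (1 + \<beta> * \<rho>) ^ d) \<longlongrightarrow> \<gamma> x) (at_right 0)"
      by simp
    then show ?thesis
    proof (rule Lim_transform_eventually)
      show "\<forall>\<^sub>F \<rho> in at_right 0. measure M {y. D x y < \<rho> + \<beta> * \<rho>\<^sup>2} / (\<rho> + \<beta> * \<rho>\<^sup>2) ^ d * (1 + \<beta> * \<rho>) ^ d
          = measure M {y. D x y < \<rho> + \<beta> * \<rho>\<^sup>2} / \<rho> ^ d"
        unfolding eventually_at_right_field
      proof (intro exI[of _ 1] conjI allI impI)
        fix \<rho> :: real assume \<rho>: "0 < \<rho>" "\<rho> < 1"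
        have "\<rho> + \<beta> * \<rho>\<^sup>2 = \<rho> * (1 + \<beta> * \<rho>)" by (simp add: algebra_simps power2_eq_square)
        then show "measure M {y. D x y < \<rho> + \<beta> * \<rho>\<^sup>2} / (\<rho> + \<beta> * \<rho>\<^sup>2) ^ d * (1 + \<beta> * \<rho>) ^ d
          = measure M {y. D x y < \<rho> + \<beta> * \<rho>\<^sup>2} / \<rho> ^ d"
          using pos[OF \<rho>] \<rho> by (auto simp: power_mult_distrib zero_less_mult_iff)
      qed simp
    qed
  qed
  have lim: "((\<lambda>\<rho>. ?m \<rho> x / \<rho> ^ d) \<longlongrightarrow> \<gamma> x) (at_right 0)" for x
  proof (rule tendsto_sandwich)
    show "((\<lambda>\<rho>. measure M {y. D x y < \<rho> + (- \<alpha>) * \<rho>\<^sup>2} / \<rho> ^ d) \<longlongrightarrow> \<gamma> x) (at_right 0)"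
      "((\<lambda>\<rho>. measure M {y. D x y < \<rho> + (1 - \<alpha>) * \<rho>\<^sup>2} / \<rho> ^ d) \<longlongrightarrow> \<gamma> x) (at_right 0)"
      using \<alpha> by (intro scaled; auto)+
    show "\<forall>\<^sub>F \<rho> in at_right 0. measure M {y. D x y < \<rho> + (- \<alpha>) * \<rho>\<^sup>2} / \<rho> ^ d \<le> ?m \<rho> x / \<rho> ^ d"
      unfolding eventually_at_right_field
      using ball_le_ramp_mass by (auto intro!: exI[of _ 1] divide_right_mono)
    show "\<forall>\<^sub>F \<rho> in at_right 0. ?m \<rho> x / \<rho> ^ d \<le> measure M {y. D x y < \<rho> + (1 - \<alpha>) * \<rho>\<^sup>2} / \<rho> ^ d"
      unfolding eventually_at_right_field
    proof (intro exI[of _ 1] conjI allI impI)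
      fix \<rho> :: real assume \<rho>: "0 < \<rho>" "\<rho> < 1"
      have eq: "\<rho> - \<alpha> * \<rho>\<^sup>2 + \<rho>\<^sup>2 = \<rho> + (1 - \<alpha>) * \<rho>\<^sup>2" by (simp add: algebra_simps)
      show "?m \<rho> x / \<rho> ^ d \<le> measure M {y. D x y < \<rho> + (1 - \<alpha>) * \<rho>\<^sup>2} / \<rho> ^ d"
        using ramp_mass_le_ball[of "\<rho>\<^sup>2" "\<rho> - \<alpha> * \<rho>\<^sup>2" x, unfolded eq] \<rho>
        by (intro divide_right_mono) auto
    qed simp
  qed
  have bound: "?m \<rho> x / \<rho> ^ d \<le> B * 2 ^ d" if \<rho>: "0 < \<rho>" "\<rho> < 1" for \<rho> x
  proof -
    have "0 \<le> \<alpha> * \<rho>\<^sup>2" "\<alpha> * \<rho>\<^sup>2 \<le> \<rho>\<^sup>2" using \<alpha> by auto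
    then have pos: "0 < \<rho> - \<alpha> * \<rho>\<^sup>2 + \<rho>\<^sup>2" "\<rho> - \<alpha> * \<rho>\<^sup>2 + \<rho>\<^sup>2 \<le> 2 * \<rho>" using sq[OF \<rho>] \<rho> by linarith+
    have "?m \<rho> x \<le> B * (\<rho> - \<alpha> * \<rho>\<^sup>2 + \<rho>\<^sup>2) ^ d" using pos \<rho> by (intro ramp_mass_bound) auto
    also have "\<dots> \<le> B * (2 * \<rho>) ^ d" using pos B_pos by (intro mult_left_mono power_mono) auto
    finally show ?thesis using \<rho> by (simp add: power_mult_distrib divide_le_eq)
  qed
  have "((\<lambda>\<rho>. (\<integral>x. (?m \<rho> x / \<rho> ^ d) ^ r \<partial>M)) \<longlongrightarrow> (\<integral>x. \<gamma> x ^ r \<partial>M)) (at_right 0)"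
    unfolding filterlim_at_right_to_top
  proof (rule integral_dominated_convergence_at_top[where w="\<lambda>_. (B * 2 ^ d) ^ r"])
    show "integrable M (\<lambda>_. (B * 2 ^ d) ^ r)" by simp
    show "\<forall>\<^sub>F t in at_top. AE x in M. norm ((?m (inverse t) x / inverse t ^ d) ^ r) \<le> (B * 2 ^ d) ^ r"
      using eventually_gt_at_top[of 1]
    proof eventually_elim
      fix t :: real assume t: "1 < t"
      then have "0 < inverse t" "inverse t < 1" by (auto simp: field_simps)
      then show "AE x in M. norm ((?m (inverse t) x / inverse t ^ d) ^ r) \<le> (B * 2 ^ d) ^ r"
        using bound[of "inverse t"] ramp_mass_nonneg
        by (intro AE_I2) (auto simp: norm_power intro!: power_mono)
    qed
    show "AE x in M. ((\<lambda>t. (?m (inverse t) x / inverse t ^ d) ^ r) \<longlongrightarrow> \<gamma> x ^ r) at_top"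
      using lim unfolding filterlim_at_right_to_top by (intro AE_I2 tendsto_power)
  qed measurable
  then show ?thesis by (simp add: power_divide power_mult)
qed

end

section \<open>Gaps between the elements of a finite set of times\<close>

text \<open>The elements of \<open>S\<close> in increasing order, numbered from 1; the starting time 0 gets number 0.\<close>

definition visit_time :: "nat set \<Rightarrow> nat \<Rightarrow> nat" where
  "visit_time S j = (0 # sorted_list_of_set S) ! j"

definition gap :: "nat set \<Rightarrow> nat \<Rightarrow> nat" where
  "gap S j = visit_time S (Suc j) - visit_time S j"

definition time_sets :: "nat \<Rightarrow> nat \<Rightarrow> nat set set" where
  "time_sets T r = {S. S \<subseteq> {1..T} \<and> card S = r}"

lemma finite_time_sets: "finite (time_sets T r)"
  unfolding time_sets_def by (rule finite_subset[of _ "Pow {1..T}"]) auto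

lemma card_time_sets: "card (time_sets T r) = T choose r"
  unfolding time_sets_def using n_subsets[of "{1..T}" r] by simp

lemma visit_time_0: "visit_time S 0 = 0"
  by (simp add: visit_time_def)

lemma visit_time_image:
  assumes "S \<in> time_sets T r"
  shows "visit_time S ` {1..r} = S"
proof -
  have fin: "finite S" using assms by (auto simp: time_sets_def intro: finite_subset)
  have "visit_time S ` {1..r} = visit_time S ` Suc ` {..<r}"
    by (metis image_Suc_lessThan)
  also have "\<dots> = (\<lambda>j. sorted_list_of_set S ! j) ` {..<r}"
    by (simp add: image_image visit_time_def)
  also have "\<dots> = set (sorted_list_of_set S)"
    using assms fin by (auto simp: time_sets_def set_conv_nth image_iff)
  finally show ?thesis using fin by simp
qed

lemma visit_time_in:
  assumes "S \<in> time_sets T r" "1 \<le> j" "j \<le> r"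
  shows "visit_time S j \<in> S"
  using visit_time_image[OF assms(1)] assms(2,3) by (metis atLeastAtMost_iff imageI)

lemma visit_time_less_Suc:
  assumes S: "S \<in> time_sets T r" and j: "j < r"
  shows "visit_time S j < visit_time S (Suc j)"
proof (cases j)
  case 0
  have "visit_time S (Suc 0) \<in> S" using visit_time_in[OF S] j by auto
  then show ?thesis using 0 S by (auto simp: time_sets_def visit_time_0)
next
  case (Suc i)
  have "finite S" "card S = r" using S by (auto simp: time_sets_def intro: finite_subset)
  then show ?thesis using Suc j
    by (auto simp: visit_time_def intro!: sorted_wrt_nth_less[OF sorted_list_of_set.strict_sorted_key_list_of_set])
qed

lemma visit_time_mono:
  assumes S: "S \<in> time_sets T r" and "i \<le> j" "j \<le> r"
  shows "visit_time S i \<le> visit_time S j"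
  using assms(2,3)
proof (induction j rule: dec_induct)
  case (step n)
  then show ?case using visit_time_less_Suc[OF S, of n] by simp
qed simp

lemma visit_time_Suc:
  assumes "S \<in> time_sets T r" "j < r"
  shows "visit_time S (Suc j) = visit_time S j + gap S j"
  using visit_time_less_Suc[OF assms] by (simp add: gap_def)

lemma gap_bounds:
  assumes S: "S \<in> time_sets T r" and j: "j < r"
  shows "1 \<le> gap S j" "gap S j \<le> T"
proof -
  show "1 \<le> gap S j" using visit_time_less_Suc[OF S j] by (simp add: gap_def)
  have "visit_time S (Suc j) \<in> S" using visit_time_in[OF S] j by auto
  then have "visit_time S (Suc j) \<le> T" using S by (auto simp: time_sets_def)
  then show "gap S j \<le> T" by (simp add: gap_def)
qed

lemma visit_time_eq_sum_gaps:
  assumes S: "S \<in> time_sets T r" and "j \<le> r"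
  shows "visit_time S j = (\<Sum>i<j. gap S i)"
  using assms(2) by (induction j) (auto simp: visit_time_0 visit_time_Suc[OF S])

lemma gaps_inj: "inj_on (\<lambda>S. restrict (gap S) {..<r}) (time_sets T r)"
proof (rule inj_onI)
  fix S S' assume S: "S \<in> time_sets T r" "S' \<in> time_sets T r"
    and eq: "restrict (gap S) {..<r} = restrict (gap S') {..<r}"
  have gap_eq: "gap S i = gap S' i" if "i < r" for i using fun_cong[OF eq, of i] that by simp
  have "visit_time S j = visit_time S' j" if "j \<in> {1..r}" for j
    using that by (simp add: visit_time_eq_sum_gaps[OF S(1)] visit_time_eq_sum_gaps[OF S(2)] gap_eq)
  then have "visit_time S ` {1..r} = visit_time S' ` {1..r}" by (intro image_cong) auto
  then show "S = S'" by (simp only: visit_time_image[OF S(1)] visit_time_image[OF S(2)])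
qed

text \<open>A set of times is recovered from its gaps, so short gaps reduce the number of choices.\<close>

lemma card_small_gaps:
  assumes "Q \<subseteq> {..<r}"
  shows "card {S \<in> time_sets T r. \<forall>j\<in>{..<r} - Q. gap S j < m} \<le> T ^ card Q * m ^ (r - card Q)"
proof -
  let ?A = "{S \<in> time_sets T r. \<forall>j\<in>{..<r} - Q. gap S j < m}"
  let ?g = "\<lambda>S. restrict (gap S) {..<r}"
  let ?X = "\<lambda>j. if j \<in> Q then {1..T} else {..<m}"
  have fin: "finite (PiE {..<r} ?X)" by (intro finite_PiE) auto
  have "card ?A = card (?g ` ?A)"
    by (rule card_image[symmetric]) (rule inj_on_subset[OF gaps_inj], auto)
  also have "\<dots> \<le> card (PiE {..<r} ?X)"
  proof (intro card_mono fin image_subsetI)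
    fix S assume S: "S \<in> ?A"
    then have "gap S j \<in> ?X j" if "j < r" for j
      using gap_bounds[of S T r j] that by auto
    then show "?g S \<in> PiE {..<r} ?X" by (simp add: restrict_PiE_iff)
  qed
  also have "\<dots> = (\<Prod>j\<in>{..<r}. if j \<in> Q then T else m)"
    by (subst card_PiE) (auto intro!: prod.cong)
  also have "\<dots> = (\<Prod>j\<in>{..<r} \<inter> Q. T) * (\<Prod>j\<in>{..<r} \<inter> - Q. m)"
    by (subst prod.If_cases) auto
  also have "\<dots> = T ^ card Q * m ^ (r - card Q)"
  proof -
    have "{..<r} \<inter> Q = Q" "{..<r} \<inter> - Q = {..<r} - Q" using assms by auto
    then show ?thesis using assms by (simp add: card_Diff_subset finite_subset[OF assms])
  qed
  finally show ?thesis .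
qed

text \<open>
  There are \<open>r + 1\<close> disjoint ranges and only \<open>r\<close> values, so one range is avoided: the values split
  into small and large ones with a wide range between them.
\<close>

lemma scale_without_gap:
  fixes m :: "nat \<Rightarrow> nat" and a :: "nat \<Rightarrow> nat"
  assumes mono: "\<And>s. m s \<le> m (Suc s)"
  obtains s where "s \<le> r" "\<And>j. j < r \<Longrightarrow> a j < m s \<or> m (Suc s) \<le> a j"
proof (rule ccontr)
  assume "\<not> thesis"
  then have "\<forall>s\<in>{..r}. \<exists>j. j < r \<and> m s \<le> a j \<and> a j < m (Suc s)" using that by (metis atMost_iff not_le)
  then obtain j where j: "\<And>s. s \<le> r \<Longrightarrow> j s < r \<and> m s \<le> a (j s) \<and> a (j s) < m (Suc s)"
    by (metis atMost_iff)
  have "inj_on j {..r}"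
  proof (rule linorder_inj_onI')
    fix s s' assume s: "s \<in> {..r}" "s' \<in> {..r}" "s < s'"
    have "m (Suc s) \<le> m s'" using lift_Suc_mono_le[of m, OF mono, of "Suc s" s'] s by simp
    then have "a (j s) < a (j s')" using j[of s] j[of s'] s by force
    then show "j s \<noteq> j s'" by auto
  qed
  moreover have "j ` {..r} \<subseteq> {..<r}" using j by auto
  ultimately have "card {..r} \<le> card {..<r}" by (metis card_inj_on_le finite_lessThan)
  then show False by simp
qed

context mixing_returns begin

definition joint :: "nat set \<Rightarrow> real \<Rightarrow> 'a set" where
  "joint S \<rho> = {x. \<forall>n\<in>S. D x ((f ^^ n) x) \<le> \<rho>}"

lemma joint_eq:
  assumes "S \<in> time_sets T r"
  shows "joint S \<rho> = {x. \<forall>i\<in>{1..r}. D x ((f ^^ visit_time S i) x) \<le> \<rho>}"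
proof -
  have "(\<forall>n\<in>S. D x ((f ^^ n) x) \<le> \<rho>) \<longleftrightarrow> (\<forall>i\<in>{1..r}. D x ((f ^^ visit_time S i) x) \<le> \<rho>)" for x
    using visit_time_image[OF assms] by (metis (no_types, lifting) image_iff)
  then show ?thesis by (simp add: joint_def)
qed

lemma joint_sets: "finite S \<Longrightarrow> joint S \<rho> \<in> sets M"
proof -
  assume "finite S"
  then have "{x \<in> space M. \<forall>n\<in>S. D x ((f ^^ n) x) \<le> \<rho>} \<in> sets M"
    by (intro sets.sets_Collect_finite_All) (simp_all add: return_sets space_UNIV)
  then show ?thesis by (simp add: joint_def space_UNIV)
qed

text \<open>
  The large gaps cut the times into clusters, and only the first time of each cluster is kept. At the
  first short gap two times of one cluster are adjacent; as both points are close to \<open>x\<close>, they are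
  close to each other, and the cluster starts with a short return.
\<close>

lemma clustered_returns:
  assumes bound: "\<And>p c k n. p \<le> r \<Longrightarrow> c \<le> p \<Longrightarrow> 1 \<le> n \<Longrightarrow> k 0 = 0 \<Longrightarrow>
        (\<And>j. j < p \<Longrightarrow> k j + m \<le> k (Suc j)) \<Longrightarrow>
        measure M {x. (\<forall>i\<in>{1..p}. D x ((f ^^ k i) x) \<le> \<rho>) \<and>
            D ((f ^^ k c) x) ((f ^^ n) ((f ^^ k c) x)) \<le> 2 * \<rho>} \<le> \<beta> p n"
    and \<rho>: "0 < \<rho>" and S: "S \<in> time_sets T r" and Q: "Q \<subset> {..<r}"
    and far: "\<And>j. j \<in> Q \<Longrightarrow> m \<le> gap S j"
  obtains j where "j \<in> {..<r} - Q" "measure M (joint S \<rho>) \<le> \<beta> (card Q) (gap S j)"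
proof -
  \<comment> \<open>All gaps before the first short one are large, so the time before it starts a cluster.\<close>
  define j where "j = Min ({..<r} - Q)"
  have ne: "{..<r} - Q \<noteq> {}" "finite ({..<r} - Q)" using Q by auto
  have j: "j \<in> {..<r} - Q" unfolding j_def using Min_in[OF ne(2,1)] .
  have below: "i \<in> Q" if "i < j" for i
    using Min_le[OF ne(2), of i] that j unfolding j_def[symmetric] by force
  have finQ: "finite Q" using Q by (auto intro: finite_subset)
  define qs where "qs = sorted_list_of_set Q"
  define p where "p = card Q"
  have qs: "length qs = p" "set qs = Q" using finQ by (auto simp: qs_def p_def)
  have qs_less: "qs ! i < qs ! i'" if "i < i'" "i' < p" for i i'
    unfolding qs_def using that qs(1)
    by (intro sorted_wrt_nth_less[OF sorted_list_of_set.strict_sorted_key_list_of_set]) (auto simp: qs_def)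
  have qs_in: "qs ! i \<in> Q" if "i < p" for i using qs that nth_mem by metis
  have pr: "p \<le> r" unfolding p_def using card_mono[of "{..<r}" Q] Q by auto
  let ?t = "visit_time S"
  \<comment> \<open>\<open>k i\<close> is the first time of the \<open>i\<close>-th cluster; cluster 0 starts at time 0.\<close>
  define k where "k i = (case i of 0 \<Rightarrow> 0 | Suc i' \<Rightarrow> ?t (Suc (qs ! i')))" for i
  have k_gap: "k i + m \<le> k (Suc i)" if i: "i < p" for i
  proof -
    have q: "qs ! i \<in> Q" "qs ! i < r" using qs_in[OF i] Q by auto
    have "k i \<le> ?t (qs ! i)"
    proof (cases i)
      case (Suc i')
      then have "Suc (qs ! i') \<le> qs ! i" using qs_less[of i' i] i by simp
      then show ?thesis using visit_time_mono[OF S] q Suc by (simp add: k_def)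
    qed (simp add: k_def)
    then show ?thesis using visit_time_Suc[OF S q(2)] far[OF q(1)] by (simp add: k_def)
  qed
  obtain c where c: "c \<le> p" "k c = ?t j"
  proof (cases j)
    case 0
    then show ?thesis using that[of 0] by (simp add: k_def visit_time_0)
  next
    case (Suc i)
    then have "i \<in> set qs" using below qs by auto
    then obtain c' where "c' < p" "qs ! c' = i" using qs(1) by (auto simp: in_set_conv_nth)
    then show ?thesis using that[of "Suc c'"] Suc by (simp add: k_def)
  qed
  have jr: "j < r" using j by auto
  have "joint S \<rho> \<subseteq> {x. (\<forall>i\<in>{1..p}. D x ((f ^^ k i) x) \<le> \<rho>) \<and>
            D ((f ^^ k c) x) ((f ^^ gap S j) ((f ^^ k c) x)) \<le> 2 * \<rho>}"
  proof
    fix x assume "x \<in> joint S \<rho>"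
    then have x: "\<And>i. 1 \<le> i \<Longrightarrow> i \<le> r \<Longrightarrow> D x ((f ^^ ?t i) x) \<le> \<rho>"
      unfolding joint_eq[OF S] by auto
    have "D x ((f ^^ k i) x) \<le> \<rho>" if i: "i \<in> {1..p}" for i
    proof -
      obtain i' where i': "i = Suc i'" using i by (cases i) auto
      then have "qs ! i' < r" using qs_in[of i'] i Q by auto
      then show ?thesis using x[of "Suc (qs ! i')"] i' by (simp add: k_def)
    qed
    moreover have "D ((f ^^ k c) x) ((f ^^ gap S j) ((f ^^ k c) x)) \<le> 2 * \<rho>"
    proof -
      have "(f ^^ gap S j) ((f ^^ k c) x) = (f ^^ ?t (Suc j)) x"
        using visit_time_Suc[OF S jr] c(2) funpow_add[of "gap S j" "?t j" f] by (simp add: add.commute)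
      moreover have "D x ((f ^^ ?t (Suc j)) x) \<le> \<rho>" using x jr by auto
      moreover have "D x ((f ^^ k c) x) \<le> \<rho>"
        using x[of j] jr \<rho> c(2) by (cases "j = 0") (auto simp: visit_time_0 D_refl)
      ultimately show ?thesis
        using D_triangle[of "(f ^^ k c) x" "(f ^^ ?t (Suc j)) x" x] D_sym[of x "(f ^^ k c) x"] by simp
    qed
    ultimately show "x \<in> {x. (\<forall>i\<in>{1..p}. D x ((f ^^ k i) x) \<le> \<rho>) \<and>
            D ((f ^^ k c) x) ((f ^^ gap S j) ((f ^^ k c) x)) \<le> 2 * \<rho>}" by blast
  qed
  then have "measure M (joint S \<rho>) \<le> measure M {x. (\<forall>i\<in>{1..p}. D x ((f ^^ k i) x) \<le> \<rho>) \<and>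
            D ((f ^^ k c) x) ((f ^^ gap S j) ((f ^^ k c) x)) \<le> 2 * \<rho>}"
  proof (rule finite_measure_mono)
    have "{x\<in>space M. (\<forall>i\<in>{1..p}. D x ((f ^^ k i) x) \<le> \<rho>) \<and>
            D ((f ^^ k c) x) ((f ^^ gap S j) ((f ^^ k c) x)) \<le> 2 * \<rho>} \<in> sets M" by measurable
    then show "{x. (\<forall>i\<in>{1..p}. D x ((f ^^ k i) x) \<le> \<rho>) \<and>
            D ((f ^^ k c) x) ((f ^^ gap S j) ((f ^^ k c) x)) \<le> 2 * \<rho>} \<in> sets M"
      by (simp add: space_UNIV)
  qed
  also have "\<dots> \<le> \<beta> p (gap S j)"
    using bound[OF pr c(1) gap_bounds(1)[OF S jr], of k] k_gap by (simp add: k_def)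
  finally show ?thesis using that[OF j] by (simp add: p_def)
qed

text \<open>The binomial coefficient counts the sets of \<open>r\<close> return times.\<close>

lemma binomial_moment_eq:
  "(\<integral>x. real (card {n\<in>{1..T}. D x ((f ^^ n) x) \<le> \<rho>} choose r) \<partial>M)
    = (\<Sum>S\<in>time_sets T r. measure M (joint S \<rho>))"
proof -
  have "real (card {n\<in>{1..T}. D x ((f ^^ n) x) \<le> \<rho>} choose r) = (\<Sum>S\<in>time_sets T r. of_bool (x \<in> joint S \<rho>))"
    for x
  proof -
    let ?H = "{n\<in>{1..T}. D x ((f ^^ n) x) \<le> \<rho>}"
    have "card ?H choose r = card {S. S \<subseteq> ?H \<and> card S = r}" by (simp add: n_subsets)
    also have "{S. S \<subseteq> ?H \<and> card S = r} = {S\<in>time_sets T r. x \<in> joint S \<rho>}"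
      by (auto simp: time_sets_def joint_def)
    finally have "card ?H choose r = card {S\<in>time_sets T r. x \<in> joint S \<rho>}" .
    then show ?thesis using finite_time_sets[of T r] by (simp add: sum_of_bool_eq Int_def)
  qed
  moreover have "(\<integral>x. (\<Sum>S\<in>time_sets T r. of_bool (x \<in> joint S \<rho>)) \<partial>M)
      = (\<Sum>S\<in>time_sets T r. measure M (joint S \<rho>))"
  proof (subst Bochner_Integration.integral_sum)
    fix S assume "S \<in> time_sets T r"
    then have "joint S \<rho> \<in> sets M" by (intro joint_sets) (auto simp: time_sets_def intro: finite_subset)
    then show "integrable M (\<lambda>x. of_bool (x \<in> joint S \<rho>) :: real)"
      by (intro integrable_of_bool) simp
  next
    show "(\<Sum>S\<in>time_sets T r. \<integral>x. of_bool (x \<in> joint S \<rho>) \<partial>M) = (\<Sum>S\<in>time_sets T r. measure M (joint S \<rho>))"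
    proof (rule sum.cong[OF refl])
      fix S assume "S \<in> time_sets T r"
      then have "joint S \<rho> \<in> sets M" by (intro joint_sets) (auto simp: time_sets_def intro: finite_subset)
      then show "(\<integral>x. of_bool (x \<in> joint S \<rho>) \<partial>M) = measure M (joint S \<rho>)"
        using measure_as_integral[of "\<lambda>x. x \<in> joint S \<rho>"] by simp
    qed
  qed
  ultimately show ?thesis by simp
qed

end

lemma choose_limit:
  fixes T :: "'b \<Rightarrow> nat" and \<epsilon> :: "'b \<Rightarrow> real"
  assumes T: "((\<lambda>\<rho>. real (T \<rho>) * \<epsilon> \<rho>) \<longlongrightarrow> \<tau>) F" and \<epsilon>: "(\<epsilon> \<longlongrightarrow> 0) F"
  shows "((\<lambda>\<rho>. real (T \<rho> choose r) * \<epsilon> \<rho> ^ r) \<longlongrightarrow> \<tau> ^ r / fact r) F"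
proof -
  have "real (n choose r) * e ^ r = (\<Prod>i<r. real n * e - real i * e) / fact r" for n and e :: real
  proof -
    have "(\<Prod>i<r. real n * e - real i * e) = (\<Prod>i<r. (real n - real i)) * e ^ r"
      by (simp add: left_diff_distrib[symmetric] prod.distrib)
    then show ?thesis by (simp add: binomial_gbinomial gbinomial_prod_rev atLeast0LessThan)
  qed
  moreover have "((\<lambda>\<rho>. (\<Prod>i<r. real (T \<rho>) * \<epsilon> \<rho> - real i * \<epsilon> \<rho>) / fact r) \<longlongrightarrow> (\<Prod>i<r. \<tau> - real i * 0) / fact r) F"
    by (intro tendsto_intros T \<epsilon>) auto
  ultimately show ?thesis by simp
qed

lemma horizon_bounds:
  assumes "0 < \<tau>" "0 < \<rho>"
  shows "real (nat \<lfloor>\<tau> / \<rho> ^ d\<rfloor>) * \<rho> ^ d \<le> \<tau>" "\<tau> - \<rho> ^ d \<le> real (nat \<lfloor>\<tau> / \<rho> ^ d\<rfloor>) * \<rho> ^ d"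
proof -
  have p: "0 < \<rho> ^ d" "0 \<le> \<tau> / \<rho> ^ d" using assms by auto
  then have "real (nat \<lfloor>\<tau> / \<rho> ^ d\<rfloor>) \<le> \<tau> / \<rho> ^ d" "\<tau> / \<rho> ^ d - 1 \<le> real (nat \<lfloor>\<tau> / \<rho> ^ d\<rfloor>)"
    by linarith+
  moreover define N where "N = real (nat \<lfloor>\<tau> / \<rho> ^ d\<rfloor>)"
  ultimately have "N \<le> \<tau> / \<rho> ^ d" "\<tau> / \<rho> ^ d - 1 \<le> N" by simp_all
  then show "real (nat \<lfloor>\<tau> / \<rho> ^ d\<rfloor>) * \<rho> ^ d \<le> \<tau>" "\<tau> - \<rho> ^ d \<le> real (nat \<lfloor>\<tau> / \<rho> ^ d\<rfloor>) * \<rho> ^ d"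
    unfolding N_def[symmetric] using p by (auto simp: field_simps)
qed

lemma power_tendsto_0_at_right: "1 \<le> d \<Longrightarrow> ((\<lambda>\<rho>::real. \<rho> ^ d) \<longlongrightarrow> 0) (at_right 0)"
  using tendsto_power[of "\<lambda>\<rho>::real. \<rho>" 0 "at_right 0" d] by (simp add: power_0_left)

lemma horizon_limit:
  assumes "0 < \<tau>" "1 \<le> d"
  shows "((\<lambda>\<rho>. real (nat \<lfloor>\<tau> / \<rho> ^ d\<rfloor>) * \<rho> ^ d) \<longlongrightarrow> \<tau>) (at_right 0)"
proof (rule tendsto_sandwich)
  show "((\<lambda>\<rho>. \<tau> - \<rho> ^ d) \<longlongrightarrow> \<tau>) (at_right 0)" "((\<lambda>\<rho>. \<tau>) \<longlongrightarrow> \<tau>) (at_right 0)"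
    using tendsto_diff[OF tendsto_const power_tendsto_0_at_right[OF assms(2)], of \<tau>] by auto
qed (auto simp: eventually_at_right_field horizon_bounds[OF assms(1)] intro!: exI[of _ 1])

text \<open>In terms of \<open>u = \<eta> ln (1 / \<rho>)\<close> this is the decay of \<open>u\<^sup>k / exp u\<close>.\<close>

lemma log_power_limit:
  fixes \<kappa> \<eta> :: real
  assumes "0 \<le> \<kappa>" "0 < \<eta>"
  shows "((\<lambda>\<rho>. real (nat \<lceil>\<kappa> * ln (1 / \<rho>)\<rceil>) ^ k * \<rho> powr \<eta>) \<longlongrightarrow> 0) (at_right 0)"
proof -
  let ?u = "\<lambda>\<rho>::real. \<eta> * ln (1 / \<rho>)"
  have u: "filterlim ?u at_top (at_right 0)"
  proof -
    have "filterlim (\<lambda>\<rho>::real. 1 / \<rho>) at_top (at_right 0)"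
      using filterlim_inverse_at_top_right by (simp add: inverse_eq_divide)
    from filterlim_compose[OF ln_at_top this]
    show ?thesis by (rule filterlim_tendsto_pos_mult_at_top[OF tendsto_const assms(2)])
  qed
  have poly: "((\<lambda>u::real. ((\<kappa> / \<eta> + 1) * u) ^ k / exp u) \<longlongrightarrow> 0) at_top"
    using tendsto_mult_right_zero[OF tendsto_power_div_exp_0[of k], of "(\<kappa> / \<eta> + 1) ^ k"]
    by (simp add: power_mult_distrib)
  have lim: "((\<lambda>\<rho>. ((\<kappa> / \<eta> + 1) * ?u \<rho>) ^ k / exp (?u \<rho>)) \<longlongrightarrow> 0) (at_right 0)"
    using filterlim_compose[OF poly u] .
  have "\<forall>\<^sub>F \<rho> in at_right 0. 1 \<le> ?u \<rho>" using u by (simp add: filterlim_at_top)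
  moreover have "\<forall>\<^sub>F \<rho>::real in at_right 0. 0 < \<rho>" by (simp add: eventually_at_right_less)
  ultimately have "\<forall>\<^sub>F \<rho> in at_right 0. real (nat \<lceil>\<kappa> * ln (1 / \<rho>)\<rceil>) ^ k * \<rho> powr \<eta>
      \<le> ((\<kappa> / \<eta> + 1) * ?u \<rho>) ^ k / exp (?u \<rho>)"
  proof eventually_elim
    fix \<rho> :: real assume \<rho>: "1 \<le> ?u \<rho>" "0 < \<rho>"
    have l: "0 < ln (1 / \<rho>)" using \<rho>(1) assms by (smt (verit) mult_nonneg_nonpos)
    have "real (nat \<lceil>\<kappa> * ln (1 / \<rho>)\<rceil>) \<le> \<kappa> * ln (1 / \<rho>) + 1"
    proof -
      have "0 \<le> \<kappa> * ln (1 / \<rho>)" using l assms by simp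
      then show ?thesis by linarith
    qed
    also have "\<dots> \<le> (\<kappa> / \<eta> + 1) * ?u \<rho>" using \<rho> assms by (simp add: distrib_right)
    finally have "real (nat \<lceil>\<kappa> * ln (1 / \<rho>)\<rceil>) ^ k \<le> ((\<kappa> / \<eta> + 1) * ?u \<rho>) ^ k"
      by (intro power_mono) auto
    moreover have "\<rho> powr \<eta> = 1 / exp (?u \<rho>)"
      using \<rho>(2) by (simp add: powr_def ln_div exp_minus inverse_eq_divide)
    ultimately show "real (nat \<lceil>\<kappa> * ln (1 / \<rho>)\<rceil>) ^ k * \<rho> powr \<eta> \<le> ((\<kappa> / \<eta> + 1) * ?u \<rho>) ^ k / exp (?u \<rho>)"
      by (simp add: divide_right_mono)
  qed
  then show ?thesis by (intro tendsto_sandwich[OF _ _ tendsto_const lim]) auto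
qed

lemma power_log_scale_le:
  fixes \<theta> \<rho> \<kappa> :: real
  assumes "0 < \<theta>" "\<theta> < 1" "0 < \<rho>"
  shows "\<theta> ^ nat \<lceil>\<kappa> * ln (1 / \<rho>)\<rceil> \<le> \<rho> powr (\<kappa> * ln (1 / \<theta>))"
proof -
  have "\<theta> ^ nat \<lceil>\<kappa> * ln (1 / \<rho>)\<rceil> = \<theta> powr real (nat \<lceil>\<kappa> * ln (1 / \<rho>)\<rceil>)"
    using assms by (subst powr_realpow) auto
  also have "\<dots> \<le> \<theta> powr (\<kappa> * ln (1 / \<rho>))" using assms by (intro powr_mono') (auto, linarith)
  also have "\<dots> = \<rho> powr (\<kappa> * ln (1 / \<theta>))" using assms by (simp add: powr_def ln_div)
  finally show ?thesis .
qed

lemma power_log_scale_ge1_le: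
  fixes \<Lambda> \<rho> \<kappa> :: real
  assumes "1 \<le> \<Lambda>" "0 < \<rho>" "\<rho> < 1" "0 \<le> \<kappa>"
  shows "\<Lambda> ^ nat \<lceil>\<kappa> * ln (1 / \<rho>)\<rceil> \<le> \<Lambda> * \<rho> powr (- (\<kappa> * ln \<Lambda>))"
proof -
  have nn: "0 \<le> \<kappa> * ln (1 / \<rho>)" using assms by simp
  have "\<Lambda> ^ nat \<lceil>\<kappa> * ln (1 / \<rho>)\<rceil> = \<Lambda> powr real (nat \<lceil>\<kappa> * ln (1 / \<rho>)\<rceil>)"
    using assms by (subst powr_realpow) auto
  also have "\<dots> \<le> \<Lambda> powr (1 + \<kappa> * ln (1 / \<rho>))" using assms nn by (intro powr_mono) linarith+
  also have "\<dots> = \<Lambda> * \<Lambda> powr (\<kappa> * ln (1 / \<rho>))" using assms by (simp add: powr_add)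
  also have "\<Lambda> powr (\<kappa> * ln (1 / \<rho>)) = \<rho> powr (- (\<kappa> * ln \<Lambda>))" using assms by (simp add: powr_def ln_div)
  finally show ?thesis .
qed

section \<open>Factorial moments of the number of returns\<close>

context mixing_returns begin

text \<open>
  The recursion for the scales makes each scale beat the Lipschitz constant \<open>L\<close> to the power of
  the preceding one, with \<open>\<rho> powr (d r + 2)\<close> to spare.
\<close>

lemma clustered_sum_limit:
  assumes \<tau>: "0 < \<tau>" and \<kappa>0: "0 \<le> \<kappa>0"
  defines "T \<equiv> \<lambda>\<rho>. nat \<lfloor>\<tau> / \<rho> ^ d\<rfloor>"
  shows "((\<lambda>\<rho>. \<Sum>S\<in>{S\<in>time_sets (T \<rho>) r. \<exists>j<r. gap S j < nat \<lceil>\<kappa>0 * ln (1 / \<rho>)\<rceil>}. measure M (joint S \<rho>))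
    \<longlongrightarrow> 0) (at_right 0)"
proof -
  obtain C \<eta> \<theta> where C: "0 < C" and \<eta>: "0 < \<eta>" and \<theta>: "0 < \<theta>" "\<theta> < 1" and
    bound: "\<And>p c k m n \<rho>. p \<le> r \<Longrightarrow> c \<le> p \<Longrightarrow> 1 \<le> n \<Longrightarrow> 0 < \<rho> \<Longrightarrow> \<rho> \<le> 1 \<Longrightarrow> k 0 = 0 \<Longrightarrow>
        (\<And>j. j < p \<Longrightarrow> k j + m \<le> k (Suc j)) \<Longrightarrow>
        measure M {x. (\<forall>i\<in>{1..p}. D x ((f ^^ k i) x) \<le> \<rho>) \<and>
            D ((f ^^ k c) x) ((f ^^ n) ((f ^^ k c) x)) \<le> 2 * \<rho>}
          \<le> C * (\<rho> ^ (d * p) * \<rho> powr \<eta> + \<theta> ^ m * L ^ n / \<rho>)"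
    by (rule cluster_bound[of r]) blast
  define \<beta> where "\<beta> = ln (1 / \<theta>)"
  have \<beta>: "0 < \<beta>" using \<theta> by (simp add: \<beta>_def)
  have lnL: "0 \<le> ln L" using L_ge_1 by simp
  define \<kappa> where "\<kappa> = rec_nat \<kappa>0 (\<lambda>_ k. k + (k * ln L + real (d * r + 2)) / \<beta>)"
  have \<kappa>_simps: "\<kappa> 0 = \<kappa>0" "\<And>s. \<kappa> (Suc s) = \<kappa> s + (\<kappa> s * ln L + real (d * r + 2)) / \<beta>"
    by (simp_all add: \<kappa>_def)
  have \<kappa>_nonneg: "0 \<le> \<kappa> s" for s
    by (induction s) (use \<kappa>0 lnL \<beta> in \<open>auto simp: \<kappa>_simps intro!: add_nonneg_nonneg divide_nonneg_nonneg\<close>)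
  have \<kappa>_mono: "\<kappa> s \<le> \<kappa> (Suc s)" for s
    using \<kappa>_nonneg[of s] lnL \<beta> by (auto simp: \<kappa>_simps intro!: divide_nonneg_nonneg add_nonneg_nonneg)
  define m where "m \<rho> s = nat \<lceil>\<kappa> s * ln (1 / \<rho>)\<rceil>" for \<rho> s
  \<comment> \<open>The mixing error is of order \<open>\<rho>\<close> relative to \<open>\<rho> ^ (d * card Q)\<close>, whence the exponent 1.\<close>
  define \<eta>' where "\<eta>' = min \<eta> 1"
  have \<eta>': "0 < \<eta>'" "\<eta>' \<le> \<eta>" "\<eta>' \<le> 1" using \<eta> by (auto simp: \<eta>'_def)
  define \<Theta> where "\<Theta> \<rho> = (\<Sum>Q\<in>Pow {..<r}. C * (1 + L) * \<tau> ^ card Q * (real (m \<rho> (Suc r)) ^ (r - card Q) * \<rho> powr \<eta>'))" for \<rho>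
  have main: "(\<Sum>S\<in>{S\<in>time_sets (T \<rho>) r. \<exists>j<r. gap S j < m \<rho> 0}. measure M (joint S \<rho>)) \<le> \<Theta> \<rho>"
    if \<rho>: "0 < \<rho>" "\<rho> < 1" for \<rho>
  proof -
    let ?A = "\<lambda>Q. {S \<in> time_sets (T \<rho>) r. \<forall>j\<in>{..<r} - Q. gap S j < m \<rho> (Suc r)}"
    let ?b = "\<lambda>Q. C * (1 + L) * (\<rho> ^ (d * card Q) * \<rho> powr \<eta>')"
    have l: "0 < ln (1 / \<rho>)" using \<rho> by simp
    have m_mono: "m \<rho> s \<le> m \<rho> (Suc s)" for s
      unfolding m_def using \<kappa>_mono[of s] l by (intro nat_mono ceiling_mono mult_right_mono) auto
    have b_nonneg: "0 \<le> ?b Q" for Q using C L_ge_1 \<rho> by auto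
    have "measure M (joint S \<rho>) \<le> (\<Sum>Q\<in>Pow {..<r}. of_bool (S \<in> ?A Q) * ?b Q)"
      if S: "S \<in> time_sets (T \<rho>) r" and bad: "\<exists>j<r. gap S j < m \<rho> 0" for S
    proof -
      obtain s where s: "s \<le> r" "\<And>j. j < r \<Longrightarrow> gap S j < m \<rho> s \<or> m \<rho> (Suc s) \<le> gap S j"
        by (rule scale_without_gap[of "m \<rho>" r "gap S", OF m_mono]) blast
      define Q where "Q = {j. j < r \<and> m \<rho> (Suc s) \<le> gap S j}"
      obtain j0 where j0: "j0 < r" "gap S j0 < m \<rho> 0" using bad by blast
      have "m \<rho> 0 \<le> m \<rho> (Suc s)" using lift_Suc_mono_le[of "m \<rho>", OF m_mono] by simp
      then have "j0 \<notin> Q" using j0 by (auto simp: Q_def)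
      then have Q: "Q \<subset> {..<r}" using j0 by (auto simp: Q_def)
      have small: "gap S j < m \<rho> s" if "j \<in> {..<r} - Q" for j using that s(2)[of j] by (auto simp: Q_def)
      have "m \<rho> s \<le> m \<rho> (Suc r)" using lift_Suc_mono_le[of "m \<rho>", OF m_mono, of s "Suc r"] s(1) by simp
      then have SA: "S \<in> ?A Q" using S small by force
      obtain j where j: "j \<in> {..<r} - Q" and
        le: "measure M (joint S \<rho>) \<le> C * (\<rho> ^ (d * card Q) * \<rho> powr \<eta> + \<theta> ^ m \<rho> (Suc s) * L ^ gap S j / \<rho>)"
      proof (rule clustered_returns[OF _ \<rho>(1) S Q, of "m \<rho> (Suc s)"
            "\<lambda>p n. C * (\<rho> ^ (d * p) * \<rho> powr \<eta> + \<theta> ^ m \<rho> (Suc s) * L ^ n / \<rho>)"])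
      qed (use bound \<rho> in \<open>auto simp: Q_def\<close>)
      have "\<theta> ^ m \<rho> (Suc s) * L ^ gap S j / \<rho> \<le> L * \<rho> ^ (d * r + 1)"
      proof -
        have "\<theta> ^ m \<rho> (Suc s) \<le> \<rho> powr (\<kappa> (Suc s) * \<beta>)"
          unfolding m_def \<beta>_def using \<theta> \<rho> by (intro power_log_scale_le) auto
        also have "\<dots> \<le> \<rho> powr (\<kappa> s * ln L + real (d * r + 2))"
        proof (rule powr_mono')
          have "\<kappa> (Suc s) * \<beta> = \<kappa> s * \<beta> + (\<kappa> s * ln L + real (d * r + 2))"
            unfolding \<kappa>_simps distrib_right using \<beta> by simp
          moreover have "0 \<le> \<kappa> s * \<beta>" using \<beta> \<kappa>_nonneg[of s] by simp
          ultimately show "\<kappa> s * ln L + real (d * r + 2) \<le> \<kappa> (Suc s) * \<beta>" by linarith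
        qed (use \<rho> in auto)
        finally have 1: "\<theta> ^ m \<rho> (Suc s) \<le> \<rho> powr (\<kappa> s * ln L + real (d * r + 2))" .
        have "L ^ gap S j \<le> L ^ m \<rho> s" using small[OF j] L_ge_1 by (intro power_increasing) auto
        also have "\<dots> \<le> L * \<rho> powr (- (\<kappa> s * ln L))"
          unfolding m_def using L_ge_1 \<rho> \<kappa>_nonneg by (intro power_log_scale_ge1_le) auto
        finally have 2: "L ^ gap S j \<le> L * \<rho> powr (- (\<kappa> s * ln L))" .
        have "\<theta> ^ m \<rho> (Suc s) * L ^ gap S j / \<rho>
            \<le> \<rho> powr (\<kappa> s * ln L + real (d * r + 2)) * (L * \<rho> powr (- (\<kappa> s * ln L))) / \<rho>"
          using 1 2 \<theta> L_ge_1 \<rho> by (intro divide_right_mono mult_mono) auto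
        also have "\<dots> = L * (\<rho> powr (\<kappa> s * ln L + real (d * r + 2)) * \<rho> powr (- (\<kappa> s * ln L))) / \<rho>"
          by (simp add: ac_simps)
        also have "\<rho> powr (\<kappa> s * ln L + real (d * r + 2)) * \<rho> powr (- (\<kappa> s * ln L)) = \<rho> powr real (d * r + 2)"
          by (subst powr_add[symmetric]) simp
        also have "\<dots> = \<rho> ^ (d * r + 2)" using \<rho> by (simp only: powr_realpow)
        also have "L * \<rho> ^ (d * r + 2) / \<rho> = L * \<rho> ^ (d * r + 1)" using \<rho> by simp
        finally show ?thesis .
      qed
      also have "L * \<rho> ^ (d * r + 1) \<le> L * (\<rho> ^ (d * card Q) * \<rho> powr \<eta>')"
      proof -
        have "card Q \<le> r" using card_mono[of "{..<r}" Q] Q by auto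
        then have "\<rho> ^ (d * r) \<le> \<rho> ^ (d * card Q)" using \<rho> by (intro power_decreasing) auto
        moreover have "\<rho> powr 1 \<le> \<rho> powr \<eta>'" using \<rho> \<eta>' by (intro powr_mono') auto
        ultimately have "\<rho> ^ (d * r) * \<rho> powr 1 \<le> \<rho> ^ (d * card Q) * \<rho> powr \<eta>'" using \<rho> by (intro mult_mono) auto
        then show ?thesis using L_ge_1 \<rho> by (intro mult_left_mono) (auto simp: mult.commute)
      qed
      finally have "\<theta> ^ m \<rho> (Suc s) * L ^ gap S j / \<rho> \<le> L * (\<rho> ^ (d * card Q) * \<rho> powr \<eta>')" .
      moreover have "\<rho> ^ (d * card Q) * \<rho> powr \<eta> \<le> \<rho> ^ (d * card Q) * \<rho> powr \<eta>'"
        using \<rho> \<eta>' by (intro mult_left_mono powr_mono') auto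
      ultimately have "C * (\<rho> ^ (d * card Q) * \<rho> powr \<eta> + \<theta> ^ m \<rho> (Suc s) * L ^ gap S j / \<rho>)
          \<le> C * (\<rho> ^ (d * card Q) * \<rho> powr \<eta>' + L * (\<rho> ^ (d * card Q) * \<rho> powr \<eta>'))"
        using C by (intro mult_left_mono[OF add_mono]) auto
      then have "measure M (joint S \<rho>) \<le> of_bool (S \<in> ?A Q) * ?b Q"
        using le SA by (simp add: algebra_simps)
      also have "\<dots> \<le> (\<Sum>Q\<in>Pow {..<r}. of_bool (S \<in> ?A Q) * ?b Q)"
        using Q b_nonneg by (intro member_le_sum) (auto simp del: mem_Collect_eq)
      finally show ?thesis .
    qed
    then have "(\<Sum>S\<in>{S\<in>time_sets (T \<rho>) r. \<exists>j<r. gap S j < m \<rho> 0}. measure M (joint S \<rho>))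
        \<le> (\<Sum>S\<in>{S\<in>time_sets (T \<rho>) r. \<exists>j<r. gap S j < m \<rho> 0}. \<Sum>Q\<in>Pow {..<r}. of_bool (S \<in> ?A Q) * ?b Q)"
      by (intro sum_mono) blast
    also have "\<dots> \<le> (\<Sum>S\<in>time_sets (T \<rho>) r. \<Sum>Q\<in>Pow {..<r}. of_bool (S \<in> ?A Q) * ?b Q)"
      by (intro sum_mono2 sum_nonneg mult_nonneg_nonneg b_nonneg finite_time_sets) auto
    also have "\<dots> = (\<Sum>Q\<in>Pow {..<r}. \<Sum>S\<in>time_sets (T \<rho>) r. of_bool (S \<in> ?A Q) * ?b Q)"
      by (rule sum.swap)
    also have "\<dots> = (\<Sum>Q\<in>Pow {..<r}. real (card (?A Q)) * ?b Q)"
    proof (rule sum.cong[OF refl])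
      fix Q
      have "(\<Sum>S\<in>time_sets (T \<rho>) r. of_bool (S \<in> ?A Q) :: real) = real (card (?A Q))"
        using finite_time_sets[of "T \<rho>" r] by (simp add: sum_of_bool_eq Int_def)
      then show "(\<Sum>S\<in>time_sets (T \<rho>) r. of_bool (S \<in> ?A Q) * ?b Q) = real (card (?A Q)) * ?b Q"
        by (simp only: sum_distrib_right[symmetric])
    qed
    also have "\<dots> \<le> \<Theta> \<rho>"
      unfolding \<Theta>_def
    proof (rule sum_mono)
      fix Q assume "Q \<in> Pow {..<r}"
      then have "card (?A Q) \<le> T \<rho> ^ card Q * m \<rho> (Suc r) ^ (r - card Q)"
        by (intro card_small_gaps) auto
      then have "real (card (?A Q)) \<le> real (T \<rho>) ^ card Q * real (m \<rho> (Suc r)) ^ (r - card Q)"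
        unfolding of_nat_mult[symmetric] of_nat_power[symmetric] of_nat_le_iff .
      then have "real (card (?A Q)) * ?b Q \<le> real (T \<rho>) ^ card Q * real (m \<rho> (Suc r)) ^ (r - card Q) * ?b Q"
        using b_nonneg by (intro mult_right_mono) auto
      also have "\<dots> = C * (1 + L) * (real (T \<rho>) * \<rho> ^ d) ^ card Q * (real (m \<rho> (Suc r)) ^ (r - card Q) * \<rho> powr \<eta>')"
        by (simp add: power_mult power_mult_distrib)
      also have "\<dots> \<le> C * (1 + L) * \<tau> ^ card Q * (real (m \<rho> (Suc r)) ^ (r - card Q) * \<rho> powr \<eta>')"
        using horizon_bounds(1)[OF \<tau> \<rho>(1), of d] C L_ge_1 \<rho> unfolding T_def
        by (intro mult_right_mono mult_left_mono power_mono) auto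
      finally show "real (card (?A Q)) * ?b Q
          \<le> C * (1 + L) * \<tau> ^ card Q * (real (m \<rho> (Suc r)) ^ (r - card Q) * \<rho> powr \<eta>')" .
    qed
    finally show ?thesis .
  qed
  have "(\<Theta> \<longlongrightarrow> (\<Sum>Q\<in>Pow {..<r}. C * (1 + L) * \<tau> ^ card Q * 0)) (at_right 0)"
    unfolding \<Theta>_def m_def using \<kappa>_nonneg \<eta>'(1) by (intro tendsto_sum tendsto_mult tendsto_const log_power_limit)
  then have \<Theta>0: "(\<Theta> \<longlongrightarrow> 0) (at_right 0)" by simp
  have m0: "m \<rho> 0 = nat \<lceil>\<kappa>0 * ln (1 / \<rho>)\<rceil>" for \<rho> by (simp add: m_def \<kappa>_simps)
  show ?thesis
    unfolding m0[symmetric]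
    by (rule tendsto_sandwich[OF _ _ tendsto_const \<Theta>0])
      (auto simp: eventually_at_right_field intro!: exI[of _ 1] main sum_nonneg)
qed

lemma card_close_times:
  "card {S \<in> time_sets T r. \<exists>j<r. gap S j < m} \<le> r * (T ^ (r - 1) * m)"
proof -
  have "{S \<in> time_sets T r. \<exists>j<r. gap S j < m} \<subseteq> (\<Union>j<r. {S \<in> time_sets T r. \<forall>i\<in>{..<r} - ({..<r} - {j}). gap S i < m})"
    by auto
  then have "card {S \<in> time_sets T r. \<exists>j<r. gap S j < m}
      \<le> card (\<Union>j<r. {S \<in> time_sets T r. \<forall>i\<in>{..<r} - ({..<r} - {j}). gap S i < m})"
    by (intro card_mono finite_UN_I) (auto simp: finite_time_sets)
  also have "\<dots> \<le> (\<Sum>j<r. card {S \<in> time_sets T r. \<forall>i\<in>{..<r} - ({..<r} - {j}). gap S i < m})"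
    by (rule card_UN_le) simp
  also have "\<dots> \<le> (\<Sum>j<r. T ^ (r - 1) * m)"
  proof (rule sum_mono)
    fix j assume "j \<in> {..<r}"
    then show "card {S \<in> time_sets T r. \<forall>i\<in>{..<r} - ({..<r} - {j}). gap S i < m} \<le> T ^ (r - 1) * m"
      using card_small_gaps[of "{..<r} - {j}" r T m] by simp
  qed
  finally show ?thesis by simp
qed

text \<open>
  The sets of widely separated times contribute asymptotically \<open>\<rho> powr (d r) \<integral>\<gamma>\<^sup>r\<close> each, uniformly;
  the others are negligible both in number and in their contribution.
\<close>

lemma binomial_moment_limit:
  assumes \<tau>: "0 < \<tau>"
  shows "((\<lambda>\<rho>. \<integral>x. real (card {n\<in>{1..nat \<lfloor>\<tau> / \<rho> ^ d\<rfloor>}. D x ((f ^^ n) x) \<le> \<rho>} choose r) \<partial>M)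
    \<longlongrightarrow> \<tau> ^ r / fact r * (\<integral>x. \<gamma> x ^ r \<partial>M)) (at_right 0)"
proof -
  obtain C \<theta> where C: "0 < C" and \<theta>: "0 < \<theta>" "\<theta> < 1" and
    upper: "\<And>k m \<rho> w. 0 < w \<Longrightarrow> k 0 = 0 \<Longrightarrow> (\<And>j. j < r \<Longrightarrow> k j + m \<le> k (Suc j)) \<Longrightarrow>
        measure M {x. \<forall>i\<in>{1..r}. D x ((f ^^ k i) x) \<le> \<rho>}
          \<le> (\<integral>x. ramp_mass \<rho> w x ^ r \<partial>M) + C * \<theta> ^ m * (1 + real r / w)" and
    lower: "\<And>k m \<rho> w. 0 < w \<Longrightarrow> k 0 = 0 \<Longrightarrow> (\<And>j. j < r \<Longrightarrow> k j + m \<le> k (Suc j)) \<Longrightarrow>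
        (\<integral>x. ramp_mass (\<rho> - w) w x ^ r \<partial>M) - C * \<theta> ^ m * (1 + real r / w)
          \<le> measure M {x. \<forall>i\<in>{1..r}. D x ((f ^^ k i) x) \<le> \<rho>}"
    by (rule separated_returns[of r]) blast
  define T where "T \<rho> = nat \<lfloor>\<tau> / \<rho> ^ d\<rfloor>" for \<rho>
  \<comment> \<open>The mixing error becomes \<open>\<rho> ^ (d r + 3)\<close>. Two powers are lost to the width \<open>\<rho>\<^sup>2\<close> of the ramps, and \<open>\<rho> ^ (d r)\<close> to
    the number of summands.\<close>
  define \<kappa> where "\<kappa> = real (d * r + 3) / ln (1 / \<theta>)"
  have \<kappa>: "0 \<le> \<kappa>" "\<kappa> * ln (1 / \<theta>) = real (d * r + 3)" using \<theta> by (auto simp: \<kappa>_def)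
  define m where "m \<rho> = nat \<lceil>\<kappa> * ln (1 / \<rho>)\<rceil>" for \<rho>
  define Ip where "Ip \<rho> = (\<integral>x. ramp_mass \<rho> (\<rho>\<^sup>2) x ^ r \<partial>M)" for \<rho>
  define Im where "Im \<rho> = (\<integral>x. ramp_mass (\<rho> - \<rho>\<^sup>2) (\<rho>\<^sup>2) x ^ r \<partial>M)" for \<rho>
  define E where "E \<rho> = C * real (Suc r) * \<rho> ^ (d * r + 1)" for \<rho>
  define W where "W \<rho> = (\<Sum>S\<in>{S\<in>time_sets (T \<rho>) r. \<exists>j<r. gap S j < m \<rho>}. measure M (joint S \<rho>))" for \<rho>
  define \<Gamma> where "\<Gamma> = (\<integral>x. \<gamma> x ^ r \<partial>M)"
  have Im_nonneg: "0 \<le> Im \<rho>" for \<rho> unfolding Im_def by (simp add: ramp_mass_nonneg)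
  have Ip_lim: "((\<lambda>\<rho>. Ip \<rho> / \<rho> ^ (d * r)) \<longlongrightarrow> \<Gamma>) (at_right 0)"
    and Im_lim: "((\<lambda>\<rho>. Im \<rho> / \<rho> ^ (d * r)) \<longlongrightarrow> \<Gamma>) (at_right 0)"
    unfolding Ip_def Im_def \<Gamma>_def using ramp_mass_power_limit[of 0 r] ramp_mass_power_limit[of 1 r] by simp_all
  have W_lim: "(W \<longlongrightarrow> 0) (at_right 0)"
    unfolding W_def T_def m_def by (rule clustered_sum_limit[OF \<tau> \<kappa>(1)])
  have error: "C * \<theta> ^ m \<rho> * (1 + real r / \<rho>\<^sup>2) \<le> E \<rho>" if \<rho>: "0 < \<rho>" "\<rho> < 1" for \<rho>
  proof -
    have "\<theta> ^ m \<rho> \<le> \<rho> powr real (d * r + 3)"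
      unfolding m_def \<kappa>(2)[symmetric] using \<theta> \<rho> by (intro power_log_scale_le) auto
    then have 1: "\<theta> ^ m \<rho> \<le> \<rho> ^ (d * r + 3)" using \<rho> by (simp only: powr_realpow)
    have "\<rho>\<^sup>2 \<le> 1" using \<rho> by (simp add: power_le_one)
    then have 2: "1 + real r / \<rho>\<^sup>2 \<le> real (Suc r) / \<rho>\<^sup>2" using \<rho> by (simp add: field_simps)
    have "C * \<theta> ^ m \<rho> * (1 + real r / \<rho>\<^sup>2) \<le> C * \<rho> ^ (d * r + 3) * (real (Suc r) / \<rho>\<^sup>2)"
      using 1 2 C \<theta> \<rho> by (intro mult_mono mult_left_mono) auto
    also have "\<dots> = E \<rho>" using \<rho> unfolding E_def by (simp add: power2_eq_square numeral_eq_Suc)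
    finally show ?thesis .
  qed
  have sep_k: "visit_time S j + m \<rho> \<le> visit_time S (Suc j)"
    if "S \<in> time_sets (T \<rho>) r" "\<not> (\<exists>j<r. gap S j < m \<rho>)" "j < r" for S \<rho> j
  proof -
    have "m \<rho> \<le> gap S j" using that(2,3) by (meson not_less)
    then show ?thesis using visit_time_Suc[OF that(1,3)] by simp
  qed
  have split: "(\<integral>x. real (card {n\<in>{1..T \<rho>}. D x ((f ^^ n) x) \<le> \<rho>} choose r) \<partial>M)
      = W \<rho> + (\<Sum>S\<in>{S\<in>time_sets (T \<rho>) r. \<not> (\<exists>j<r. gap S j < m \<rho>)}. measure M (joint S \<rho>))" for \<rho>
  proof -
    have "(\<Sum>S\<in>time_sets (T \<rho>) r. measure M (joint S \<rho>))
        = (\<Sum>S\<in>{S\<in>time_sets (T \<rho>) r. \<exists>j<r. gap S j < m \<rho>} \<union> {S\<in>time_sets (T \<rho>) r. \<not> (\<exists>j<r. gap S j < m \<rho>)}. measure M (joint S \<rho>))"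
      by (rule sum.cong) auto
    then show ?thesis unfolding W_def binomial_moment_eq
      by (subst (asm) sum.union_disjoint) (auto simp: finite_time_sets)
  qed
  let ?N = "\<lambda>\<rho>. real (T \<rho> choose r) * (\<rho> ^ d) ^ r"
  have N_lim: "(?N \<longlongrightarrow> \<tau> ^ r / fact r) (at_right 0)"
    unfolding T_def by (intro choose_limit horizon_limit power_tendsto_0_at_right \<tau> d_pos)
  have card_split: "real (card {S\<in>time_sets (T \<rho>) r. \<not> (\<exists>j<r. gap S j < m \<rho>)})
      = real (T \<rho> choose r) - real (card {S\<in>time_sets (T \<rho>) r. \<exists>j<r. gap S j < m \<rho>})" for \<rho>
  proof -
    have "{S\<in>time_sets (T \<rho>) r. \<not> (\<exists>j<r. gap S j < m \<rho>)} = time_sets (T \<rho>) r - {S\<in>time_sets (T \<rho>) r. \<exists>j<r. gap S j < m \<rho>}"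
      by auto
    moreover have "card \<dots> = card (time_sets (T \<rho>) r) - card {S\<in>time_sets (T \<rho>) r. \<exists>j<r. gap S j < m \<rho>}"
      by (intro card_Diff_subset) (auto simp: finite_time_sets)
    moreover have "card {S\<in>time_sets (T \<rho>) r. \<exists>j<r. gap S j < m \<rho>} \<le> card (time_sets (T \<rho>) r)"
      by (intro card_mono) (auto simp: finite_time_sets)
    ultimately show ?thesis by (simp add: card_time_sets of_nat_diff)
  qed
  let ?U = "\<lambda>\<rho>. W \<rho> + (?N \<rho> * (Ip \<rho> / \<rho> ^ (d * r)) + ?N \<rho> * (C * real (Suc r) * \<rho>))"
  let ?V = "\<lambda>\<rho>. ?N \<rho> * (Im \<rho> / \<rho> ^ (d * r)) - ?N \<rho> * (C * real (Suc r) * \<rho>)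
      - real r * (real (T \<rho>) * \<rho> ^ d) ^ (r - 1) * (real (m \<rho>) ^ 1 * \<rho> powr real d) * (Im \<rho> / \<rho> ^ (d * r))"
  have U: "(\<integral>x. real (card {n\<in>{1..T \<rho>}. D x ((f ^^ n) x) \<le> \<rho>} choose r) \<partial>M) \<le> ?U \<rho>" if \<rho>: "0 < \<rho>" "\<rho> < 1" for \<rho>
  proof -
    have "(\<Sum>S\<in>{S\<in>time_sets (T \<rho>) r. \<not> (\<exists>j<r. gap S j < m \<rho>)}. measure M (joint S \<rho>))
        \<le> (\<Sum>S\<in>{S\<in>time_sets (T \<rho>) r. \<not> (\<exists>j<r. gap S j < m \<rho>)}. Ip \<rho> + E \<rho>)"
    proof (rule sum_mono)
      fix S assume "S \<in> {S\<in>time_sets (T \<rho>) r. \<not> (\<exists>j<r. gap S j < m \<rho>)}"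
      then have S: "S \<in> time_sets (T \<rho>) r" "\<not> (\<exists>j<r. gap S j < m \<rho>)" by auto
      show "measure M (joint S \<rho>) \<le> Ip \<rho> + E \<rho>"
        unfolding joint_eq[OF S(1)] Ip_def
        using upper[of "\<rho>\<^sup>2" "visit_time S" "m \<rho>" \<rho>, OF _ visit_time_0 sep_k[OF S]] error[OF \<rho>] \<rho> by simp
    qed
    also have "\<dots> = real (card {S\<in>time_sets (T \<rho>) r. \<not> (\<exists>j<r. gap S j < m \<rho>)}) * (Ip \<rho> + E \<rho>)" by simp
    also have "\<dots> \<le> real (T \<rho> choose r) * (Ip \<rho> + E \<rho>)"
    proof (rule mult_right_mono)
      show "0 \<le> Ip \<rho> + E \<rho>" unfolding Ip_def E_def using C \<rho> by (auto simp: ramp_mass_nonneg intro!: add_nonneg_nonneg)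
    qed (use card_split[of \<rho>] in linarith)
    also have "\<dots> = ?N \<rho> * (Ip \<rho> / \<rho> ^ (d * r)) + ?N \<rho> * (C * real (Suc r) * \<rho>)"
      unfolding E_def power_mult[symmetric] using \<rho> by (simp add: algebra_simps)
    finally show ?thesis unfolding split by simp
  qed
  have V: "?V \<rho> \<le> (\<integral>x. real (card {n\<in>{1..T \<rho>}. D x ((f ^^ n) x) \<le> \<rho>} choose r) \<partial>M)" if \<rho>: "0 < \<rho>" "\<rho> < 1" for \<rho>
  proof -
    let ?c = "real (card {S\<in>time_sets (T \<rho>) r. \<exists>j<r. gap S j < m \<rho>})"
    have E0: "0 \<le> E \<rho>" unfolding E_def using C \<rho> by auto
    have "?c \<le> real (r * (T \<rho> ^ (r - 1) * m \<rho>))" by (simp only: of_nat_le_iff card_close_times)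
    then have "?c * Im \<rho> \<le> real (r * (T \<rho> ^ (r - 1) * m \<rho>)) * Im \<rho>" using Im_nonneg by (intro mult_right_mono)
    also have "\<dots> = real r * (real (T \<rho>) * \<rho> ^ d) ^ (r - 1) * (real (m \<rho>) ^ 1 * \<rho> powr real d) * (Im \<rho> / \<rho> ^ (d * r))"
    proof (cases r)
      case (Suc q)
      have "\<rho> ^ (d * r) = (\<rho> ^ d) ^ q * \<rho> ^ d" by (simp add: Suc power_mult power_add mult.commute)
      then show ?thesis using \<rho> by (simp add: Suc powr_realpow power_mult_distrib algebra_simps)
    qed simp
    finally have 1: "?c * Im \<rho> \<le> \<dots>" .
    have "?N \<rho> * (Im \<rho> / \<rho> ^ (d * r)) - ?N \<rho> * (C * real (Suc r) * \<rho>) - ?c * Im \<rho>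
        = (real (T \<rho> choose r) - ?c) * Im \<rho> - real (T \<rho> choose r) * E \<rho>"
      unfolding E_def power_mult[symmetric] using \<rho> by (simp add: algebra_simps)
    also have "\<dots> \<le> (real (T \<rho> choose r) - ?c) * (Im \<rho> - E \<rho>)"
      using E0 by (simp add: algebra_simps)
    also have "\<dots> = (\<Sum>S\<in>{S\<in>time_sets (T \<rho>) r. \<not> (\<exists>j<r. gap S j < m \<rho>)}. Im \<rho> - E \<rho>)"
      unfolding card_split[symmetric] by simp
    also have "\<dots> \<le> (\<Sum>S\<in>{S\<in>time_sets (T \<rho>) r. \<not> (\<exists>j<r. gap S j < m \<rho>)}. measure M (joint S \<rho>))"
    proof (rule sum_mono)
      fix S assume "S \<in> {S\<in>time_sets (T \<rho>) r. \<not> (\<exists>j<r. gap S j < m \<rho>)}"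
      then have S: "S \<in> time_sets (T \<rho>) r" "\<not> (\<exists>j<r. gap S j < m \<rho>)" by auto
      show "Im \<rho> - E \<rho> \<le> measure M (joint S \<rho>)"
        unfolding joint_eq[OF S(1)] Im_def
        using lower[of "\<rho>\<^sup>2" "visit_time S" "m \<rho>" \<rho>, OF _ visit_time_0 sep_k[OF S]] error[OF \<rho>] \<rho> by simp
    qed
    also have "\<dots> \<le> (\<integral>x. real (card {n\<in>{1..T \<rho>}. D x ((f ^^ n) x) \<le> \<rho>} choose r) \<partial>M)"
      unfolding split W_def by (simp add: sum_nonneg)
    finally show ?thesis using 1 by linarith
  qed
  have id: "((\<lambda>\<rho>::real. C * real (Suc r) * \<rho>) \<longlongrightarrow> C * real (Suc r) * 0) (at_right 0)"
    by (intro tendsto_intros)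
  have "(?U \<longlongrightarrow> 0 + (\<tau> ^ r / fact r * \<Gamma> + \<tau> ^ r / fact r * (C * real (Suc r) * 0))) (at_right 0)"
    by (intro tendsto_add W_lim tendsto_mult N_lim Ip_lim id)
  then have U_lim: "(?U \<longlongrightarrow> \<tau> ^ r / fact r * \<Gamma>) (at_right 0)" by simp
  have "(?V \<longlongrightarrow> \<tau> ^ r / fact r * \<Gamma> - \<tau> ^ r / fact r * (C * real (Suc r) * 0) - real r * \<tau> ^ (r - 1) * 0 * \<Gamma>) (at_right 0)"
    unfolding T_def[symmetric]
    by (intro tendsto_diff tendsto_mult N_lim Im_lim id tendsto_const tendsto_power
        horizon_limit[OF \<tau> d_pos, folded T_def] log_power_limit[OF \<kappa>(1), of "real d" 1, folded m_def])
      (use d_pos in simp)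
  then have V_lim: "(?V \<longlongrightarrow> \<tau> ^ r / fact r * \<Gamma>) (at_right 0)" by simp
  have "((\<lambda>\<rho>. \<integral>x. real (card {n\<in>{1..T \<rho>}. D x ((f ^^ n) x) \<le> \<rho>} choose r) \<partial>M) \<longlongrightarrow> \<tau> ^ r / fact r * \<Gamma>) (at_right 0)"
    by (rule tendsto_sandwich[OF _ _ V_lim U_lim])
      (use U V in \<open>auto simp: eventually_at_right_field intro!: exI[of _ 1]\<close>)
  then show ?thesis unfolding T_def \<Gamma>_def .
qed

end

section \<open>Convergence to a mixture of Poisson laws\<close>

lemma exp_partial_sum_bounded:
  fixes u :: real
  assumes "0 \<le> u"
  shows "\<bar>\<Sum>i\<le>I. (- u) ^ i / fact i\<bar> \<le> exp u"
proof -
  have "\<bar>\<Sum>i\<le>I. (- u) ^ i / fact i\<bar> \<le> (\<Sum>i\<le>I. u ^ i / fact i)"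
    using assms by (intro order_trans[OF sum_abs]) (auto simp: power_abs abs_mult)
  also have "\<dots> \<le> exp u"
  proof -
    have "(\<lambda>i. u ^ i / fact i) sums exp u"
      using exp_converges[of u] by (simp add: divide_inverse mult.commute)
    then show ?thesis
      using sum_le_suminf[of "\<lambda>i. u ^ i / fact i" "{..I}"] assms by (auto simp: sums_iff)
  qed
  finally show ?thesis .
qed

lemma binomial_right_mono: "n \<le> m \<Longrightarrow> n choose r \<le> m choose r"
proof (rule lift_Suc_mono_le[of "\<lambda>n. n choose r"])
  show "n choose r \<le> Suc n choose r" for n by (cases r) auto
qed

context mixing_returns begin

lemma \<gamma>_power_integrable: "integrable M (\<lambda>x. \<gamma> x ^ r)"
  using \<gamma>_nonneg \<gamma>_le_B by (intro integrable_const_bound[of _ "B ^ r"]) (auto simp: norm_power intro!: power_mono)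

lemma count_integrable:
  "integrable M (\<lambda>x. real (card {n\<in>{1..T}. D x ((f ^^ n) x) \<le> \<rho>} choose r))"
proof (rule integrable_const_bound[of _ "real (T choose r)"])
  show "AE x in M. norm (real (card {n\<in>{1..T}. D x ((f ^^ n) x) \<le> \<rho>} choose r)) \<le> real (T choose r)"
  proof (intro AE_I2)
    fix x
    have "card {n\<in>{1..T}. D x ((f ^^ n) x) \<le> \<rho>} \<le> card {1..T}" by (intro card_mono) auto
    then show "norm (real (card {n\<in>{1..T}. D x ((f ^^ n) x) \<le> \<rho>} choose r)) \<le> real (T choose r)"
      using binomial_right_mono by simp
  qed
  have "(\<lambda>x. card {n\<in>{1..T}. D x ((f ^^ n) x) \<le> \<rho>}) \<in> M \<rightarrow>\<^sub>M count_space UNIV"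
    by measurable
  then show "(\<lambda>x. real (card {n\<in>{1..T}. D x ((f ^^ n) x) \<le> \<rho>} choose r)) \<in> borel_measurable M"
    by measurable
qed

text \<open>
  The bounds of truncated inclusion and exclusion involve finitely many factorial moments, hence
  pass to the limit \<open>\<rho> \<rightarrow> 0\<close>; since \<open>\<gamma>\<close> is bounded, they close up as the truncation grows.
\<close>

lemma returns_mixed_poisson:
  assumes \<tau>: "0 < \<tau>"
  shows "((\<lambda>\<rho>. measure M {x. card {n\<in>{1..nat \<lfloor>\<tau> / \<rho> ^ d\<rfloor>}. D x ((f ^^ n) x) \<le> \<rho>} = l})
    \<longlongrightarrow> (\<integral>x. exp (- (\<gamma> x * \<tau>)) * (\<gamma> x * \<tau>) ^ l / fact l \<partial>M)) (at_right 0)"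
proof -
  define N where "N \<rho> x = card {n\<in>{1..nat \<lfloor>\<tau> / \<rho> ^ d\<rfloor>}. D x ((f ^^ n) x) \<le> \<rho>}" for \<rho> x
  define \<Phi> where "\<Phi> r = \<tau> ^ r / fact r * (\<integral>x. \<gamma> x ^ r \<partial>M)" for r
  have moment: "((\<lambda>\<rho>. \<integral>x. real (N \<rho> x choose r) \<partial>M) \<longlongrightarrow> \<Phi> r) (at_right 0)" for r
    unfolding N_def \<Phi>_def by (rule binomial_moment_limit[OF \<tau>])
  have int: "integrable M (\<lambda>x. real (N \<rho> x choose r))" for \<rho> r
    unfolding N_def by (rule count_integrable)
  have sets: "{x. N \<rho> x = l} \<in> sets M" for \<rho>
  proof -
    have [measurable]: "N \<rho> \<in> M \<rightarrow>\<^sub>M count_space UNIV" unfolding N_def by measurable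
    have "{x\<in>space M. N \<rho> x = l} \<in> sets M" by measurable
    then show ?thesis by (simp add: space_UNIV)
  qed
  define P where "P \<rho> = measure M {x. N \<rho> x = l}" for \<rho>
  define S where "S I \<rho> = (\<Sum>i\<le>I. (-1) ^ i * real ((l + i) choose l) * (\<integral>x. real (N \<rho> x choose (l + i)) \<partial>M))" for I \<rho>
  define R where "R I \<rho> = real ((l + Suc I) choose l) * (\<integral>x. real (N \<rho> x choose (l + Suc I)) \<partial>M)" for I \<rho>
  have bonf: "\<bar>P \<rho> - S I \<rho>\<bar> \<le> R I \<rho>" for I \<rho>
  proof -
    let ?s = "\<lambda>x. \<Sum>i\<le>I. (-1) ^ i * real ((l + i) choose l) * real (N \<rho> x choose (l + i))"
    have ints: "integrable M ?s" by (intro Bochner_Integration.integrable_sum integrable_mult_right int)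
    have S_eq: "S I \<rho> = (\<integral>x. ?s x \<partial>M)"
      unfolding S_def by (simp add: int Bochner_Integration.integral_sum)
    have P_eq: "P \<rho> = (\<integral>x. of_bool (N \<rho> x = l) \<partial>M)"
      unfolding P_def by (rule measure_as_integral) (rule sets)
    have bool_int: "integrable M (\<lambda>x. of_bool (N \<rho> x = l) :: real)"
      by (rule integrable_of_bool) (rule sets)
    have diff_int: "integrable M (\<lambda>x. of_bool (N \<rho> x = l) - ?s x)"
      using bool_int ints by (rule Bochner_Integration.integrable_diff)
    have diff: "P \<rho> - S I \<rho> = (\<integral>x. of_bool (N \<rho> x = l) - ?s x \<partial>M)"
      unfolding P_eq S_eq using bool_int ints by (rule Bochner_Integration.integral_diff[symmetric])
    have "\<bar>P \<rho> - S I \<rho>\<bar> \<le> (\<integral>x. \<bar>of_bool (N \<rho> x = l) - ?s x\<bar> \<partial>M)"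
      unfolding diff by (rule integral_abs_bound)
    also have "\<dots> \<le> (\<integral>x. real ((l + Suc I) choose l) * real (N \<rho> x choose (l + Suc I)) \<partial>M)"
    proof (rule Bochner_Integration.integral_mono)
      show "integrable M (\<lambda>x. \<bar>of_bool (N \<rho> x = l) - ?s x\<bar>)"
        by (rule Bochner_Integration.integrable_abs) (rule diff_int)
      show "integrable M (\<lambda>x. real ((l + Suc I) choose l) * real (N \<rho> x choose (l + Suc I)))"
        by (rule integrable_mult_right) (rule int)
      show "\<bar>of_bool (N \<rho> x = l) - ?s x\<bar> \<le> real ((l + Suc I) choose l) * real (N \<rho> x choose (l + Suc I))" for x
        by (rule bonferroni_exactly)
    qed
    also have "\<dots> = R I \<rho>" unfolding R_def by simp
    finally show ?thesis .
  qed
  define s where "s I = (\<Sum>i\<le>I. (-1) ^ i * real ((l + i) choose l) * \<Phi> (l + i))" for I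
  define e where "e I = real ((l + Suc I) choose l) * \<Phi> (l + Suc I)" for I
  have S_lim: "(S I \<longlongrightarrow> s I) (at_right 0)" for I
    unfolding S_def s_def by (intro tendsto_intros moment)
  have R_lim: "(R I \<longlongrightarrow> e I) (at_right 0)" for I
    unfolding R_def e_def by (intro tendsto_intros moment)
  have choose_fact: "real ((l + i) choose l) / fact (l + i) = 1 / (fact l * fact i)" for i
    using binomial_fact[of l "l + i", where ?'a = real] by (simp add: field_simps)
  have coeff_eq: "real ((l + i) choose l) * \<Phi> (l + i) = (\<integral>x. (\<gamma> x * \<tau>) ^ l / fact l * ((\<gamma> x * \<tau>) ^ i / fact i) \<partial>M)" for i
  proof -
    have "real ((l + i) choose l) * \<Phi> (l + i)
        = real ((l + i) choose l) / fact (l + i) * (\<tau> ^ (l + i) * (\<integral>x. \<gamma> x ^ (l + i) \<partial>M))"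
      by (simp add: \<Phi>_def)
    also have "\<dots> = (\<integral>x. 1 / (fact l * fact i) * (\<tau> ^ (l + i) * \<gamma> x ^ (l + i)) \<partial>M)"
      unfolding choose_fact by simp
    also have "\<dots> = (\<integral>x. (\<gamma> x * \<tau>) ^ l / fact l * ((\<gamma> x * \<tau>) ^ i / fact i) \<partial>M)"
      by (intro Bochner_Integration.integral_cong refl) (simp add: power_add power_mult_distrib field_simps)
    finally show ?thesis .
  qed
  define G where "G = B * \<tau>"
  have u: "0 \<le> \<gamma> x * \<tau>" "\<gamma> x * \<tau> \<le> G" for x
    using \<gamma>_nonneg[of x] \<gamma>_le_B[of x] \<tau> by (auto simp: G_def mult_right_mono)
  have G0: "0 \<le> G" using B_pos \<tau> by (simp add: G_def)
  have int_term: "integrable M (\<lambda>x. (\<gamma> x * \<tau>) ^ l / fact l * ((\<gamma> x * \<tau>) ^ i / fact i))" for i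
  proof -
    have "integrable M (\<lambda>x. (\<tau> ^ (l + i) / (fact l * fact i)) * \<gamma> x ^ (l + i))"
      by (intro integrable_mult_right \<gamma>_power_integrable)
    then show ?thesis by (simp add: power_add power_mult_distrib field_simps)
  qed
  let ?p = "\<lambda>x. exp (- (\<gamma> x * \<tau>)) * (\<gamma> x * \<tau>) ^ l / fact l"
  have s_eq: "s I = (\<integral>x. (\<gamma> x * \<tau>) ^ l / fact l * (\<Sum>i\<le>I. (- (\<gamma> x * \<tau>)) ^ i / fact i) \<partial>M)" for I
  proof -
    have "s I = (\<Sum>i\<le>I. (-1) ^ i * (\<integral>x. (\<gamma> x * \<tau>) ^ l / fact l * ((\<gamma> x * \<tau>) ^ i / fact i) \<partial>M))"
      unfolding s_def mult.assoc coeff_eq ..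
    also have "\<dots> = (\<integral>x. (\<Sum>i\<le>I. (-1) ^ i * ((\<gamma> x * \<tau>) ^ l / fact l * ((\<gamma> x * \<tau>) ^ i / fact i))) \<partial>M)"
      by (subst Bochner_Integration.integral_sum, rule integrable_mult_right, rule int_term) simp
    also have "\<dots> = (\<integral>x. (\<gamma> x * \<tau>) ^ l / fact l * (\<Sum>i\<le>I. (- (\<gamma> x * \<tau>)) ^ i / fact i) \<partial>M)"
      unfolding sum_distrib_left
      by (intro Bochner_Integration.integral_cong refl sum.cong) (simp_all add: power_minus[of "_ * _"])
    finally show ?thesis .
  qed
  have s_lim: "s \<longlonglongrightarrow> (\<integral>x. ?p x \<partial>M)"
    unfolding s_eq
  proof (rule integral_dominated_convergence[where w="\<lambda>_. G ^ l * exp G"])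
    show "AE x in M. (\<lambda>I. (\<gamma> x * \<tau>) ^ l / fact l * (\<Sum>i\<le>I. (- (\<gamma> x * \<tau>)) ^ i / fact i)) \<longlonglongrightarrow> ?p x"
    proof (intro AE_I2)
      fix x
      have "(\<lambda>i. (- (\<gamma> x * \<tau>)) ^ i / fact i) sums exp (- (\<gamma> x * \<tau>))"
        using exp_converges[of "- (\<gamma> x * \<tau>)"] by (simp add: divide_inverse mult.commute)
      then have "(\<lambda>I. \<Sum>i\<le>I. (- (\<gamma> x * \<tau>)) ^ i / fact i) \<longlonglongrightarrow> exp (- (\<gamma> x * \<tau>))"
        by (simp add: sums_def_le)
      from tendsto_mult_left[OF this, of "(\<gamma> x * \<tau>) ^ l / fact l"]
      show "(\<lambda>I. (\<gamma> x * \<tau>) ^ l / fact l * (\<Sum>i\<le>I. (- (\<gamma> x * \<tau>)) ^ i / fact i)) \<longlonglongrightarrow> ?p x"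
        by (simp add: mult.commute)
    qed
    show "AE x in M. norm ((\<gamma> x * \<tau>) ^ l / fact l * (\<Sum>i\<le>I. (- (\<gamma> x * \<tau>)) ^ i / fact i)) \<le> G ^ l * exp G" for I
    proof (intro AE_I2)
      fix x
      have "(\<gamma> x * \<tau>) ^ l / fact l \<le> G ^ l / 1"
        using u[of x] G0 by (intro frac_le power_mono) (auto simp: fact_ge_1)
      moreover have "\<bar>\<Sum>i\<le>I. (- (\<gamma> x * \<tau>)) ^ i / fact i\<bar> \<le> exp G"
        using exp_partial_sum_bounded[OF u(1)[of x], of I] u(2)[of x] by (meson exp_le_cancel_iff order_trans)
      ultimately show "norm ((\<gamma> x * \<tau>) ^ l / fact l * (\<Sum>i\<le>I. (- (\<gamma> x * \<tau>)) ^ i / fact i)) \<le> G ^ l * exp G"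
        unfolding real_norm_def abs_mult using u(1)[of x] G0 by (intro mult_mono) (auto simp del: times_divide_eq_left)
    qed
  qed auto
  have e_lim: "e \<longlonglongrightarrow> 0"
  proof (rule tendsto_sandwich)
    show "\<forall>\<^sub>F I in sequentially. 0 \<le> e I"
      unfolding e_def \<Phi>_def using \<tau> \<gamma>_nonneg by (intro always_eventually allI) simp
    show "\<forall>\<^sub>F I in sequentially. e I \<le> G ^ l * (G ^ Suc I / fact (Suc I))"
    proof (intro always_eventually allI)
      fix I
      have "e I \<le> (\<integral>x. G ^ l * (G ^ Suc I / fact (Suc I)) \<partial>M)"
        unfolding e_def coeff_eq
      proof (intro integral_mono int_term)
        fix x
        have "(\<gamma> x * \<tau>) ^ l / fact l \<le> G ^ l / 1"
          using u[of x] G0 by (intro frac_le power_mono) (auto simp: fact_ge_1)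
        then have "(\<gamma> x * \<tau>) ^ l / fact l \<le> G ^ l" by simp
        then show "(\<gamma> x * \<tau>) ^ l / fact l * ((\<gamma> x * \<tau>) ^ Suc I / fact (Suc I)) \<le> G ^ l * (G ^ Suc I / fact (Suc I))"
          using u[of x] G0 by (intro mult_mono[OF _ divide_right_mono] power_mono) auto
      qed simp
      then show "e I \<le> G ^ l * (G ^ Suc I / fact (Suc I))" by (simp add: prob_space)
    qed
    have "(\<lambda>n. G ^ n / fact n) \<longlonglongrightarrow> 0"
      using summable_LIMSEQ_zero[OF summable_exp[of G]] by (simp add: divide_inverse mult.commute)
    then have "(\<lambda>I. G ^ l * (G ^ Suc I / fact (Suc I))) \<longlonglongrightarrow> G ^ l * 0"
      by (intro tendsto_mult tendsto_const LIMSEQ_Suc)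
    then show "(\<lambda>I. G ^ l * (G ^ Suc I / fact (Suc I))) \<longlonglongrightarrow> 0" by simp
  qed simp
  have "(P \<longlongrightarrow> (\<integral>x. ?p x \<partial>M)) (at_right 0)"
  proof (rule tendstoI)
    fix \<epsilon> :: real assume "0 < \<epsilon>"
    then have \<epsilon>: "0 < \<epsilon> / 4" by simp
    have "\<forall>\<^sub>F I in sequentially. dist (s I) (\<integral>x. ?p x \<partial>M) < \<epsilon> / 4 \<and> dist (e I) 0 < \<epsilon> / 4"
      using tendstoD[OF s_lim \<epsilon>] tendstoD[OF e_lim \<epsilon>] by eventually_elim auto
    then obtain I where I: "dist (s I) (\<integral>x. ?p x \<partial>M) < \<epsilon> / 4" "dist (e I) 0 < \<epsilon> / 4"
      by (auto simp: eventually_sequentially)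
    show "\<forall>\<^sub>F \<rho> in at_right 0. dist (P \<rho>) (\<integral>x. ?p x \<partial>M) < \<epsilon>"
      using tendstoD[OF S_lim[of I] \<epsilon>] tendstoD[OF R_lim[of I] \<epsilon>]
    proof eventually_elim
      case (elim \<rho>)
      then show ?case using bonf[of \<rho> I] I unfolding dist_real_def by linarith
    qed
  qed
  then show ?thesis unfolding P_def N_def .
qed

end

section \<open>Norms given by positive definite matrices\<close>

definition gnorm :: "real ^ 'n ^ 'n \<Rightarrow> real ^ 'n \<Rightarrow> real" where
  "gnorm G v = sqrt (v \<bullet> (G *v v))"

definition sym_posdef :: "real ^ 'n ^ 'n \<Rightarrow> bool" where
  "sym_posdef G \<longleftrightarrow> transpose G = G \<and> (\<forall>v. v \<noteq> 0 \<longrightarrow> 0 < v \<bullet> (G *v v))"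

lemma matrix_vector_scaleR: "(A :: real ^ 'n ^ 'm) *v (c *\<^sub>R x) = c *\<^sub>R (A *v x)"
  by (rule linear_cmul) (rule matrix_vector_mul_linear)

lemma sym_posdef_form_nonneg: "sym_posdef G \<Longrightarrow> 0 \<le> v \<bullet> (G *v v)"
  unfolding sym_posdef_def by (cases "v = 0") (auto intro: less_imp_le)

lemma gnorm_nonneg: "sym_posdef G \<Longrightarrow> 0 \<le> gnorm G v"
  by (simp add: gnorm_def sym_posdef_form_nonneg)

lemma gnorm_pos: "sym_posdef G \<Longrightarrow> v \<noteq> 0 \<Longrightarrow> 0 < gnorm G v"
  by (simp add: gnorm_def sym_posdef_def)

lemma gnorm_square: "sym_posdef G \<Longrightarrow> (gnorm G v)\<^sup>2 = v \<bullet> (G *v v)"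
  by (simp add: gnorm_def sym_posdef_form_nonneg)

lemma gnorm_zero: "gnorm G 0 = 0"
  by (simp add: gnorm_def)

lemma gnorm_scaleR: "gnorm G (c *\<^sub>R v) = \<bar>c\<bar> * gnorm G v"
  by (simp add: gnorm_def matrix_vector_scaleR real_sqrt_mult[symmetric] mult.assoc[symmetric] real_sqrt_mult)

lemma gnorm_continuous: "continuous_on UNIV (gnorm G)"
  unfolding gnorm_def
  by (intro continuous_on_real_sqrt continuous_intros matrix_vector_mult_linear_continuous_on)

lemma sym_posdef_symmetric: "sym_posdef G \<Longrightarrow> x \<bullet> (G *v y) = y \<bullet> (G *v x)"
  by (metis dot_lmul_matrix inner_commute sym_posdef_def transpose_matrix_vector)

text \<open>The quadratic polynomial in \<open>s\<close> given by the form at \<open>x + s y\<close> is nonnegative at its minimum.\<close>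

lemma gnorm_Cauchy_Schwarz:
  assumes G: "sym_posdef G"
  shows "\<bar>x \<bullet> (G *v y)\<bar> \<le> gnorm G x * gnorm G y"
proof (cases "y = 0")
  case True
  then show ?thesis by (simp add: gnorm_zero)
next
  case False
  let ?a = "x \<bullet> (G *v x)" and ?b = "x \<bullet> (G *v y)" and ?c = "y \<bullet> (G *v y)"
  have c: "0 < ?c" using G False by (simp add: sym_posdef_def)
  have expand: "(x + s *\<^sub>R y) \<bullet> (G *v (x + s *\<^sub>R y)) = ?a + 2 * s * ?b + s\<^sup>2 * ?c" for s
    using sym_posdef_symmetric[OF G, of y x]
    by (simp add: matrix_vector_right_distrib matrix_vector_scaleR inner_add_left inner_add_right power2_eq_square
        distrib_left)
  have "0 \<le> ?a + 2 * (- ?b / ?c) * ?b + (- ?b / ?c)\<^sup>2 * ?c"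
    unfolding expand[symmetric] by (rule sym_posdef_form_nonneg[OF G])
  also have "\<dots> = ?a - ?b\<^sup>2 / ?c" using c by (simp add: power2_eq_square field_simps)
  finally have "?b\<^sup>2 \<le> ?a * ?c" using c by (simp add: field_simps)
  then have "\<bar>?b\<bar> \<le> sqrt (?a * ?c)" by (metis real_sqrt_le_mono real_sqrt_abs)
  then show ?thesis by (simp add: gnorm_def real_sqrt_mult)
qed

text \<open>On the unit sphere a positive definite form has a positive minimum and a finite maximum.\<close>

lemma gnorm_equiv_norm:
  fixes G :: "real ^ 'n ^ 'n"
  assumes G: "sym_posdef G"
  obtains c C where "0 < c" "0 < C" "\<And>v. c * norm v \<le> gnorm G v" "\<And>v. gnorm G v \<le> C * norm v"
proof -
  let ?S = "sphere (0 :: real ^ 'n) 1"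
  obtain v0 :: "real ^ 'n" where "norm v0 = 1" by (rule vector_choose_size[of 1]) auto
  then have "v0 \<in> ?S" by simp
  then have S: "compact ?S" "?S \<noteq> {}" by auto
  have cont: "continuous_on ?S (gnorm G)" using gnorm_continuous continuous_on_subset by blast
  obtain a where a: "a \<in> ?S" "\<And>y. y \<in> ?S \<Longrightarrow> gnorm G a \<le> gnorm G y"
    using continuous_attains_inf[OF S cont] by blast
  obtain b where b: "b \<in> ?S" "\<And>y. y \<in> ?S \<Longrightarrow> gnorm G y \<le> gnorm G b"
    using continuous_attains_sup[OF S cont] by blast
  have ne: "a \<noteq> 0" "b \<noteq> 0" using a(1) b(1) by auto
  have unit: "gnorm G v = norm v * gnorm G (v /\<^sub>R norm v)" "v /\<^sub>R norm v \<in> ?S" if "v \<noteq> 0" for v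
    using that by (simp_all add: gnorm_scaleR)
  show ?thesis
  proof (rule that)
    show "0 < gnorm G a" "0 < gnorm G b" using gnorm_pos[OF G] ne by auto
    show "gnorm G a * norm v \<le> gnorm G v" for v
      using a(2)[OF unit(2), of v] unit(1)[of v]
      by (cases "v = 0") (simp_all add: gnorm_zero mult.commute mult_left_mono)
    show "gnorm G v \<le> gnorm G b * norm v" for v
      using b(2)[OF unit(2), of v] unit(1)[of v]
      by (cases "v = 0") (simp_all add: gnorm_zero mult.commute mult_left_mono)
  qed
qed

text \<open>The two quadratic forms differ by at most \<open>\<epsilon> (c |v|)\<^sup>2\<close>, which is at most \<open>\<epsilon>\<close> times the form of \<open>G\<close>.\<close>

lemma gnorm_perturb:
  fixes G H :: "real ^ 'n ^ 'n"
  assumes G: "sym_posdef G" and H: "sym_posdef H" and \<epsilon>: "0 < \<epsilon>" "\<epsilon> < 1" and c: "0 < c" "\<And>v. c * norm v \<le> gnorm G v"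
    and close: "onorm ((*v) (H - G)) \<le> \<epsilon> * c\<^sup>2"
  shows "(1 - \<epsilon>) * gnorm G v \<le> gnorm H v" "gnorm H v \<le> (1 + \<epsilon>) * gnorm G v"
proof -
  have "\<bar>v \<bullet> (H *v v) - v \<bullet> (G *v v)\<bar> = \<bar>v \<bullet> ((H - G) *v v)\<bar>"
    by (simp add: matrix_vector_mult_diff_rdistrib inner_diff_right)
  also have "\<dots> \<le> norm v * norm ((H - G) *v v)" by (rule Cauchy_Schwarz_ineq2)
  also have "\<dots> \<le> norm v * (onorm ((*v) (H - G)) * norm v)"
    by (intro mult_left_mono onorm matrix_vector_mul_bounded_linear) auto
  also have "\<dots> \<le> norm v * ((\<epsilon> * c\<^sup>2) * norm v)" by (intro mult_left_mono mult_right_mono close) auto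
  also have "\<dots> = \<epsilon> * (c * norm v)\<^sup>2" by (simp add: power2_eq_square algebra_simps)
  also have "\<dots> \<le> \<epsilon> * (gnorm G v)\<^sup>2" using c(2)[of v] c(1) \<epsilon> by (intro mult_left_mono power_mono) auto
  finally have 1: "\<bar>(gnorm H v)\<^sup>2 - (gnorm G v)\<^sup>2\<bar> \<le> \<epsilon> * (gnorm G v)\<^sup>2"
    by (simp add: gnorm_square G H)
  have "((1 - \<epsilon>) * gnorm G v)\<^sup>2 \<le> (1 - \<epsilon>) * (gnorm G v)\<^sup>2"
  proof -
    have "(1 - \<epsilon>)\<^sup>2 \<le> 1 - \<epsilon>" using \<epsilon> by (simp add: power2_eq_square mult_left_le)
    then show ?thesis unfolding power_mult_distrib by (intro mult_right_mono) auto
  qed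
  also have "\<dots> \<le> (gnorm H v)\<^sup>2" using 1 by (simp add: algebra_simps)
  finally show "(1 - \<epsilon>) * gnorm G v \<le> gnorm H v" by (rule power2_le_imp_le) (rule gnorm_nonneg[OF H])
  have "(gnorm H v)\<^sup>2 \<le> (1 + \<epsilon>) * (gnorm G v)\<^sup>2" using 1 by (simp add: algebra_simps)
  also have "\<dots> \<le> ((1 + \<epsilon>) * gnorm G v)\<^sup>2"
  proof -
    have "(1 + \<epsilon>) * 1 \<le> (1 + \<epsilon>) * (1 + \<epsilon>)" using \<epsilon> by (intro mult_left_mono) auto
    then show ?thesis using mult_right_mono[of "1 + \<epsilon>" "(1 + \<epsilon>)\<^sup>2" "(gnorm G v)\<^sup>2"]
      by (simp add: power_mult_distrib power2_eq_square mult_ac)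
  qed
  finally show "gnorm H v \<le> (1 + \<epsilon>) * gnorm G v"
    by (rule power2_le_imp_le) (use \<epsilon> gnorm_nonneg[OF G, of v] in auto)
qed

section \<open>Integrals along curves\<close>

text \<open>
  The integral of an arbitrary function is a lower integral, and every simple function below the
  integrand can be transported or cut. Thus the measurability of the speed of a curve never has to be
  discussed.
\<close>

lemma nn_integral_le_simpleI:
  assumes "\<And>h. h \<in> borel_measurable M \<Longrightarrow> (\<And>x. h x \<le> f x) \<Longrightarrow> integral\<^sup>N M h \<le> C"
  shows "integral\<^sup>N M f \<le> C"
  unfolding nn_integral_def
proof (rule SUP_least)
  fix h assume h: "h \<in> {g. simple_function M g \<and> g \<le> f}"
  then have "integral\<^sup>S M h = integral\<^sup>N M h" by (simp add: nn_integral_eq_simple_integral)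
  also have "\<dots> \<le> C" using h by (intro assms borel_measurable_simple_function) (auto simp: le_fun_def)
  finally show "integral\<^sup>S M h \<le> C" .
qed

lemma nn_integral_affine_le:
  fixes f :: "real \<Rightarrow> ennreal"
  assumes b: "b \<noteq> 0"
  shows "(\<integral>\<^sup>+x. ennreal \<bar>b\<bar> * f (a + b * x) \<partial>lborel) \<le> (\<integral>\<^sup>+x. f x \<partial>lborel)"
proof (rule nn_integral_le_simpleI)
  fix h assume [measurable]: "h \<in> borel_measurable lborel" and h: "\<And>x. h x \<le> ennreal \<bar>b\<bar> * f (a + b * x)"
  have b': "0 < ennreal \<bar>b\<bar>" "ennreal \<bar>b\<bar> \<noteq> \<top>" using b by auto
  have "(\<integral>\<^sup>+x. h x \<partial>lborel) = ennreal \<bar>b\<bar> * (\<integral>\<^sup>+x. h x / ennreal \<bar>b\<bar> \<partial>lborel)"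
  proof -
    have "h x = ennreal \<bar>b\<bar> * (h x / ennreal \<bar>b\<bar>)" for x
      using b' by (metis ennreal_mult_divide_eq ennreal_times_divide mult.commute neq_iff)
    then have "(\<integral>\<^sup>+x. h x \<partial>lborel) = (\<integral>\<^sup>+x. ennreal \<bar>b\<bar> * (h x / ennreal \<bar>b\<bar>) \<partial>lborel)"
      by (rule nn_integral_cong)
    then show ?thesis by (simp only: nn_integral_cmult borel_measurable_divide_ennreal
          borel_measurable_const \<open>h \<in> borel_measurable lborel\<close>)
  qed
  also have "\<dots> = ennreal \<bar>b\<bar> * (\<integral>\<^sup>+x. h (((a + b * x) - a) / b) / ennreal \<bar>b\<bar> \<partial>lborel)"
    using b by simp
  also have "\<dots> = (\<integral>\<^sup>+x. h ((x - a) / b) / ennreal \<bar>b\<bar> \<partial>lborel)"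
    by (rule nn_integral_real_affine[symmetric]) (use b in measurable)
  also have "\<dots> \<le> (\<integral>\<^sup>+x. f x \<partial>lborel)"
  proof (rule nn_integral_mono)
    fix x
    have "h ((x - a) / b) \<le> ennreal \<bar>b\<bar> * f x" using h[of "(x - a) / b"] b by simp
    then have "h ((x - a) / b) / ennreal \<bar>b\<bar> \<le> ennreal \<bar>b\<bar> * f x / ennreal \<bar>b\<bar>"
      by (rule divide_right_mono_ennreal)
    also have "\<dots> = f x" using b' by (metis ennreal_mult_divide_eq mult.commute neq_iff)
    finally show "h ((x - a) / b) / ennreal \<bar>b\<bar> \<le> f x" .
  qed
  finally show "integral\<^sup>N lborel h \<le> (\<integral>\<^sup>+x. f x \<partial>lborel)" .
qed

lemma nn_integral_split_le:
  fixes f :: "'a \<Rightarrow> ennreal"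
  assumes [measurable]: "A \<in> sets M" "B \<in> sets M" and null: "AE x in M. x \<in> A \<or> x \<in> B \<or> f x = 0"
  shows "(\<integral>\<^sup>+x. f x \<partial>M) \<le> (\<integral>\<^sup>+x\<in>A. f x \<partial>M) + (\<integral>\<^sup>+x\<in>B. f x \<partial>M)"
proof (rule nn_integral_le_simpleI)
  fix h assume [measurable]: "h \<in> borel_measurable M" and h: "\<And>x. h x \<le> f x"
  have "(\<integral>\<^sup>+x. h x \<partial>M) \<le> (\<integral>\<^sup>+x. h x * indicator A x + h x * indicator B x \<partial>M)"
  proof (rule nn_integral_mono_AE)
    show "AE x in M. h x \<le> h x * indicator A x + h x * indicator B x"
      using null
    proof eventually_elim
      case (elim x)
      then show ?case using h[of x] by (auto simp: indicator_def)
    qed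
  qed
  also have "\<dots> = (\<integral>\<^sup>+x\<in>A. h x \<partial>M) + (\<integral>\<^sup>+x\<in>B. h x \<partial>M)" by (rule nn_integral_add) measurable
  also have "\<dots> \<le> (\<integral>\<^sup>+x\<in>A. f x \<partial>M) + (\<integral>\<^sup>+x\<in>B. f x \<partial>M)"
    by (intro add_mono nn_integral_mono mult_right_mono h) auto
  finally show "integral\<^sup>N M h \<le> (\<integral>\<^sup>+x\<in>A. f x \<partial>M) + (\<integral>\<^sup>+x\<in>B. f x \<partial>M)" .
qed

text \<open>
  If the right-hand side is infinite there is nothing to prove. Otherwise the derivative is absolutely
  integrable and the fundamental theorem of calculus applies.
\<close>

lemma increment_le_nn_integral:
  fixes u u' :: "real \<Rightarrow> real" and w :: "real \<Rightarrow> ennreal"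
  assumes ab: "a \<le> b" and cont: "continuous_on {a..b} u" and S: "finite S"
    and der: "\<And>x. x \<in> {a<..<b} - S \<Longrightarrow> (u has_vector_derivative u' x) (at x)"
    and cont': "continuous_on ({a<..<b} - S) u'"
    and w: "\<And>x. x \<in> {a<..<b} - S \<Longrightarrow> ennreal \<bar>u' x\<bar> \<le> w x"
  shows "ennreal \<bar>u b - u a\<bar> \<le> (\<integral>\<^sup>+x\<in>{a..b}. w x \<partial>lborel)"
proof -
  define A where "A = {a<..<b} - S"
  have A: "A \<in> sets borel" unfolding A_def using S by (intro borel_open open_Diff finite_imp_closed) auto
  define v where "v x = indicator A x *\<^sub>R u' x" for x
  have v: "v \<in> borel_measurable borel"
    unfolding v_def by (rule borel_measurable_continuous_on_indicator[OF A]) (use cont' in \<open>simp add: A_def\<close>)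
  have le: "(\<integral>\<^sup>+x. ennreal (norm (v x)) \<partial>lborel) \<le> (\<integral>\<^sup>+x\<in>{a..b}. w x \<partial>lborel)"
    using w by (intro nn_integral_mono) (auto simp: v_def A_def indicator_def)
  show ?thesis
  proof (cases "(\<integral>\<^sup>+x\<in>{a..b}. w x \<partial>lborel) = \<infinity>")
    case False
    then have "(\<integral>\<^sup>+x. ennreal (norm (v x)) \<partial>lborel) < \<infinity>" using le by (auto simp: less_top top_unique)
    then have int: "integrable lborel v" using v by (intro integrableI_bounded) auto
    have "(u' has_integral (u b - u a)) {a..b}"
      by (rule fundamental_theorem_of_calculus_interior_strong[OF S ab der cont])
    moreover have "(u' has_integral integral\<^sup>L lborel v) {a..b}"
    proof -
      have "(v has_integral integral\<^sup>L lborel v) UNIV" by (rule has_integral_integral_lborel[OF int])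
      then have "((\<lambda>x. if x \<in> {a..b} then v x else 0) has_integral integral\<^sup>L lborel v) UNIV"
        by (rule has_integral_eq[rotated]) (auto simp: v_def A_def indicator_def)
      then have "(v has_integral integral\<^sup>L lborel v) {a..b}" by (simp only: has_integral_restrict_UNIV)
      then show ?thesis
      proof (rule has_integral_spike_finite[rotated 2])
        show "finite (S \<union> {a, b})" using S by simp
        show "u' x = v x" if "x \<in> {a..b} - (S \<union> {a, b})" for x
          using that by (auto simp: v_def A_def indicator_def)
      qed
    qed
    ultimately have "u b - u a = integral\<^sup>L lborel v" by (rule has_integral_unique)
    then have "ennreal \<bar>u b - u a\<bar> \<le> ennreal (integral\<^sup>L lborel (\<lambda>x. norm (v x)))"
      using integral_norm_bound[of lborel v] by (intro ennreal_leI) simp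
    also have "\<dots> = (\<integral>\<^sup>+x. ennreal (norm (v x)) \<partial>lborel)"
      using int by (intro nn_integral_eq_integral[symmetric]) auto
    finally show ?thesis using le by simp
  qed simp
qed

section \<open>Charts of a Riemannian manifold\<close>

locale riemannian =
  fixes \<A> :: "('a::{t2_space, second_countable_topology}, 'n::finite) chart set"
    and g :: "('a, 'n) metric_components"
  assumes manifold: "riemannian_manifold \<A> g"
begin

lemma chart:
  assumes "(U, \<phi>) \<in> \<A>"
  shows chart_open: "open U" and chart_open_image: "open (\<phi> ` U)" and chart_inj: "inj_on \<phi> U"
    and chart_continuous: "continuous_on U \<phi>"
    and chart_inv_continuous: "continuous_on (\<phi> ` U) (inv_into U \<phi>)"
  using assms manifold
  by (auto simp: riemannian_manifold_def smooth_atlas_def is_chart_def homeomorphism_def)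

lemma chart_cover: obtains U \<phi> where "(U, \<phi>) \<in> \<A>" "p \<in> U"
proof -
  have "p \<in> (\<Union>c\<in>\<A>. fst c)" using manifold by (simp add: riemannian_manifold_def smooth_atlas_def)
  then show ?thesis using that by auto
qed

lemma chart_inv: "(U, \<phi>) \<in> \<A> \<Longrightarrow> p \<in> U \<Longrightarrow> inv_into U \<phi> (\<phi> p) = p"
  by (simp add: chart_inj inv_into_f_f)

lemma chart_preimage_open:
  assumes "(U, \<phi>) \<in> \<A>" "open W"
  shows "open {p \<in> U. \<phi> p \<in> W}"
  using continuous_open_preimage[OF chart_continuous[OF assms(1)] chart_open[OF assms(1)] assms(2)]
  by (simp add: vimage_def Int_def)

lemma transition_smooth:
  "(U, \<phi>) \<in> \<A> \<Longrightarrow> (V, \<psi>) \<in> \<A> \<Longrightarrow> smooth_on (\<phi> ` (U \<inter> V)) (\<psi> \<circ> inv_into U \<phi>)"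
  using manifold by (fastforce simp: riemannian_manifold_def smooth_atlas_def)

lemma smooth_onD:
  assumes "smooth_on S F"
  shows "x \<in> S \<Longrightarrow> F differentiable at x" "continuous_on S (\<lambda>x. frechet_derivative F (at x) v)"
    "continuous_on S F"
proof -
  have "Ck_on (Suc 0) F S" "Ck_on 0 F S" using assms unfolding smooth_on_def by blast+
  then show "x \<in> S \<Longrightarrow> F differentiable at x" "continuous_on S (\<lambda>x. frechet_derivative F (at x) v)"
    "continuous_on S F" by auto
qed

lemma metric_continuous: "(U, \<phi>) \<in> \<A> \<Longrightarrow> continuous_on (\<phi> ` U) (\<lambda>y. g (U, \<phi>) (inv_into U \<phi> y))"
  using manifold smooth_onD(3)[of "\<phi> ` U" "g (U, \<phi>) \<circ> inv_into U \<phi>"]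
  by (fastforce simp: riemannian_manifold_def riemannian_metric_def comp_def)

lemma metric_sym_posdef: "(U, \<phi>) \<in> \<A> \<Longrightarrow> p \<in> U \<Longrightarrow> sym_posdef (g (U, \<phi>) p)"
  using manifold unfolding riemannian_manifold_def riemannian_metric_def sym_posdef_def by fast

text \<open>The length of a tangent vector does not depend on the chart.\<close>

lemma metric_transform:
  assumes c: "(U, \<phi>) \<in> \<A>" "(V, \<psi>) \<in> \<A>" and p: "p \<in> U" "p \<in> V"
  shows "gnorm (g (U, \<phi>) p) v
    = gnorm (g (V, \<psi>) p) (frechet_derivative (\<psi> \<circ> inv_into U \<phi>) (at (\<phi> p)) v)"
proof -
  let ?F = "\<psi> \<circ> inv_into U \<phi>"
  define J where "J = jacobian ?F (at (\<phi> p))"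
  have tr: "g (U, \<phi>) p = transpose J ** g (V, \<psi>) p ** J"
    using manifold c p unfolding riemannian_manifold_def riemannian_metric_def J_def Let_def by fast
  have "?F differentiable at (\<phi> p)"
    by (rule smooth_onD(1)[OF transition_smooth[OF c]]) (use p in auto)
  then have "(?F has_derivative (*v) J) (at (\<phi> p))" unfolding J_def by (simp add: jacobian_works)
  then have J: "J *v v = frechet_derivative ?F (at (\<phi> p)) v"
    by (metis frechet_derivative_at)
  have "v \<bullet> (g (U, \<phi>) p *v v) = v \<bullet> (transpose J *v (g (V, \<psi>) p *v (J *v v)))"
    unfolding tr by (simp add: matrix_vector_mul_assoc matrix_mul_assoc)
  also have "\<dots> = (J *v v) \<bullet> (g (V, \<psi>) p *v (J *v v))"
    by (metis dot_lmul_matrix transpose_matrix_vector transpose_transpose)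
  finally show ?thesis unfolding gnorm_def J by simp
qed

section \<open>Speed and length of curves\<close>

text \<open>Short names, with the atlas and the metric fixed.\<close>

definition speed :: "(real \<Rightarrow> 'a) \<Rightarrow> real \<Rightarrow> real" where
  "speed = curve_speed \<A> g"

definition len :: "(real \<Rightarrow> 'a) \<Rightarrow> ennreal" where
  "len = curve_length \<A> g"

definition curve :: "(real \<Rightarrow> 'a) \<Rightarrow> bool" where
  "curve = piecewise_C1_curve \<A>"

lemma len_eq: "len \<sigma> = (\<integral>\<^sup>+t\<in>{0..1}. ennreal (speed \<sigma> t) \<partial>lborel)"
  by (simp add: len_def curve_length_def speed_def)

lemma curve_path: "curve \<sigma> \<Longrightarrow> path \<sigma>"
  by (simp add: curve_def piecewise_C1_curve_def)

lemma curve_piecewise: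
  "curve \<sigma> \<Longrightarrow> (U, \<phi>) \<in> \<A> \<Longrightarrow> 0 \<le> a \<Longrightarrow> b \<le> 1 \<Longrightarrow> (\<And>t. a \<le> t \<Longrightarrow> t \<le> b \<Longrightarrow> \<sigma> t \<in> U) \<Longrightarrow>
    (\<phi> \<circ> \<sigma>) piecewise_C1_differentiable_on {a..b}"
proof -
  assume *: "curve \<sigma>" "(U, \<phi>) \<in> \<A>" "0 \<le> a" "b \<le> 1" "\<And>t. a \<le> t \<Longrightarrow> t \<le> b \<Longrightarrow> \<sigma> t \<in> U"
  have "{a..b} \<subseteq> {0..1} \<and> \<sigma> ` {a..b} \<subseteq> U" using * by auto
  then show ?thesis using *(1,2) unfolding curve_def piecewise_C1_curve_def by blast
qed

lemma path_near:
  assumes "path \<sigma>" "t \<in> {0<..<1}" "open W" "\<sigma> t \<in> W"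
  obtains \<delta> where "0 < \<delta>" "ball t \<delta> \<subseteq> {0<..<1}" "\<And>s. s \<in> ball t \<delta> \<Longrightarrow> \<sigma> s \<in> W"
proof -
  have "continuous_on {0<..<1} \<sigma>" using assms(1) unfolding path_def by (rule continuous_on_subset) auto
  then have "open ({0<..<1} \<inter> \<sigma> -` W)" by (rule continuous_open_preimage) (use assms in auto)
  moreover have "t \<in> {0<..<1} \<inter> \<sigma> -` W" using assms by auto
  ultimately obtain \<delta> where "0 < \<delta>" "ball t \<delta> \<subseteq> {0<..<1} \<inter> \<sigma> -` W" by (rule openE)
  then show ?thesis by (intro that[of \<delta>]) auto
qed

lemma velocity_transform:
  assumes \<sigma>: "path \<sigma>" "t \<in> {0<..<1}" and c: "(U, \<phi>) \<in> \<A>" "(V, \<psi>) \<in> \<A>" and p: "\<sigma> t \<in> U" "\<sigma> t \<in> V"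
    and v: "((\<phi> \<circ> \<sigma>) has_vector_derivative v) (at t)"
  shows "((\<psi> \<circ> \<sigma>) has_vector_derivative frechet_derivative (\<psi> \<circ> inv_into U \<phi>) (at (\<phi> (\<sigma> t))) v) (at t)"
proof -
  let ?F = "\<psi> \<circ> inv_into U \<phi>"
  obtain \<delta> where \<delta>: "0 < \<delta>" "\<And>s. s \<in> ball t \<delta> \<Longrightarrow> \<sigma> s \<in> U"
    using path_near[OF \<sigma> chart_open[OF c(1)] p(1)] by metis
  have "?F differentiable at (\<phi> (\<sigma> t))"
    by (rule smooth_onD(1)[OF transition_smooth[OF c]]) (use p in auto)
  then have F: "(?F has_derivative frechet_derivative ?F (at (\<phi> (\<sigma> t)))) (at ((\<phi> \<circ> \<sigma>) t))"
    by (simp add: frechet_derivative_works)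
  have lin: "linear (frechet_derivative ?F (at (\<phi> (\<sigma> t))))" using F has_derivative_linear by blast
  have d: "(?F \<circ> (\<phi> \<circ> \<sigma>) has_derivative frechet_derivative ?F (at (\<phi> (\<sigma> t))) \<circ> (\<lambda>h. h *\<^sub>R v)) (at t)"
    by (rule diff_chain_at[OF v[unfolded has_vector_derivative_def] F])
  have "(?F \<circ> (\<phi> \<circ> \<sigma>) has_vector_derivative frechet_derivative ?F (at (\<phi> (\<sigma> t))) v) (at t)"
  proof -
    have "frechet_derivative ?F (at (\<phi> (\<sigma> t))) \<circ> (\<lambda>h. h *\<^sub>R v)
        = (\<lambda>h. h *\<^sub>R frechet_derivative ?F (at (\<phi> (\<sigma> t))) v)"
      by (rule ext) (simp add: linear_cmul[OF lin])
    with d show ?thesis unfolding has_vector_derivative_def by simp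
  qed
  then show ?thesis
  proof (rule has_vector_derivative_transform_within_open[of _ _ _ "ball t \<delta>"])
    show "(?F \<circ> (\<phi> \<circ> \<sigma>)) s = (\<psi> \<circ> \<sigma>) s" if "s \<in> ball t \<delta>" for s
      using chart_inv[OF c(1) \<delta>(2)[OF that]] by simp
  qed (use \<delta> in auto)
qed

text \<open>Hence the chart that the definition of the speed picks is irrelevant.\<close>

lemma speed_in_chart:
  assumes \<sigma>: "path \<sigma>" "t \<in> {0<..<1}" and c: "(U, \<phi>) \<in> \<A>" and p: "\<sigma> t \<in> U"
    and v: "((\<phi> \<circ> \<sigma>) has_vector_derivative v) (at t)"
  shows "speed \<sigma> t = gnorm (g (U, \<phi>) (\<sigma> t)) v"
proof -
  define c' where "c' = (SOME c. c \<in> \<A> \<and> \<sigma> t \<in> fst c)"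
  have "c' \<in> \<A> \<and> \<sigma> t \<in> fst c'" unfolding c'_def by (rule someI[of _ "(U, \<phi>)"]) (use c p in auto)
  then obtain V \<psi> where c': "c' = (V, \<psi>)" "(V, \<psi>) \<in> \<A>" "\<sigma> t \<in> V" by (cases c') auto
  have "vector_derivative (\<psi> \<circ> \<sigma>) (at t) = frechet_derivative (\<psi> \<circ> inv_into U \<phi>) (at (\<phi> (\<sigma> t))) v"
    by (rule vector_derivative_at) (rule velocity_transform[OF \<sigma> c c'(2) p c'(3) v])
  then have "speed \<sigma> t = gnorm (g (V, \<psi>) (\<sigma> t)) (frechet_derivative (\<psi> \<circ> inv_into U \<phi>) (at (\<phi> (\<sigma> t))) v)"
    unfolding speed_def curve_speed_def c'_def[symmetric] c'(1) by (simp add: gnorm_def Let_def)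
  then show ?thesis using metric_transform[OF c c'(2) p c'(3)] by simp
qed

text \<open>Differentiability in one chart at the point; it implies the same in every other chart there.\<close>

definition regular :: "(real \<Rightarrow> 'a) \<Rightarrow> real \<Rightarrow> bool" where
  "regular \<sigma> t \<longleftrightarrow> (\<exists>U \<phi> v. (U, \<phi>) \<in> \<A> \<and> \<sigma> t \<in> U \<and> ((\<phi> \<circ> \<sigma>) has_vector_derivative v) (at t))"

text \<open>In each chart a curve has finitely many corners; bisection of the interval makes this global.\<close>

lemma finite_irregular:
  assumes \<sigma>: "curve \<sigma>"
  shows "finite {t \<in> {0..1}. \<not> regular \<sigma> t}"
proof -
  have cont: "continuous_on {0..1} \<sigma>" using curve_path[OF \<sigma>] by (simp add: path_def)
  have "0 \<le> (0::real) \<and> (1::real) \<le> 1 \<longrightarrow> finite {t \<in> {0..1}. \<not> regular \<sigma> t}"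
  proof (rule Bolzano[of 0 1 "\<lambda>a b. 0 \<le> a \<and> b \<le> 1 \<longrightarrow> finite {t \<in> {a..b}. \<not> regular \<sigma> t}"])
    show "(0::real) \<le> 1" by simp
  next
    fix a b c :: real
    assume ab: "0 \<le> a \<and> b \<le> 1 \<longrightarrow> finite {t \<in> {a..b}. \<not> regular \<sigma> t}"
      and bc: "0 \<le> b \<and> c \<le> 1 \<longrightarrow> finite {t \<in> {b..c}. \<not> regular \<sigma> t}" and le: "a \<le> b" "b \<le> c"
    have "{t \<in> {a..c}. \<not> regular \<sigma> t} = {t \<in> {a..b}. \<not> regular \<sigma> t} \<union> {t \<in> {b..c}. \<not> regular \<sigma> t}"
      using le by auto
    then show "0 \<le> a \<and> c \<le> 1 \<longrightarrow> finite {t \<in> {a..c}. \<not> regular \<sigma> t}" using ab bc le by auto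
  next
    fix x :: real assume local: "0 \<le> x" "x \<le> 1"
    obtain U \<phi> where c: "(U, \<phi>) \<in> \<A>" "\<sigma> x \<in> U" by (rule chart_cover)
    have "\<exists>T. open T \<and> T \<inter> {0..1} = {0..1} \<inter> \<sigma> -` U"
      using cont chart_open[OF c(1)] unfolding continuous_on_open_invariant by (auto simp: Int_commute)
    then obtain T where T: "open T" "T \<inter> {0..1} = {0..1} \<inter> \<sigma> -` U" by blast
    have "x \<in> T" using T(2) c(2) local by auto
    then obtain \<delta> where \<delta>: "0 < \<delta>" "ball x \<delta> \<subseteq> T" using T(1) openE by blast
    show "\<exists>d>0. \<forall>a b. a \<le> x \<and> x \<le> b \<and> b - a < d \<longrightarrow> 0 \<le> a \<and> b \<le> 1 \<longrightarrow> finite {t \<in> {a..b}. \<not> regular \<sigma> t}"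
    proof (intro exI[of _ \<delta>] conjI allI impI \<delta>)
      fix a b assume ab: "a \<le> x \<and> x \<le> b \<and> b - a < \<delta>" "0 \<le> a \<and> b \<le> 1"
      have in_U: "\<sigma> t \<in> U" if "a \<le> t" "t \<le> b" for t
      proof -
        have "t \<in> ball x \<delta>" using that ab by (auto simp: dist_real_def)
        then have "t \<in> T \<inter> {0..1}" using \<delta>(2) that ab by auto
        then show ?thesis unfolding T(2) by simp
      qed
      then have "(\<phi> \<circ> \<sigma>) piecewise_C1_differentiable_on {a..b}" using ab by (intro curve_piecewise[OF \<sigma> c(1)]) auto
      then obtain S D where S: "finite S" "\<And>t. t \<in> {a..b} - S \<Longrightarrow> ((\<phi> \<circ> \<sigma>) has_vector_derivative D t) (at t)"
        unfolding piecewise_C1_differentiable_on_def C1_differentiable_on_def by blast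
      have "{t \<in> {a..b}. \<not> regular \<sigma> t} \<subseteq> S"
        using S(2) in_U c unfolding regular_def by fastforce
      then show "finite {t \<in> {a..b}. \<not> regular \<sigma> t}" using S(1) finite_subset by blast
    qed
  qed
  then show ?thesis by simp
qed

text \<open>Affine changes of parameter cover both the reversal and the concatenation of curves.\<close>

lemma speed_affine:
  assumes "path \<sigma>" "path \<sigma>'" and t: "t \<in> {0<..<1}" "a + b * t \<in> {0<..<1}" and W: "open W" "t \<in> W"
    and eq: "\<And>s. s \<in> W \<Longrightarrow> \<sigma>' s = \<sigma> (a + b * s)" and reg: "regular \<sigma> (a + b * t)"
  shows "speed \<sigma>' t = \<bar>b\<bar> * speed \<sigma> (a + b * t)"
proof -
  obtain U \<phi> v where c: "(U, \<phi>) \<in> \<A>" "\<sigma> (a + b * t) \<in> U"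
    and v: "((\<phi> \<circ> \<sigma>) has_vector_derivative v) (at (a + b * t))" using reg unfolding regular_def by blast
  have "((\<lambda>s. a + b * s) has_vector_derivative b) (at t)"
    by (auto intro!: derivative_eq_intros simp: has_real_derivative_iff_has_vector_derivative[symmetric])
  from vector_diff_chain_at[OF this v]
  have "((\<phi> \<circ> \<sigma>) \<circ> (\<lambda>s. a + b * s) has_vector_derivative b *\<^sub>R v) (at t)" .
  then have v': "((\<phi> \<circ> \<sigma>') has_vector_derivative b *\<^sub>R v) (at t)"
    by (rule has_vector_derivative_transform_within_open[OF _ W]) (simp add: eq)
  have "\<sigma>' t = \<sigma> (a + b * t)" using eq W by blast
  then show ?thesis
    using speed_in_chart[OF assms(2) t(1) c(1) _ v'] speed_in_chart[OF assms(1) t(2) c v] c(2)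
    by (simp add: gnorm_scaleR)
qed

lemma len_affine_piece:
  assumes \<sigma>: "curve \<sigma>" and \<sigma>': "path \<sigma>'" and b: "b \<noteq> 0" and W: "open W" "W \<subseteq> {0<..<1}"
    and maps: "\<And>s. s \<in> W \<Longrightarrow> a + b * s \<in> {0<..<1}" and eq: "\<And>s. s \<in> W \<Longrightarrow> \<sigma>' s = \<sigma> (a + b * s)"
  shows "(\<integral>\<^sup>+t\<in>W - {t. \<not> regular \<sigma> (a + b * t)}. ennreal (speed \<sigma>' t) \<partial>lborel) \<le> len \<sigma>"
proof -
  have "(\<integral>\<^sup>+t\<in>W - {t. \<not> regular \<sigma> (a + b * t)}. ennreal (speed \<sigma>' t) \<partial>lborel)
      \<le> (\<integral>\<^sup>+t. ennreal \<bar>b\<bar> * (ennreal (speed \<sigma> (a + b * t)) * indicator {0..1} (a + b * t)) \<partial>lborel)"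
  proof (intro nn_integral_mono)
    fix t
    show "ennreal (speed \<sigma>' t) * indicator (W - {t. \<not> regular \<sigma> (a + b * t)}) t
        \<le> ennreal \<bar>b\<bar> * (ennreal (speed \<sigma> (a + b * t)) * indicator {0..1} (a + b * t))"
    proof (cases "t \<in> W \<and> regular \<sigma> (a + b * t)")
      case True
      then have "speed \<sigma>' t = \<bar>b\<bar> * speed \<sigma> (a + b * t)"
        using W maps by (intro speed_affine[OF curve_path[OF \<sigma>] \<sigma>' _ _ W(1) _ eq]) auto
      moreover have "a + b * t \<in> {0..1}" using maps[of t] True by auto
      ultimately show ?thesis by (simp add: ennreal_mult' indicator_def)
    qed (auto simp: indicator_def)
  qed
  also have "\<dots> \<le> len \<sigma>" unfolding len_eq
    by (rule nn_integral_affine_le[OF b, of "\<lambda>t. ennreal (speed \<sigma> t) * indicator {0..1} t"])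
  finally show ?thesis .
qed

lemma finite_irregular_affine:
  assumes \<sigma>: "curve \<sigma>" and b: "b \<noteq> 0"
  shows "finite {t. a + b * t \<in> {0..1} \<and> \<not> regular \<sigma> (a + b * t)}"
proof -
  have "inj (\<lambda>t. a + b * t)" using b by (auto intro: injI)
  then have "finite ((\<lambda>t. a + b * t) -` {t \<in> {0..1}. \<not> regular \<sigma> t})"
    by (intro finite_vimageI finite_irregular \<sigma>)
  then show ?thesis by (simp add: vimage_def)
qed

text \<open>
  Derivatives are two-sided, also at the ends of the interval, where the functions may differ on one
  side. So the ends join the exceptional set.
\<close>

lemma piecewise_C1_cong:
  assumes f: "f piecewise_C1_differentiable_on {a..b::real}" and eq: "\<And>t. t \<in> {a..b} \<Longrightarrow> f t = h t"
  shows "h piecewise_C1_differentiable_on {a..b}"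
proof -
  obtain S D where S: "finite S" "\<And>t. t \<in> {a..b} - S \<Longrightarrow> (f has_vector_derivative D t) (at t)" "continuous_on ({a..b} - S) D"
    and cont: "continuous_on {a..b} f"
    using f unfolding piecewise_C1_differentiable_on_def C1_differentiable_on_def by blast
  have "(h has_vector_derivative D t) (at t)" if t: "t \<in> {a..b} - (S \<union> {a, b})" for t
    by (rule has_vector_derivative_transform_within_open[of f _ _ "{a<..<b}"]) (use t S(2) eq in auto)
  moreover have "continuous_on ({a..b} - (S \<union> {a, b})) D" by (rule continuous_on_subset[OF S(3)]) auto
  moreover have "continuous_on {a..b} h" using continuous_on_cong[OF refl eq, of "{a..b}"] cont by simp
  ultimately show ?thesis
    unfolding piecewise_C1_differentiable_on_def C1_differentiable_on_def
    using S(1) by (intro conjI exI[of _ "S \<union> {a, b}"] exI[of _ D]) auto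
qed

lemma piecewise_C1_combine:
  assumes 1: "f piecewise_C1_differentiable_on {a..c::real}" and 2: "f piecewise_C1_differentiable_on {c..b}"
    and le: "a \<le> c" "c \<le> b"
  shows "f piecewise_C1_differentiable_on {a..b}"
proof -
  have "(\<lambda>x. if x \<le> c then f x else f x) piecewise_C1_differentiable_on {a..b}"
    by (rule piecewise_C1_differentiable_cases[OF 1 2 le refl])
  then show ?thesis by simp
qed

lemma curve_affine_piece:
  assumes \<sigma>: "curve \<sigma>" and c: "(U, \<phi>) \<in> \<A>" and b: "b \<noteq> 0"
    and maps: "\<And>s. s \<in> {l..u} \<Longrightarrow> a + b * s \<in> {0..1} \<and> \<sigma>' s = \<sigma> (a + b * s) \<and> \<sigma>' s \<in> U"
  shows "(\<phi> \<circ> \<sigma>') piecewise_C1_differentiable_on {l..u}"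
proof (cases "l \<le> u")
  case True
  define l' u' where "l' = min (a + b * l) (a + b * u)" and "u' = max (a + b * l) (a + b * u)"
  have image: "(\<lambda>s. b * s + a) ` {l..u} = {l'..u'}"
    using b True unfolding image_affinity_atLeastAtMost l'_def u'_def
    by (auto simp: algebra_simps min_def max_def mult_le_cancel_left)
  have ends: "0 \<le> l'" "u' \<le> 1" using maps[of l] maps[of u] True by (auto simp: l'_def u'_def)
  have "(\<phi> \<circ> \<sigma>) piecewise_C1_differentiable_on {l'..u'}"
  proof (rule curve_piecewise[OF \<sigma> c ends])
    fix t assume "l' \<le> t" "t \<le> u'"
    then have "t \<in> (\<lambda>s. b * s + a) ` {l..u}" unfolding image by simp
    then obtain s where "s \<in> {l..u}" "t = b * s + a" by blast
    then show "\<sigma> t \<in> U" using maps[of s] by (metis add.commute)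
  qed
  then have "((\<phi> \<circ> \<sigma>) \<circ> (\<lambda>s. b *\<^sub>R s + a)) piecewise_C1_differentiable_on {l..u}"
    using b by (intro piecewise_C1_differentiable_affine) (auto simp: image)
  then show ?thesis by (rule piecewise_C1_cong) (use maps in \<open>simp add: add.commute\<close>)
qed (auto simp: piecewise_C1_differentiable_on_def C1_differentiable_on_def intro: exI[of _ "{}"])

lemma curve_reversepath:
  assumes \<sigma>: "curve \<sigma>"
  shows "curve (reversepath \<sigma>)" "len (reversepath \<sigma>) \<le> len \<sigma>"
proof -
  have path: "path (reversepath \<sigma>)" using curve_path[OF \<sigma>] by simp
  have "(\<phi> \<circ> reversepath \<sigma>) piecewise_C1_differentiable_on {l..u}"
    if c: "(U, \<phi>) \<in> \<A>" and lu: "{l..u} \<subseteq> {0..1}" "reversepath \<sigma> ` {l..u} \<subseteq> U" for U \<phi> l u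
  proof (rule curve_affine_piece[OF \<sigma> c, of "-1" _ _ 1])
    fix s assume s: "s \<in> {l..u}"
    then have "s \<in> {0..1}" "reversepath \<sigma> s \<in> U" using lu by auto
    then show "1 + - 1 * s \<in> {0..1} \<and> reversepath \<sigma> s = \<sigma> (1 + - 1 * s) \<and> reversepath \<sigma> s \<in> U"
      by (auto simp: reversepath_def)
  qed simp
  then show "curve (reversepath \<sigma>)"
    using path unfolding curve_def piecewise_C1_curve_def by blast
  let ?W = "{0<..<1::real}" and ?N = "{t. \<not> regular \<sigma> (1 + (-1) * t)}"
  have fin: "finite {t. 1 + (-1) * t \<in> {0..1} \<and> \<not> regular \<sigma> (1 + (-1) * t)}"
    by (rule finite_irregular_affine[OF \<sigma>]) simp
  have fin': "finite ({0, 1} \<union> {t. 1 + (-1) * t \<in> {0..1} \<and> \<not> regular \<sigma> (1 + (-1) * t)})" using fin by simp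
  have meas: "?W - ?N \<in> sets lborel"
  proof -
    have "?W - ?N = ?W - {t. 1 + (-1) * t \<in> {0..1} \<and> \<not> regular \<sigma> (1 + (-1) * t)}" by auto
    then show ?thesis using fin by (auto intro!: borel_open open_Diff finite_imp_closed)
  qed
  have "len (reversepath \<sigma>) \<le> (\<integral>\<^sup>+t\<in>?W - ?N. ennreal (speed (reversepath \<sigma>) t) * indicator {0..1} t \<partial>lborel)
      + (\<integral>\<^sup>+t\<in>{}. ennreal (speed (reversepath \<sigma>) t) * indicator {0..1} t \<partial>lborel)"
    unfolding len_eq
  proof (rule nn_integral_split_le[OF meas])
    have "AE t in lborel. t \<notin> {0, 1} \<union> {t. 1 + (-1) * t \<in> {0..1} \<and> \<not> regular \<sigma> (1 + (-1) * t)}"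
      using finite_imp_null_set_lborel[OF fin'] by (rule AE_not_in)
    then show "AE t in lborel. t \<in> ?W - ?N \<or> t \<in> {} \<or> ennreal (speed (reversepath \<sigma>) t) * indicator {0..1} t = 0"
      by eventually_elim (auto simp: indicator_def)
  qed simp
  also have "\<dots> \<le> (\<integral>\<^sup>+t\<in>?W - ?N. ennreal (speed (reversepath \<sigma>) t) \<partial>lborel)"
    by (auto intro!: nn_integral_mono simp: indicator_def)
  also have "\<dots> \<le> len \<sigma>"
    by (rule len_affine_piece[OF \<sigma> path]) (auto simp: reversepath_def)
  finally show "len (reversepath \<sigma>) \<le> len \<sigma>" .
qed

lemma curve_joinpaths:
  assumes \<sigma>1: "curve \<sigma>1" and \<sigma>2: "curve \<sigma>2" and ends: "pathfinish \<sigma>1 = pathstart \<sigma>2"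
  shows "curve (\<sigma>1 +++ \<sigma>2)" "len (\<sigma>1 +++ \<sigma>2) \<le> len \<sigma>1 + len \<sigma>2"
proof -
  let ?J = "\<sigma>1 +++ \<sigma>2"
  have path: "path ?J" using curve_path[OF \<sigma>1] curve_path[OF \<sigma>2] ends by simp
  have right: "?J s = \<sigma>2 (- 1 + 2 * s)" if "1/2 \<le> s" for s
  proof (cases "s = 1/2")
    case True
    show ?thesis unfolding True using ends by (simp add: joinpaths_def pathfinish_def pathstart_def)
  qed (use that in \<open>simp add: joinpaths_def\<close>)
  have left: "?J s = \<sigma>1 (0 + 2 * s)" if "s \<le> 1/2" for s using that by (simp add: joinpaths_def)
  have "(\<phi> \<circ> ?J) piecewise_C1_differentiable_on {l..u}"
    if c: "(U, \<phi>) \<in> \<A>" and lu: "{l..u} \<subseteq> {0..1}" "?J ` {l..u} \<subseteq> U" for U \<phi> l u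
  proof -
    have piece1: "(\<phi> \<circ> ?J) piecewise_C1_differentiable_on {l..u'}" if "u' \<le> u" "u' \<le> 1/2" for u'
    proof (rule curve_affine_piece[OF \<sigma>1 c, of 2 _ _ 0])
      fix s assume s: "s \<in> {l..u'}"
      then have "s \<in> {0..1}" "?J s \<in> U" using lu that by auto
      then show "0 + 2 * s \<in> {0..1} \<and> ?J s = \<sigma>1 (0 + 2 * s) \<and> ?J s \<in> U"
        using left[of s] s that by auto
    qed simp
    have piece2: "(\<phi> \<circ> ?J) piecewise_C1_differentiable_on {l'..u}" if "l \<le> l'" "1/2 \<le> l'" for l'
    proof (rule curve_affine_piece[OF \<sigma>2 c, of 2 _ _ "-1"])
      fix s assume s: "s \<in> {l'..u}"
      then have "s \<in> {0..1}" "?J s \<in> U" using lu that by auto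
      then show "- 1 + 2 * s \<in> {0..1} \<and> ?J s = \<sigma>2 (- 1 + 2 * s) \<and> ?J s \<in> U"
        using right[of s] s that by auto
    qed simp
    consider "u \<le> 1/2" | "1/2 \<le> l" | "l < 1/2" "1/2 < u" by linarith
    then show ?thesis
    proof cases
      case 3
      then show ?thesis by (intro piecewise_C1_combine[of _ l "1/2" u] piece1 piece2) auto
    qed (use piece1[of u] piece2[of l] in auto)
  qed
  then show "curve ?J" using path unfolding curve_def piecewise_C1_curve_def by blast
  let ?A = "{0<..<1/2::real}" and ?NA = "{t. \<not> regular \<sigma>1 (0 + 2 * t)}"
  let ?B = "{1/2<..<1::real}" and ?NB = "{t. \<not> regular \<sigma>2 (-1 + 2 * t)}"
  let ?FA = "{t. 0 + 2 * t \<in> {0..1} \<and> \<not> regular \<sigma>1 (0 + 2 * t)}"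
  let ?FB = "{t. - 1 + 2 * t \<in> {0..1} \<and> \<not> regular \<sigma>2 (- 1 + 2 * t)}"
  have fin: "finite ?FA" "finite ?FB"
    using finite_irregular_affine[OF \<sigma>1, of 2 0] finite_irregular_affine[OF \<sigma>2, of 2 "-1"] by auto
  have meas: "?A - ?NA \<in> sets lborel" "?B - ?NB \<in> sets lborel"
  proof -
    have "?A - ?NA = ?A - ?FA" "?B - ?NB = ?B - ?FB" by auto
    then show "?A - ?NA \<in> sets lborel" "?B - ?NB \<in> sets lborel"
      using fin by (auto intro!: borel_open open_Diff finite_imp_closed)
  qed
  have "len ?J \<le> (\<integral>\<^sup>+t\<in>?A - ?NA. ennreal (speed ?J t) * indicator {0..1} t \<partial>lborel)
      + (\<integral>\<^sup>+t\<in>?B - ?NB. ennreal (speed ?J t) * indicator {0..1} t \<partial>lborel)"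
    unfolding len_eq
  proof (rule nn_integral_split_le[OF meas])
    have "finite ({0, 1/2, 1} \<union> ?FA \<union> ?FB)" using fin by simp
    then have "AE t in lborel. t \<notin> {0, 1/2, 1} \<union> ?FA \<union> ?FB"
      by (intro AE_not_in finite_imp_null_set_lborel)
    then show "AE t in lborel. t \<in> ?A - ?NA \<or> t \<in> ?B - ?NB \<or> ennreal (speed ?J t) * indicator {0..1} t = 0"
      by eventually_elim (auto simp: indicator_def)
  qed
  also have "\<dots> \<le> (\<integral>\<^sup>+t\<in>?A - ?NA. ennreal (speed ?J t) \<partial>lborel) + (\<integral>\<^sup>+t\<in>?B - ?NB. ennreal (speed ?J t) \<partial>lborel)"
    by (intro add_mono nn_integral_mono) (auto simp: indicator_def)
  also have "\<dots> \<le> len \<sigma>1 + len \<sigma>2"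
    by (intro add_mono len_affine_piece[OF \<sigma>1 path] len_affine_piece[OF \<sigma>2 path] left right) auto
  finally show "len ?J \<le> len \<sigma>1 + len \<sigma>2" .
qed

definition rdist :: "'a \<Rightarrow> 'a \<Rightarrow> ennreal" where
  "rdist = riem_dist \<A> g"

lemma rdist_eq: "rdist x y = (INF \<sigma>\<in>{\<sigma>. curve \<sigma> \<and> pathstart \<sigma> = x \<and> pathfinish \<sigma> = y}. len \<sigma>)"
  by (simp add: rdist_def riem_dist_def curve_def len_def)

lemma rdist_le: "curve \<sigma> \<Longrightarrow> rdist (pathstart \<sigma>) (pathfinish \<sigma>) \<le> len \<sigma>"
  unfolding rdist_eq by (intro INF_lower) auto

lemma rdist_sym: "rdist x y = rdist y x"
proof -
  have "rdist x y \<le> rdist y x" for x y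
    unfolding rdist_eq[of y x]
  proof (rule INF_greatest)
    fix \<sigma> assume "\<sigma> \<in> {\<sigma>. curve \<sigma> \<and> pathstart \<sigma> = y \<and> pathfinish \<sigma> = x}"
    then show "rdist x y \<le> len \<sigma>"
      using rdist_le[OF curve_reversepath(1), of \<sigma>] curve_reversepath(2)[of \<sigma>] by auto
  qed
  then show ?thesis by (intro antisym)
qed

lemma rdist_triangle: "rdist x z \<le> rdist x y + rdist y z"
proof (rule ennreal_le_epsilon)
  fix e :: real assume e: "0 < e" and fin: "rdist x y + rdist y z < top"
  have "rdist x y < rdist x y + ennreal (e / 2)" "rdist y z < rdist y z + ennreal (e / 2)"
  proof -
    have "a < a + ennreal (e / 2)" if "a < top" for a :: ennreal
      using that e by (cases a) (auto simp: ennreal_plus[symmetric] ennreal_less_iff simp del: ennreal_plus)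
    then show "rdist x y < rdist x y + ennreal (e / 2)" "rdist y z < rdist y z + ennreal (e / 2)"
      using fin by (auto simp: less_top)
  qed
  then obtain \<sigma>1 \<sigma>2 where 1: "curve \<sigma>1" "pathstart \<sigma>1 = x" "pathfinish \<sigma>1 = y" "len \<sigma>1 < rdist x y + ennreal (e / 2)"
    and 2: "curve \<sigma>2" "pathstart \<sigma>2 = y" "pathfinish \<sigma>2 = z" "len \<sigma>2 < rdist y z + ennreal (e / 2)"
    unfolding rdist_eq[of x y] rdist_eq[of y z] INF_less_iff by blast
  have "rdist x z \<le> len (\<sigma>1 +++ \<sigma>2)"
    using rdist_le[OF curve_joinpaths(1)[OF 1(1) 2(1)]] 1 2 by simp
  also have "\<dots> \<le> len \<sigma>1 + len \<sigma>2" using 1 2 by (intro curve_joinpaths) auto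
  also have "\<dots> \<le> (rdist x y + ennreal (e / 2)) + (rdist y z + ennreal (e / 2))"
    using 1 2 by (intro add_mono) auto
  also have "\<dots> = rdist x y + rdist y z + (ennreal (e / 2) + ennreal (e / 2))" by (simp add: ac_simps)
  also have "ennreal (e / 2) + ennreal (e / 2) = ennreal e" using e by (simp add: ennreal_plus[symmetric])
  finally show "rdist x z \<le> rdist x y + rdist y z + ennreal e" .
qed

end

section \<open>Comparison of the Riemannian distance with the norm in a chart\<close>

context riemannian begin

definition chart_ball :: "'a set \<Rightarrow> ('a \<Rightarrow> real ^ 'n) \<Rightarrow> 'a \<Rightarrow> real \<Rightarrow> 'a set" where
  "chart_ball U \<phi> p R = {x \<in> U. \<phi> x \<in> ball (\<phi> p) R}"

lemma chart_ball_open: "(U, \<phi>) \<in> \<A> \<Longrightarrow> open (chart_ball U \<phi> p R)"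
  unfolding chart_ball_def by (intro chart_preimage_open) auto

lemma chart_ball_center: "p \<in> U \<Longrightarrow> 0 < R \<Longrightarrow> p \<in> chart_ball U \<phi> p R"
  by (simp add: chart_ball_def)

text \<open>
  Projecting the curve to the direction of its increment, in the sense of the inner product \<open>G\<close>,
  reduces the bound to the fundamental theorem of calculus for a real function.
\<close>

lemma len_ge_in_chart:
  assumes \<sigma>: "curve \<sigma>" and c: "(U, \<phi>) \<in> \<A>" and ab: "0 \<le> a" "a \<le> b" "b \<le> 1"
    and U: "\<And>t. a \<le> t \<Longrightarrow> t \<le> b \<Longrightarrow> \<sigma> t \<in> U" and G: "sym_posdef G" and \<kappa>: "0 < \<kappa>"
    and le: "\<And>t v. a \<le> t \<Longrightarrow> t \<le> b \<Longrightarrow> \<kappa> * gnorm G v \<le> gnorm (g (U, \<phi>) (\<sigma> t)) v"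
  shows "ennreal (\<kappa> * gnorm G (\<phi> (\<sigma> b) - \<phi> (\<sigma> a))) \<le> len \<sigma>"
proof -
  define w where "w = \<phi> (\<sigma> b) - \<phi> (\<sigma> a)"
  show ?thesis
  proof (cases "w = 0")
    case True
    then show ?thesis by (simp add: w_def[symmetric] gnorm_zero)
  next
    case False
    define n where "n = gnorm G w"
    have n: "0 < n" using gnorm_pos[OF G False] by (simp add: n_def)
    \<comment> \<open>Scaled so that the component of the velocity along \<open>e\<close> is at most the speed.\<close>
    define e where "e = (\<kappa> / n) *\<^sub>R (G *v w)"
    obtain S D where S: "finite S" and D: "\<And>t. t \<in> {a..b} - S \<Longrightarrow> ((\<phi> \<circ> \<sigma>) has_vector_derivative D t) (at t)"
      and D_cont: "continuous_on ({a..b} - S) D" and cont: "continuous_on {a..b} (\<phi> \<circ> \<sigma>)"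
      using curve_piecewise[OF \<sigma> c ab(1,3) U]
      unfolding piecewise_C1_differentiable_on_def C1_differentiable_on_def by blast
    have "ennreal \<bar>(\<phi> \<circ> \<sigma>) b \<bullet> e - (\<phi> \<circ> \<sigma>) a \<bullet> e\<bar> \<le> (\<integral>\<^sup>+t\<in>{a..b}. ennreal (speed \<sigma> t) \<partial>lborel)"
    proof (rule increment_le_nn_integral[OF ab(2) _ S])
      show "continuous_on {a..b} (\<lambda>t. (\<phi> \<circ> \<sigma>) t \<bullet> e)" by (intro continuous_intros cont)
      show "continuous_on ({a<..<b} - S) (\<lambda>t. D t \<bullet> e)"
        by (intro continuous_intros continuous_on_subset[OF D_cont]) auto
      fix t assume t: "t \<in> {a<..<b} - S"
      have d: "((\<phi> \<circ> \<sigma>) has_vector_derivative D t) (at t)" using t D by auto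
      show "((\<lambda>t. (\<phi> \<circ> \<sigma>) t \<bullet> e) has_vector_derivative D t \<bullet> e) (at t)"
        by (rule bounded_linear.has_vector_derivative[OF bounded_linear_inner_left d])
      have "\<bar>D t \<bullet> e\<bar> = \<kappa> / n * \<bar>D t \<bullet> (G *v w)\<bar>"
        using n \<kappa> by (simp add: e_def abs_mult)
      also have "\<dots> \<le> \<kappa> / n * (gnorm G (D t) * n)"
        using gnorm_Cauchy_Schwarz[OF G, of "D t" w] n \<kappa> by (intro mult_left_mono) (auto simp: n_def)
      also have "\<dots> = \<kappa> * gnorm G (D t)" using n by simp
      also have "\<dots> \<le> gnorm (g (U, \<phi>) (\<sigma> t)) (D t)" using t by (intro le) auto
      also have "\<dots> = speed \<sigma> t"
        using t ab U by (intro speed_in_chart[OF curve_path[OF \<sigma>] _ c _ d, symmetric]) auto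
      finally show "ennreal \<bar>D t \<bullet> e\<bar> \<le> ennreal (speed \<sigma> t)" by (rule ennreal_leI)
    qed
    also have "\<dots> \<le> len \<sigma>"
      unfolding len_eq using ab by (intro nn_integral_mono) (auto simp: indicator_def)
    also have "\<bar>(\<phi> \<circ> \<sigma>) b \<bullet> e - (\<phi> \<circ> \<sigma>) a \<bullet> e\<bar> = \<kappa> * gnorm G w"
    proof -
      have "(\<phi> \<circ> \<sigma>) b \<bullet> e - (\<phi> \<circ> \<sigma>) a \<bullet> e = w \<bullet> e" by (simp add: w_def inner_diff_left)
      also have "\<dots> = \<kappa> / n * n\<^sup>2" by (simp add: e_def n_def gnorm_square[OF G])
      also have "\<dots> = \<kappa> * n" using n by (simp add: power2_eq_square)
      finally show ?thesis using n \<kappa> by (simp add: n_def)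
    qed
    finally show ?thesis by (simp add: w_def)
  qed
qed

text \<open>At the first time outside \<open>W\<close> the curve is still in the closed set \<open>K\<close>, being a limit of points of \<open>W\<close>.\<close>

lemma first_exit:
  assumes \<sigma>: "path \<sigma>" and W: "open W" and K: "closed K" "W \<subseteq> K" and start: "\<sigma> 0 \<in> W"
    and exit: "t0 \<in> {0..1}" "\<sigma> t0 \<notin> W"
  obtains t where "0 \<le> t" "t \<le> 1" "\<sigma> t \<notin> W" "\<And>s. 0 \<le> s \<Longrightarrow> s \<le> t \<Longrightarrow> \<sigma> s \<in> K"
proof -
  have cont: "continuous_on {0..1} \<sigma>" using \<sigma> by (simp add: path_def)
  define E where "E = {0..1} \<inter> \<sigma> -` (- W)"
  have E: "closed E" unfolding E_def using W by (intro continuous_closed_preimage cont) auto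
  have E_ne: "E \<noteq> {}" "bdd_below E" using exit by (auto simp: E_def)
  define t where "t = Inf E"
  have tE: "t \<in> E" unfolding t_def by (rule closed_contains_Inf[OF E_ne E])
  have t: "0 \<le> t" "t \<le> 1" "\<sigma> t \<notin> W" using tE by (auto simp: E_def)
  have before: "\<sigma> s \<in> W" if "0 \<le> s" "s < t" for s
  proof (rule ccontr)
    assume "\<sigma> s \<notin> W"
    then have "s \<in> E" using that t by (auto simp: E_def)
    then show False using cInf_lower[OF _ E_ne(2), of s] that by (simp add: t_def)
  qed
  have "0 < t" using t start by (cases "t = 0") auto
  have "\<sigma> ` closure {0..<t} \<subseteq> K"
  proof (rule image_closure_subset[OF _ K(1)])
    show "continuous_on (closure {0..<t}) \<sigma>" using \<open>0 < t\<close> t by (intro continuous_on_subset[OF cont]) auto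
    show "\<sigma> ` {0..<t} \<subseteq> K" using before K(2) by auto
  qed
  then have "\<sigma> s \<in> K" if "0 \<le> s" "s \<le> t" for s using that \<open>0 < t\<close> by auto
  then show ?thesis using that t by blast
qed

text \<open>A curve that is too short to leave the chart can be measured in the chart.\<close>

lemma short_curve_in_chart:
  assumes \<sigma>: "curve \<sigma>" and c: "(U, \<phi>) \<in> \<A>" and R: "r < R" "cball (\<phi> p) R \<subseteq> \<phi> ` U" and G: "sym_posdef G" and \<kappa>: "0 < \<kappa>"
    and le: "\<And>x v. x \<in> U \<Longrightarrow> \<phi> x \<in> cball (\<phi> p) R \<Longrightarrow> \<kappa> * gnorm G v \<le> gnorm (g (U, \<phi>) x) v"
    and e: "0 < e" "\<And>v. e * norm v \<le> gnorm G v"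
    and start: "pathstart \<sigma> \<in> chart_ball U \<phi> p r" and short: "len \<sigma> < ennreal (\<kappa> * e * (R - r))"
  shows "pathfinish \<sigma> \<in> chart_ball U \<phi> p R"
    and "ennreal (\<kappa> * gnorm G (\<phi> (pathfinish \<sigma>) - \<phi> (pathstart \<sigma>))) \<le> len \<sigma>"
proof -
  let ?W = "chart_ball U \<phi> p R" and ?K = "{x \<in> U. \<phi> x \<in> cball (\<phi> p) R}"
  have K_eq: "?K = inv_into U \<phi> ` cball (\<phi> p) R"
  proof (intro equalityI subsetI)
    fix x assume "x \<in> ?K"
    then show "x \<in> inv_into U \<phi> ` cball (\<phi> p) R" using chart_inv[OF c, of x] by force
  next
    fix x assume "x \<in> inv_into U \<phi> ` cball (\<phi> p) R"
    then obtain y where y: "y \<in> cball (\<phi> p) R" "x = inv_into U \<phi> y" by blast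
    then have "y \<in> \<phi> ` U" using R by blast
    then show "x \<in> ?K" using y by (auto simp: f_inv_into_f inv_into_into)
  qed
  have "compact ?K" unfolding K_eq
    using R(2) by (intro compact_continuous_image continuous_on_subset[OF chart_inv_continuous[OF c]]) auto
  then have K: "closed ?K" "?W \<subseteq> ?K" by (auto intro: compact_imp_closed simp: chart_ball_def)
  have W0: "\<sigma> 0 \<in> ?W" using start R(1) by (auto simp: chart_ball_def pathstart_def)
  have inside: "\<sigma> t \<in> ?W" if t: "t \<in> {0..1}" for t
  proof (rule ccontr)
    assume out: "\<sigma> t \<notin> ?W"
    obtain t where t: "0 \<le> t" "t \<le> 1" "\<sigma> t \<notin> ?W" and in_K: "\<And>s. 0 \<le> s \<Longrightarrow> s \<le> t \<Longrightarrow> \<sigma> s \<in> ?K"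
      by (rule first_exit[OF curve_path[OF \<sigma>] chart_ball_open[OF c] K W0 t out]) blast
    have "ennreal (\<kappa> * gnorm G (\<phi> (\<sigma> t) - \<phi> (\<sigma> 0))) \<le> len \<sigma>"
      by (rule len_ge_in_chart[OF \<sigma> c _ t(1,2) _ G \<kappa>]) (use in_K le in auto)
    moreover have "\<kappa> * e * (R - r) \<le> \<kappa> * gnorm G (\<phi> (\<sigma> t) - \<phi> (\<sigma> 0))"
    proof -
      have "R \<le> dist (\<phi> p) (\<phi> (\<sigma> t))" using t in_K[of t] by (auto simp: chart_ball_def)
      moreover have "dist (\<phi> p) (\<phi> (\<sigma> 0)) < r" using start by (simp add: chart_ball_def pathstart_def)
      ultimately have "R - r \<le> norm (\<phi> (\<sigma> t) - \<phi> (\<sigma> 0))"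
        using dist_triangle[of "\<phi> p" "\<phi> (\<sigma> t)" "\<phi> (\<sigma> 0)"] by (simp add: dist_norm norm_minus_commute)
      then have "e * (R - r) \<le> gnorm G (\<phi> (\<sigma> t) - \<phi> (\<sigma> 0))"
        using e(2)[of "\<phi> (\<sigma> t) - \<phi> (\<sigma> 0)"] mult_left_mono[of _ _ e] e(1) by (smt (verit))
      then show ?thesis using \<kappa> by (simp add: mult.assoc)
    qed
    ultimately show False using short by (meson ennreal_leI leD order_trans)
  qed
  show "pathfinish \<sigma> \<in> ?W" using inside[of 1] by (simp add: pathfinish_def)
  show "ennreal (\<kappa> * gnorm G (\<phi> (pathfinish \<sigma>) - \<phi> (pathstart \<sigma>))) \<le> len \<sigma>"
    unfolding pathfinish_def pathstart_def
    by (rule len_ge_in_chart[OF \<sigma> c _ _ _ _ G \<kappa>]) (use inside K(2) le in \<open>auto simp: chart_ball_def\<close>)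
qed

lemma rdist_ge_in_chart:
  assumes c: "(U, \<phi>) \<in> \<A>" and R: "r < R" "cball (\<phi> p) R \<subseteq> \<phi> ` U" and G: "sym_posdef G" and \<kappa>: "0 < \<kappa>"
    and le: "\<And>x v. x \<in> U \<Longrightarrow> \<phi> x \<in> cball (\<phi> p) R \<Longrightarrow> \<kappa> * gnorm G v \<le> gnorm (g (U, \<phi>) x) v"
    and e: "0 < e" "\<And>v. e * norm v \<le> gnorm G v"
    and y: "y \<in> chart_ball U \<phi> p r" and short: "rdist y z < ennreal (\<kappa> * e * (R - r))"
  shows "z \<in> chart_ball U \<phi> p R" and "ennreal (\<kappa> * gnorm G (\<phi> z - \<phi> y)) \<le> rdist y z"
proof -
  note curve_bound = short_curve_in_chart[OF _ c R G \<kappa> le e]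
  obtain \<sigma>0 where \<sigma>0: "curve \<sigma>0" "pathstart \<sigma>0 = y" "pathfinish \<sigma>0 = z" "len \<sigma>0 < ennreal (\<kappa> * e * (R - r))"
    using short unfolding rdist_eq INF_less_iff by blast
  show "z \<in> chart_ball U \<phi> p R" using curve_bound(1)[of \<sigma>0] \<sigma>0 y by simp
  have 0: "ennreal (\<kappa> * gnorm G (\<phi> z - \<phi> y)) \<le> len \<sigma>0" using curve_bound(2)[of \<sigma>0] \<sigma>0 y by simp
  show "ennreal (\<kappa> * gnorm G (\<phi> z - \<phi> y)) \<le> rdist y z"
    unfolding rdist_eq
  proof (rule INF_greatest)
    fix \<sigma> assume \<sigma>: "\<sigma> \<in> {\<sigma>. curve \<sigma> \<and> pathstart \<sigma> = y \<and> pathfinish \<sigma> = z}"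
    show "ennreal (\<kappa> * gnorm G (\<phi> z - \<phi> y)) \<le> len \<sigma>"
    proof (cases "len \<sigma> < ennreal (\<kappa> * e * (R - r))")
      case True
      then show ?thesis using curve_bound(2)[of \<sigma>] \<sigma> y by simp
    next
      case False
      then show ?thesis using 0 \<sigma>0(4) by (meson leI order.strict_trans2 order_trans less_imp_le)
    qed
  qed
qed

text \<open>For the upper bound it suffices to measure the curve that is a segment in the chart.\<close>

lemma rdist_le_in_chart:
  assumes c: "(U, \<phi>) \<in> \<A>" and R: "cball (\<phi> p) R \<subseteq> \<phi> ` U" and \<Lambda>: "0 \<le> \<Lambda>"
    and le: "\<And>x v. x \<in> U \<Longrightarrow> \<phi> x \<in> cball (\<phi> p) R \<Longrightarrow> gnorm (g (U, \<phi>) x) v \<le> \<Lambda> * gnorm G v"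
    and yz: "y \<in> chart_ball U \<phi> p R" "z \<in> chart_ball U \<phi> p R"
  shows "rdist y z \<le> ennreal (\<Lambda> * gnorm G (\<phi> z - \<phi> y))"
proof -
  define w where "w = \<phi> z - \<phi> y"
  define q where "q t = \<phi> y + t *\<^sub>R w" for t
  define \<sigma> where "\<sigma> t = inv_into U \<phi> (q t)" for t
  have q_ball: "q t \<in> ball (\<phi> p) R" if "t \<in> {0..1}" for t
  proof -
    have "q t = (1 - t) *\<^sub>R \<phi> y + t *\<^sub>R \<phi> z" by (simp add: q_def w_def algebra_simps)
    moreover have "(1 - t) *\<^sub>R \<phi> y + t *\<^sub>R \<phi> z \<in> ball (\<phi> p) R"
      by (rule convexD[OF convex_ball]) (use yz that in \<open>auto simp: chart_ball_def\<close>)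
    ultimately show ?thesis by simp
  qed
  have q_image: "q t \<in> \<phi> ` U" if "t \<in> {0..1}" for t using q_ball[OF that] R ball_subset_cball by blast
  have q_cont: "continuous_on A q" for A unfolding q_def by (intro continuous_intros)
  have q_der: "(q has_vector_derivative w) (at t)" for t
    unfolding q_def by (auto intro!: derivative_eq_intros)
  have \<sigma>_in: "\<sigma> t \<in> U" "\<phi> (\<sigma> t) = q t" if "t \<in> {0..1}" for t
    using q_image[OF that] by (auto simp: \<sigma>_def inv_into_into f_inv_into_f)
  have path: "path \<sigma>" unfolding path_def \<sigma>_def
    by (rule continuous_on_compose2[OF chart_inv_continuous[OF c] q_cont]) (use q_image in auto)
  have "(\<psi> \<circ> \<sigma>) piecewise_C1_differentiable_on {a..b}"
    if c': "(V, \<psi>) \<in> \<A>" and ab: "{a..b} \<subseteq> {0..1}" "\<sigma> ` {a..b} \<subseteq> V" for V \<psi> a b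
  proof -
    let ?F = "\<psi> \<circ> inv_into U \<phi>"
    note F = smooth_onD[OF transition_smooth[OF c c']]
    have q_UV: "q t \<in> \<phi> ` (U \<inter> V)" if "t \<in> {a..b}" for t
    proof -
      have "t \<in> {0..1}" "\<sigma> t \<in> V" using that ab by auto
      then show ?thesis using \<sigma>_in[of t] by (metis IntI image_eqI)
    qed
    have comp: "\<psi> \<circ> \<sigma> = ?F \<circ> q" by (auto simp: \<sigma>_def)
    have "((?F \<circ> q) has_vector_derivative frechet_derivative ?F (at (q t)) w) (at t)" if "t \<in> {a..b}" for t
    proof -
      have d: "(?F has_derivative frechet_derivative ?F (at (q t))) (at (q t))"
        using F(1)[OF q_UV[OF that]] by (simp add: frechet_derivative_works)
      then have lin: "linear (frechet_derivative ?F (at (q t)))" by (rule has_derivative_linear)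
      have "(?F \<circ> q has_derivative frechet_derivative ?F (at (q t)) \<circ> (\<lambda>h. h *\<^sub>R w)) (at t)"
        by (rule diff_chain_at[OF q_der[unfolded has_vector_derivative_def] d])
      moreover have "frechet_derivative ?F (at (q t)) \<circ> (\<lambda>h. h *\<^sub>R w) = (\<lambda>h. h *\<^sub>R frechet_derivative ?F (at (q t)) w)"
        by (rule ext) (simp add: linear_cmul[OF lin])
      ultimately show ?thesis unfolding has_vector_derivative_def by simp
    qed
    moreover have "continuous_on {a..b} (\<lambda>t. frechet_derivative ?F (at (q t)) w)"
      by (rule continuous_on_compose2[OF F(2) q_cont]) (use q_UV in auto)
    moreover have "continuous_on {a..b} (?F \<circ> q)"
      unfolding comp_def[of ?F q] by (rule continuous_on_compose2[OF F(3) q_cont]) (use q_UV in auto)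
    ultimately show ?thesis
      unfolding comp piecewise_C1_differentiable_on_def C1_differentiable_on_def
      by (intro conjI exI[of _ "{}"] exI[of _ "\<lambda>t. frechet_derivative ?F (at (q t)) w"]) auto
  qed
  then have curve: "curve \<sigma>" using path unfolding curve_def piecewise_C1_curve_def by blast
  have speed: "speed \<sigma> t \<le> \<Lambda> * gnorm G w" if t: "t \<in> {0<..<1}" for t
  proof -
    have t': "t \<in> {0..1}" using t by auto
    have "((\<phi> \<circ> \<sigma>) has_vector_derivative w) (at t)"
      by (rule has_vector_derivative_transform_within_open[OF q_der, of "{0<..<1}"]) (use t \<sigma>_in(2) in auto)
    then have "speed \<sigma> t = gnorm (g (U, \<phi>) (\<sigma> t)) w"
      by (intro speed_in_chart[OF path t c \<sigma>_in(1)[OF t']])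
    also have "\<dots> \<le> \<Lambda> * gnorm G w"
      using q_ball[OF t'] \<sigma>_in[OF t'] by (intro le) auto
    finally show ?thesis .
  qed
  have "pathstart \<sigma> = y" "pathfinish \<sigma> = z"
    using yz chart_inv[OF c] by (auto simp: pathstart_def pathfinish_def \<sigma>_def q_def w_def chart_ball_def)
  then have "rdist y z \<le> len \<sigma>" using rdist_le[OF curve] by simp
  also have "\<dots> \<le> (\<integral>\<^sup>+t\<in>{0..1::real}. ennreal (\<Lambda> * gnorm G w) \<partial>lborel)"
    unfolding len_eq
  proof (rule nn_integral_mono_AE)
    have "AE t in lborel. t \<notin> {0, 1::real}" by (intro AE_not_in finite_imp_null_set_lborel) auto
    then show "AE t in lborel. ennreal (speed \<sigma> t) * indicator {0..1} t \<le> ennreal (\<Lambda> * gnorm G w) * indicator {0..1} t"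
      by eventually_elim (auto simp: indicator_def intro!: ennreal_leI speed)
  qed
  also have "\<dots> = ennreal (\<Lambda> * gnorm G w)" by (simp add: nn_integral_cmult_indicator)
  finally show ?thesis by (simp add: w_def)
qed

text \<open>Continuity of the metric, in the form of a comparison of norms.\<close>

lemma chart_metric_nearly_constant:
  assumes c: "(U, \<phi>) \<in> \<A>" and p: "p \<in> U" and \<epsilon>: "0 < \<epsilon>" "\<epsilon> < 1" and R0: "0 < R0"
  obtains R where "0 < R" "R < R0" "cball (\<phi> p) R \<subseteq> \<phi> ` U"
    "\<And>x v. x \<in> U \<Longrightarrow> \<phi> x \<in> cball (\<phi> p) R \<Longrightarrow> (1 - \<epsilon>) * gnorm (g (U, \<phi>) p) v \<le> gnorm (g (U, \<phi>) x) v"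
    "\<And>x v. x \<in> U \<Longrightarrow> \<phi> x \<in> cball (\<phi> p) R \<Longrightarrow> gnorm (g (U, \<phi>) x) v \<le> (1 + \<epsilon>) * gnorm (g (U, \<phi>) p) v"
proof -
  let ?G = "g (U, \<phi>) p"
  have G: "sym_posdef ?G" by (rule metric_sym_posdef[OF c p])
  obtain e where e: "0 < e" "\<And>v. e * norm v \<le> gnorm ?G v" by (rule gnorm_equiv_norm[OF G]) blast
  define N where "N = real CARD('n) * real CARD('n)"
  have N: "0 < N" by (simp add: N_def)
  define \<eta> where "\<eta> = \<epsilon> * e\<^sup>2 / N"
  have \<eta>: "0 < \<eta>" using \<epsilon> e N by (simp add: \<eta>_def)
  have pim: "\<phi> p \<in> \<phi> ` U" using p by auto
  obtain R1 where R1: "0 < R1" "ball (\<phi> p) R1 \<subseteq> \<phi> ` U" using chart_open_image[OF c] pim openE by blast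
  have "isCont (\<lambda>y. g (U, \<phi>) (inv_into U \<phi> y)) (\<phi> p)"
    using metric_continuous[OF c] chart_open_image[OF c] pim continuous_on_eq_continuous_at by blast
  then obtain R2 where R2: "0 < R2" "\<And>y. dist y (\<phi> p) < R2 \<Longrightarrow> dist (g (U, \<phi>) (inv_into U \<phi> y)) ?G < \<eta>"
    using \<eta> chart_inv[OF c p] unfolding continuous_at_eps_delta by metis
  define R where "R = min (min R1 R2) R0 / 2"
  have R: "0 < R" "R < R0" "R < R1" "R < R2" using R1 R2 R0 by (auto simp: R_def)
  have close: "onorm ((*v) (g (U, \<phi>) x - ?G)) \<le> \<epsilon> * e\<^sup>2" if x: "x \<in> U" "\<phi> x \<in> cball (\<phi> p) R" for x
  proof -
    have "dist (\<phi> x) (\<phi> p) < R2" using x R by (simp add: dist_commute)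
    then have "norm (g (U, \<phi>) x - ?G) < \<eta>" using R2(2)[of "\<phi> x"] chart_inv[OF c x(1)] by (simp add: dist_norm)
    then have "\<bar>(g (U, \<phi>) x - ?G) $ i $ j\<bar> \<le> \<eta>" for i j
      using component_le_norm_cart[of "(g (U, \<phi>) x - ?G) $ i" j] Finite_Cartesian_Product.norm_nth_le[of "g (U, \<phi>) x - ?G" i]
      by linarith
    then have "onorm ((*v) (g (U, \<phi>) x - ?G)) \<le> N * \<eta>"
      unfolding N_def by (rule onorm_le_matrix_component)
    then show ?thesis using N by (simp add: \<eta>_def)
  qed
  show ?thesis
  proof (rule that[OF R(1,2)])
    show "cball (\<phi> p) R \<subseteq> \<phi> ` U" using R1(2) R by (auto simp: subset_iff)
  qed (use gnorm_perturb[OF G metric_sym_posdef[OF c] \<epsilon> e close] in auto)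
qed

text \<open>
  Near \<open>p\<close> the distance is the norm given by \<open>g(p)\<close> up to a factor arbitrarily close to 1. The
  lower bound includes that points at small distance from \<open>y\<close> lie in the chart.
\<close>

lemma rdist_local:
  assumes c: "(U, \<phi>) \<in> \<A>" and p: "p \<in> U" and \<epsilon>: "0 < \<epsilon>" "\<epsilon> < 1" and R0: "0 < R0"
  obtains R \<delta> where "0 < R" "R < R0" "0 < \<delta>" "cball (\<phi> p) R \<subseteq> \<phi> ` U"
    "\<And>y z. y \<in> chart_ball U \<phi> p R \<Longrightarrow> z \<in> chart_ball U \<phi> p R \<Longrightarrow> rdist y z \<le> ennreal ((1 + \<epsilon>) * gnorm (g (U, \<phi>) p) (\<phi> z - \<phi> y))"
    "\<And>y z. y \<in> chart_ball U \<phi> p (R / 2) \<Longrightarrow> rdist y z < ennreal \<delta> \<Longrightarrow>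
       z \<in> chart_ball U \<phi> p R \<and> ennreal ((1 - \<epsilon>) * gnorm (g (U, \<phi>) p) (\<phi> z - \<phi> y)) \<le> rdist y z"
proof -
  let ?G = "g (U, \<phi>) p"
  have G: "sym_posdef ?G" by (rule metric_sym_posdef[OF c p])
  obtain e where e: "0 < e" "\<And>v. e * norm v \<le> gnorm ?G v" by (rule gnorm_equiv_norm[OF G]) blast
  obtain R where R: "0 < R" "cball (\<phi> p) R \<subseteq> \<phi> ` U" "R < R0" and
    ge: "\<And>x v. x \<in> U \<Longrightarrow> \<phi> x \<in> cball (\<phi> p) R \<Longrightarrow> (1 - \<epsilon>) * gnorm ?G v \<le> gnorm (g (U, \<phi>) x) v" and
    le: "\<And>x v. x \<in> U \<Longrightarrow> \<phi> x \<in> cball (\<phi> p) R \<Longrightarrow> gnorm (g (U, \<phi>) x) v \<le> (1 + \<epsilon>) * gnorm ?G v"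
    using chart_metric_nearly_constant[OF c p \<epsilon> R0] by metis
  \<comment> \<open>A curve from the ball of radius \<open>R / 2\<close> needs at least this length to leave the ball of radius \<open>R\<close>.\<close>
  define \<delta> where "\<delta> = (1 - \<epsilon>) * e * (R - R / 2)"
  have \<delta>: "0 < \<delta>" using R e \<epsilon> by (simp add: \<delta>_def)
  have R2: "R / 2 < R" and \<epsilon>': "0 < 1 - \<epsilon>" "0 \<le> 1 + \<epsilon>" using R \<epsilon> by auto
  show ?thesis
  proof (rule that[OF R(1,3) \<delta> R(2)])
    show "rdist y z \<le> ennreal ((1 + \<epsilon>) * gnorm ?G (\<phi> z - \<phi> y))" if "y \<in> chart_ball U \<phi> p R" "z \<in> chart_ball U \<phi> p R" for y z
      by (rule rdist_le_in_chart[OF c R(2) \<epsilon>'(2) le that])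
    show "z \<in> chart_ball U \<phi> p R \<and> ennreal ((1 - \<epsilon>) * gnorm ?G (\<phi> z - \<phi> y)) \<le> rdist y z"
      if "y \<in> chart_ball U \<phi> p (R / 2)" "rdist y z < ennreal \<delta>" for y z
      using rdist_ge_in_chart[OF c R2 R(2) G \<epsilon>'(1) ge e that(1)] that(2) unfolding \<delta>_def by blast
  qed
qed

lemma rdist_refl: "rdist p p = 0"
proof -
  obtain U \<phi> where c: "(U, \<phi>) \<in> \<A>" and p: "p \<in> U" by (rule chart_cover)
  have half: "0 < (1/2::real)" "(1/2::real) < 1" by auto
  obtain R \<delta> where R: "0 < R" and
    le: "\<And>y z. y \<in> chart_ball U \<phi> p R \<Longrightarrow> z \<in> chart_ball U \<phi> p R \<Longrightarrow> rdist y z \<le> ennreal ((1 + 1/2) * gnorm (g (U, \<phi>) p) (\<phi> z - \<phi> y))"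
    using rdist_local[OF c p half zero_less_one] by metis
  show ?thesis using le[of p p] chart_ball_center[OF p R] by (simp add: gnorm_zero)
qed

lemma rdist_small:
  assumes e: "0 < e"
  obtains W where "open W" "p \<in> W" "\<And>q. q \<in> W \<Longrightarrow> rdist p q < ennreal e"
proof -
  obtain U \<phi> where c: "(U, \<phi>) \<in> \<A>" and p: "p \<in> U" by (rule chart_cover)
  have half: "0 < (1/2::real)" "(1/2::real) < 1" by auto
  let ?G = "g (U, \<phi>) p"
  obtain R \<delta> where R: "0 < R" and
    le: "\<And>y z. y \<in> chart_ball U \<phi> p R \<Longrightarrow> z \<in> chart_ball U \<phi> p R \<Longrightarrow> rdist y z \<le> ennreal ((1 + 1/2) * gnorm ?G (\<phi> z - \<phi> y))"
    using rdist_local[OF c p half zero_less_one] by metis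
  obtain C where C: "0 < C" "\<And>v. gnorm ?G v \<le> C * norm v" by (rule gnorm_equiv_norm[OF metric_sym_posdef[OF c p]]) blast
  define r where "r = min R (e / (2 * C))"
  have r: "0 < r" "r \<le> R" "2 * (C * r) \<le> e" using R C e by (auto simp: r_def min_def field_simps)
  show ?thesis
  proof (rule that[OF chart_ball_open[OF c] chart_ball_center[OF p r(1)]])
    fix q assume q: "q \<in> chart_ball U \<phi> p r"
    have "rdist p q \<le> ennreal ((1 + 1/2) * gnorm ?G (\<phi> q - \<phi> p))"
      using q r chart_ball_center[OF p R] by (intro le) (auto simp: chart_ball_def)
    also have "\<dots> < ennreal e"
    proof -
      have "norm (\<phi> q - \<phi> p) < r" using q by (simp add: chart_ball_def dist_norm norm_minus_commute)
      then have "C * norm (\<phi> q - \<phi> p) < C * r" using C by simp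
      then have "gnorm ?G (\<phi> q - \<phi> p) < e / 2" using C(2)[of "\<phi> q - \<phi> p"] r(3) by linarith
      then have "(1 + 1/2) * gnorm ?G (\<phi> q - \<phi> p) < e" using e by (simp add: field_simps)
      then show ?thesis using e by (intro ennreal_lessI)
    qed
    finally show "rdist p q < ennreal e" .
  qed
qed

end

section \<open>The Riemannian distance as a bounded pseudo-metric\<close>

context riemannian begin

lemma rdist_ball_open: "open {z. rdist y z < r}"
proof (rule Topological_Spaces.openI)
  fix z assume "z \<in> {z. rdist y z < r}"
  then obtain b where b: "rdist y z < b" "b < r" using dense[of "rdist y z" r] by auto
  then obtain a' b' where ab: "rdist y z = ennreal a'" "0 \<le> a'" "b = ennreal b'" "0 \<le> b'"
    by (cases "rdist y z"; cases b) auto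
  have e: "0 < b' - a'" using b(1) ab by (simp add: ennreal_less_iff)
  obtain W where W: "open W" "z \<in> W" "\<And>q. q \<in> W \<Longrightarrow> rdist z q < ennreal (b' - a')"
    using rdist_small[OF e, of z] by metis
  have "W \<subseteq> {z. rdist y z < r}"
  proof
    fix q assume "q \<in> W"
    have "rdist y q \<le> rdist y z + rdist z q" by (rule rdist_triangle)
    also have "\<dots> \<le> ennreal a' + ennreal (b' - a')" using W(3)[OF \<open>q \<in> W\<close>] ab by (intro add_mono) auto
    also have "\<dots> = b" using ab e by (simp add: ennreal_plus[symmetric] del: ennreal_plus)
    finally show "q \<in> {z. rdist y z < r}" using b by simp
  qed
  then show "\<exists>T. open T \<and> z \<in> T \<and> T \<subseteq> {z. rdist y z < r}" using W by blast
qed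

text \<open>
  Truncation makes the distance real-valued also between different components, without changing
  small balls. A map that is Lipschitz at small distances is then Lipschitz.
\<close>

definition bdist :: "'a \<Rightarrow> 'a \<Rightarrow> real" where
  "bdist x y = enn2real (min 1 (rdist x y))"

lemma ennreal_bdist: "ennreal (bdist x y) = min 1 (rdist x y)"
  unfolding bdist_def by (rule ennreal_enn2real) (auto simp: min_def intro: le_less_trans[of _ 1] ennreal_one_less_top)

lemma bdist_nonneg: "0 \<le> bdist x y"
  by (simp add: bdist_def)

lemma bdist_le_1: "bdist x y \<le> 1"
  using ennreal_bdist[of x y] by (metis ennreal_le_1 min.cobounded1)

lemma bdist_refl: "bdist x x = 0"
  by (simp add: bdist_def rdist_refl)

lemma bdist_sym: "bdist x y = bdist y x"
  by (simp add: bdist_def rdist_sym)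

lemma bdist_le_rdist: "ennreal (bdist x y) \<le> rdist x y"
  by (simp add: ennreal_bdist)

lemma bdist_triangle: "bdist x z \<le> bdist x y + bdist y z"
proof -
  have "min 1 (rdist x z) \<le> min 1 (rdist x y) + min 1 (rdist y z)"
  proof (cases "rdist x y \<le> 1 \<and> rdist y z \<le> 1")
    case True
    then show ?thesis using rdist_triangle[of x z y] by (simp add: min.absorb2 min.coboundedI2)
  next
    case False
    then have "1 \<le> min 1 (rdist x y) + min 1 (rdist y z)"
      by (auto simp: min_def intro: add_increasing add_increasing2)
    then show ?thesis by (rule min.coboundedI1)
  qed
  then have "ennreal (bdist x z) \<le> ennreal (bdist x y + bdist y z)"
    by (simp add: ennreal_bdist bdist_nonneg)
  then show ?thesis using bdist_nonneg by (subst (asm) ennreal_le_iff) (auto intro: add_nonneg_nonneg)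
qed

lemma bdist_less_iff:
  assumes "\<rho> \<le> 1"
  shows "bdist x y < \<rho> \<longleftrightarrow> rdist x y < ennreal \<rho>"
proof (cases "0 < \<rho>")
  case True
  have "bdist x y < \<rho> \<longleftrightarrow> ennreal (bdist x y) < ennreal \<rho>" using True bdist_nonneg by (simp add: ennreal_less_iff)
  also have "\<dots> \<longleftrightarrow> rdist x y < ennreal \<rho>"
    unfolding ennreal_bdist using assms by (auto simp: min_less_iff_disj dest: leD)
  finally show ?thesis .
next
  case False
  then show ?thesis using bdist_nonneg[of x y] by (simp add: ennreal_neg)
qed

lemma bdist_le_iff:
  assumes "0 \<le> \<rho>" "\<rho> < 1"
  shows "bdist x y \<le> \<rho> \<longleftrightarrow> rdist x y \<le> ennreal \<rho>"
proof -
  have "bdist x y \<le> \<rho> \<longleftrightarrow> ennreal (bdist x y) \<le> ennreal \<rho>" using assms by simp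
  also have "\<dots> \<longleftrightarrow> rdist x y \<le> ennreal \<rho>"
    unfolding ennreal_bdist using assms by (auto simp: min_le_iff_disj dest: leD)
  finally show ?thesis .
qed

lemma bdist_measurable: "case_prod bdist \<in> borel_measurable (borel \<Otimes>\<^sub>M borel)"
proof -
  have "open {z. case_prod bdist z < r}" for r
  proof (rule Topological_Spaces.openI)
    fix z assume "z \<in> {z. case_prod bdist z < r}"
    then obtain x y where z: "z = (x, y)" "bdist x y < r" by (cases z) auto
    have e: "0 < (r - bdist x y) / 2" using z by simp
    obtain W1 where W1: "open W1" "x \<in> W1" "\<And>q. q \<in> W1 \<Longrightarrow> rdist x q < ennreal ((r - bdist x y) / 2)"
      using rdist_small[OF e, of x] by metis
    obtain W2 where W2: "open W2" "y \<in> W2" "\<And>q. q \<in> W2 \<Longrightarrow> rdist y q < ennreal ((r - bdist x y) / 2)"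
      using rdist_small[OF e, of y] by metis
    have small: "bdist u v < t" if "rdist u v < ennreal t" for u v t
    proof -
      have "ennreal (bdist u v) < ennreal t" using that bdist_le_rdist[of u v] by (rule le_less_trans[rotated])
      then show ?thesis using bdist_nonneg ennreal_less_iff by blast
    qed
    have "W1 \<times> W2 \<subseteq> {z. case_prod bdist z < r}"
    proof
      fix q assume "q \<in> W1 \<times> W2"
      then obtain u v where q: "q = (u, v)" "u \<in> W1" "v \<in> W2" by auto
      have "bdist u v \<le> bdist x u + bdist x y + bdist y v"
        using bdist_triangle[of u v x] bdist_triangle[of x v y] bdist_sym[of u x] by linarith
      also have "\<dots> < r" using small[OF W1(3)[OF q(2)]] small[OF W2(3)[OF q(3)]] by (simp add: field_simps)
      finally show "q \<in> {z. case_prod bdist z < r}" using q by simp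
    qed
    then show "\<exists>T. open T \<and> z \<in> T \<and> T \<subseteq> {z. case_prod bdist z < r}"
      using open_Times[OF W1(1) W2(1)] z W1 W2 by blast
  qed
  then have "case_prod bdist \<in> borel_measurable borel"
    by (intro borel_measurableI_less) (auto intro: borel_open)
  then show ?thesis by (simp only: borel_prod)
qed

section \<open>Measure of small balls\<close>

lemma smooth_fun_continuous:
  assumes h: "smooth_fun \<A> h" and c: "(U, \<phi>) \<in> \<A>"
  shows "continuous_on (\<phi> ` U) (\<lambda>y. h (inv_into U \<phi> y))" "continuous_on U h"
proof -
  have "smooth_on (\<phi> ` U) (h \<circ> inv_into U \<phi>)" using h c unfolding smooth_fun_def by auto
  then show 1: "continuous_on (\<phi> ` U) (\<lambda>y. h (inv_into U \<phi> y))" using smooth_onD(3) by (fastforce simp: comp_def)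
  have "continuous_on U (\<lambda>x. h (inv_into U \<phi> (\<phi> x)))"
    by (rule continuous_on_compose2[OF 1 chart_continuous[OF c]]) auto
  then show "continuous_on U h" by (rule continuous_on_eq) (simp add: chart_inv[OF c])
qed

lemma smooth_fun_measurable: "smooth_fun \<A> h \<Longrightarrow> h \<in> borel_measurable borel"
proof -
  assume h: "smooth_fun \<A> h"
  have "isCont h x" for x
  proof -
    obtain U \<phi> where c: "(U, \<phi>) \<in> \<A>" "x \<in> U" by (rule chart_cover)
    then show ?thesis using smooth_fun_continuous(2)[OF h c(1)] chart_open[OF c(1)]
      by (simp add: continuous_on_eq_continuous_at)
  qed
  then show ?thesis by (intro borel_measurable_continuous_onI) (simp add: continuous_at_imp_continuous_on)
qed

lemma emeasure_ellipsoid: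
  fixes G :: "real ^ 'n ^ 'n"
  assumes G: "sym_posdef G" and t: "0 < t"
  shows "{v. gnorm G (v - a) < t} \<in> sets borel"
    "emeasure lborel {v. gnorm G (v - a) < t} = ennreal (t ^ CARD('n) * measure lborel {v. gnorm G v < 1})"
proof -
  have op: "open {v. gnorm G (v - a) < t}" for a t
    by (intro open_Collect_less continuous_on_compose2[OF gnorm_continuous] continuous_intros) auto
  then show sets: "{v. gnorm G (v - a) < t} \<in> sets borel" by (rule borel_open)
  have op0: "open {v. gnorm G v < 1}" using op[of 0 1] by simp
  have "bounded {v. gnorm G v < 1}"
  proof -
    obtain e where e: "0 < e" "\<And>v. e * norm v \<le> gnorm G v" by (rule gnorm_equiv_norm[OF G]) blast
    have "norm v \<le> 1 / e" if "gnorm G v < 1" for v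
      using e(2)[of v] e(1) that by (simp add: field_simps)
    then show ?thesis unfolding bounded_iff by blast
  qed
  then have fin: "emeasure lborel {v. gnorm G v < 1} < \<infinity>" by (rule emeasure_bounded_finite)
  have image: "{v. gnorm G (v - a) < t} = (\<lambda>v. t *\<^sub>R v + a) ` {v. gnorm G v < 1}"
  proof (intro equalityI subsetI)
    fix v assume "v \<in> {v. gnorm G (v - a) < t}"
    then have "gnorm G ((1 / t) *\<^sub>R (v - a)) < 1" using t by (simp add: gnorm_scaleR)
    moreover have "v = t *\<^sub>R ((1 / t) *\<^sub>R (v - a)) + a" using t by simp
    ultimately show "v \<in> (\<lambda>v. t *\<^sub>R v + a) ` {v. gnorm G v < 1}" by blast
  next
    fix v assume "v \<in> (\<lambda>v. t *\<^sub>R v + a) ` {v. gnorm G v < 1}"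
    then show "v \<in> {v. gnorm G (v - a) < t}" using t by (auto simp: gnorm_scaleR)
  qed
  have "emeasure lborel {v. gnorm G (v - a) < t} = emeasure lebesgue ((\<lambda>v. t *\<^sub>R v + a) ` {v. gnorm G v < 1})"
    using sets unfolding image by simp
  also have "\<dots> = ennreal (\<bar>t\<bar> ^ DIM(real ^ 'n)) * emeasure lebesgue {v. gnorm G v < 1}"
    by (rule emeasure_lebesgue_affine)
  also have "emeasure lebesgue {v. gnorm G v < 1} = emeasure lborel {v. gnorm G v < 1}"
    using op0 by simp
  also have "\<dots> = ennreal (measure lborel {v. gnorm G v < 1})"
    using fin by (intro emeasure_eq_ennreal_measure) auto
  finally show "emeasure lborel {v. gnorm G (v - a) < t} = ennreal (t ^ CARD('n) * measure lborel {v. gnorm G v < 1})"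
    using t by (simp add: ennreal_mult)
qed

lemma continuous_on_det:
  fixes A :: "'b::topological_space \<Rightarrow> real ^ 'm ^ 'm"
  assumes "continuous_on S A"
  shows "continuous_on S (\<lambda>x. det (A x))"
  unfolding det_def by (intro continuous_intros assms)

text \<open>
  In a small chart the ball is squeezed between two ellipsoids, and the density is nearly constant. The
  centre varies near \<open>p\<close> so that the upper bound can be made uniform by compactness.
\<close>

lemma ball_measure:
  assumes vol: "riemannian_volume \<A> g vol" and h: "smooth_fun \<A> h" "\<And>x. 0 < h x"
    and \<mu>: "\<mu> = density vol (\<lambda>x. ennreal (h x))" and prob: "prob_space \<mu>"
  obtains k where "0 \<le> k"
    "\<And>e. 0 < e \<Longrightarrow> \<exists>W \<delta>. open W \<and> p \<in> W \<and> 0 < \<delta> \<and> (\<forall>y\<in>W. \<forall>\<rho>. 0 < \<rho> \<and> \<rho> < \<delta> \<longrightarrow>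
        (k - e) * \<rho> ^ CARD('n) \<le> measure \<mu> {z. rdist y z < ennreal \<rho>} \<and>
        measure \<mu> {z. rdist y z < ennreal \<rho>} \<le> (k + e) * \<rho> ^ CARD('n))"
proof -
  interpret prob_space \<mu> by (rule prob)
  obtain U \<phi> where c: "(U, \<phi>) \<in> \<A>" and p: "p \<in> U" by (rule chart_cover)
  let ?G = "g (U, \<phi>) p" and ?d = "CARD('n)"
  have G: "sym_posdef ?G" by (rule metric_sym_posdef[OF c p])
  obtain e0 where e0: "0 < e0" "\<And>v. e0 * norm v \<le> gnorm ?G v" by (rule gnorm_equiv_norm[OF G]) blast
  define E where "E = measure lborel {v. gnorm ?G v < 1}"
  \<comment> \<open>The maximum with 0 makes the density nonnegative outright; \<open>ennreal\<close> ignores negative values anyway.\<close>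
  define s where "s y = max 0 (sqrt (det (g (U, \<phi>) (inv_into U \<phi> y))))" for y
  define k where "k = h p * s (\<phi> p) * E"
  have E0: "0 \<le> E" and s0: "0 \<le> s y" for y by (auto simp: E_def s_def)
  have sets_vol: "sets vol = sets borel" and
    vol_eq: "\<And>B. B \<in> sets borel \<Longrightarrow> B \<subseteq> U \<Longrightarrow> emeasure vol B = (\<integral>\<^sup>+y\<in>\<phi> ` B. ennreal (s y) \<partial>lborel)"
    using vol c unfolding riemannian_volume_def s_def by (fastforce simp: ennreal_max_0)+
  have h_meas: "h \<in> borel_measurable vol"
    using smooth_fun_measurable[OF h(1)] measurable_cong_sets[OF sets_vol refl] by blast
  have main: "\<exists>W \<delta>. open W \<and> p \<in> W \<and> 0 < \<delta> \<and> (\<forall>y\<in>W. \<forall>\<rho>. 0 < \<rho> \<and> \<rho> < \<delta> \<longrightarrow>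
        max 0 (h p - \<epsilon>) * max 0 (s (\<phi> p) - \<epsilon>) * E / (1 + \<epsilon>) ^ ?d * \<rho> ^ ?d \<le> measure \<mu> {z. rdist y z < ennreal \<rho>} \<and>
        measure \<mu> {z. rdist y z < ennreal \<rho>} \<le> (h p + \<epsilon>) * (s (\<phi> p) + \<epsilon>) * E / (1 - \<epsilon>) ^ ?d * \<rho> ^ ?d)"
    if \<epsilon>: "0 < \<epsilon>" "\<epsilon> < 1" for \<epsilon>
  proof -
    have pim: "\<phi> p \<in> \<phi> ` U" using p by auto
    have "continuous_on (\<phi> ` U) s" unfolding s_def
      by (intro continuous_intros continuous_on_det metric_continuous[OF c])
    then have "isCont s (\<phi> p)" "isCont (\<lambda>y. h (inv_into U \<phi> y)) (\<phi> p)"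
      using smooth_fun_continuous(1)[OF h(1) c] chart_open_image[OF c] pim continuous_on_eq_continuous_at by blast+
    then obtain R1 R2 where R12: "0 < R1" "\<And>y. dist y (\<phi> p) < R1 \<Longrightarrow> dist (s y) (s (\<phi> p)) < \<epsilon>"
      "0 < R2" "\<And>y. dist y (\<phi> p) < R2 \<Longrightarrow> dist (h (inv_into U \<phi> y)) (h p) < \<epsilon>"
      using \<epsilon> chart_inv[OF c p] unfolding continuous_at_eps_delta by metis
    have "0 < min R1 R2" using R12 by simp
    from rdist_local[OF c p \<epsilon> this]
    obtain R \<delta>0 where R: "0 < R" "R < min R1 R2" "cball (\<phi> p) R \<subseteq> \<phi> ` U" and \<delta>0: "0 < \<delta>0"
      and upper: "\<And>y z. y \<in> chart_ball U \<phi> p R \<Longrightarrow> z \<in> chart_ball U \<phi> p R \<Longrightarrow> rdist y z \<le> ennreal ((1 + \<epsilon>) * gnorm ?G (\<phi> z - \<phi> y))"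
      and lower: "\<And>y z. y \<in> chart_ball U \<phi> p (R / 2) \<Longrightarrow> rdist y z < ennreal \<delta>0 \<Longrightarrow>
       z \<in> chart_ball U \<phi> p R \<and> ennreal ((1 - \<epsilon>) * gnorm ?G (\<phi> z - \<phi> y)) \<le> rdist y z"
      by metis
    \<comment> \<open>The second bound keeps the inner ellipsoid inside the ball of radius \<open>R\<close>.\<close>
    define \<delta> where "\<delta> = min \<delta>0 (e0 * R / 2)"
    have \<delta>: "0 < \<delta>" "\<delta> \<le> \<delta>0" "\<delta> \<le> e0 * R / 2" using \<delta>0 e0 R by (auto simp: \<delta>_def)
    have near: "dist (s y) (s (\<phi> p)) < \<epsilon>" "dist (h (inv_into U \<phi> y)) (h p) < \<epsilon>" if "y \<in> ball (\<phi> p) R" for y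
      using that R R12 by (auto simp: dist_commute)
    have "max 0 (h p - \<epsilon>) * max 0 (s (\<phi> p) - \<epsilon>) * E / (1 + \<epsilon>) ^ ?d * \<rho> ^ ?d \<le> measure \<mu> {z. rdist y z < ennreal \<rho>} \<and>
        measure \<mu> {z. rdist y z < ennreal \<rho>} \<le> (h p + \<epsilon>) * (s (\<phi> p) + \<epsilon>) * E / (1 - \<epsilon>) ^ ?d * \<rho> ^ ?d"
      if y: "y \<in> chart_ball U \<phi> p (R / 2)" and \<rho>: "0 < \<rho>" "\<rho> < \<delta>" for y \<rho>
    proof -
      define Bl where "Bl = {z. rdist y z < ennreal \<rho>}"
      define Lo where "Lo = {v. gnorm ?G (v - \<phi> y) < \<rho> / (1 + \<epsilon>)}"
      define Hi where "Hi = {v. gnorm ?G (v - \<phi> y) < \<rho> / (1 - \<epsilon>)}"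
      have y': "y \<in> U" "\<phi> y \<in> ball (\<phi> p) (R / 2)" "y \<in> chart_ball U \<phi> p R" using y R by (auto simp: chart_ball_def)
      have Bl_sets: "Bl \<in> sets borel" unfolding Bl_def by (intro borel_open rdist_ball_open)
      have Bl_nhd: "z \<in> chart_ball U \<phi> p R" "\<phi> z \<in> Hi" if "z \<in> Bl" for z
      proof -
        have z: "rdist y z < ennreal \<rho>" using that by (simp add: Bl_def)
        also have "ennreal \<rho> \<le> ennreal \<delta>0" using \<rho> \<delta> by (intro ennreal_leI) auto
        finally have l: "z \<in> chart_ball U \<phi> p R \<and> ennreal ((1 - \<epsilon>) * gnorm ?G (\<phi> z - \<phi> y)) \<le> rdist y z"
          by (rule lower[OF y])
        then show "z \<in> chart_ball U \<phi> p R" by simp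
        have "ennreal ((1 - \<epsilon>) * gnorm ?G (\<phi> z - \<phi> y)) < ennreal \<rho>" using l z by (meson le_less_trans)
        then have "(1 - \<epsilon>) * gnorm ?G (\<phi> z - \<phi> y) < \<rho>"
          using \<epsilon> gnorm_nonneg[OF G] by (subst (asm) ennreal_less_iff) auto
        then show "\<phi> z \<in> Hi" unfolding Hi_def using \<epsilon> by (simp add: field_simps)
      qed
      have Bl_U: "Bl \<subseteq> U" using Bl_nhd(1) by (auto simp: chart_ball_def)
      have Lo_Bl: "Lo \<subseteq> \<phi> ` Bl"
      proof
        fix v assume v: "v \<in> Lo"
        have "e0 * norm (v - \<phi> y) < \<rho>"
        proof -
          have "gnorm ?G (v - \<phi> y) < \<rho> / (1 + \<epsilon>)" using v by (simp add: Lo_def)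
          also have "\<dots> \<le> \<rho> / 1" using \<rho> \<epsilon> by (intro divide_left_mono) auto
          finally show ?thesis using e0(2)[of "v - \<phi> y"] by simp
        qed
        also have "\<rho> < e0 * (R / 2)" using \<rho> \<delta> by simp
        finally have "norm (v - \<phi> y) < R / 2" using e0 by simp
        then have vR: "v \<in> ball (\<phi> p) R"
          using y'(2) dist_triangle[of "\<phi> p" v "\<phi> y"] by (simp add: dist_norm norm_minus_commute)
        then have "v \<in> \<phi> ` U" using R(3) ball_subset_cball by blast
        then obtain z where z: "z \<in> U" "v = \<phi> z" by blast
        have "rdist y z \<le> ennreal ((1 + \<epsilon>) * gnorm ?G (\<phi> z - \<phi> y))"
          using y'(3) z vR by (intro upper) (auto simp: chart_ball_def)
        also have "\<dots> < ennreal \<rho>"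
          using v \<epsilon> \<rho> z by (intro ennreal_lessI) (auto simp: Lo_def field_simps)
        finally show "v \<in> \<phi> ` Bl" using z by (auto simp: Bl_def)
      qed
      have image_ball: "\<phi> ` Bl \<subseteq> ball (\<phi> p) R" using Bl_nhd(1) by (auto simp: chart_ball_def)
      have s_bounds: "s v \<le> s (\<phi> p) + \<epsilon>" "max 0 (s (\<phi> p) - \<epsilon>) \<le> s v" if "v \<in> \<phi> ` Bl" for v
        using near(1)[of v] that image_ball s0[of v] by (auto simp: dist_real_def)
      have h_bounds: "h z \<le> h p + \<epsilon>" "max 0 (h p - \<epsilon>) \<le> h z" if "z \<in> Bl" for z
      proof -
        have "\<phi> z \<in> ball (\<phi> p) R" "inv_into U \<phi> (\<phi> z) = z"
          using that image_ball Bl_U chart_inv[OF c, of z] by auto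
        then show "h z \<le> h p + \<epsilon>" "max 0 (h p - \<epsilon>) \<le> h z"
          using near(2)[of "\<phi> z"] h(2)[of z] by (auto simp: dist_real_def)
      qed
      have pos: "0 < \<rho> / (1 + \<epsilon>)" "0 < \<rho> / (1 - \<epsilon>)" using \<rho> \<epsilon> by auto
      have hp: "0 \<le> h p + \<epsilon>" "0 \<le> s (\<phi> p) + \<epsilon>" using h(2)[of p] s0[of "\<phi> p"] \<epsilon> by auto
      have vol_le: "emeasure vol Bl \<le> ennreal ((s (\<phi> p) + \<epsilon>) * ((\<rho> / (1 - \<epsilon>)) ^ ?d * E))"
      proof -
        have "emeasure vol Bl \<le> (\<integral>\<^sup>+v. ennreal (s (\<phi> p) + \<epsilon>) * indicator Hi v \<partial>lborel)"
          unfolding vol_eq[OF Bl_sets Bl_U]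
          using s_bounds(1) Bl_nhd(2) by (intro nn_integral_mono) (auto simp: indicator_def intro!: ennreal_leI)
        also have "\<dots> = ennreal (s (\<phi> p) + \<epsilon>) * emeasure lborel Hi"
          using emeasure_ellipsoid(1)[OF G pos(2)] by (intro nn_integral_cmult_indicator) (simp add: Hi_def)
        also have "\<dots> = ennreal ((s (\<phi> p) + \<epsilon>) * ((\<rho> / (1 - \<epsilon>)) ^ ?d * E))"
          unfolding Hi_def emeasure_ellipsoid(2)[OF G pos(2)] E_def[symmetric]
          using hp pos E0 by (intro ennreal_mult[symmetric]) (auto intro!: mult_nonneg_nonneg)
        finally show ?thesis .
      qed
      have vol_ge: "ennreal (max 0 (s (\<phi> p) - \<epsilon>) * ((\<rho> / (1 + \<epsilon>)) ^ ?d * E)) \<le> emeasure vol Bl"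
      proof -
        have "ennreal (max 0 (s (\<phi> p) - \<epsilon>) * ((\<rho> / (1 + \<epsilon>)) ^ ?d * E)) = ennreal (max 0 (s (\<phi> p) - \<epsilon>)) * emeasure lborel Lo"
          unfolding Lo_def emeasure_ellipsoid(2)[OF G pos(1)] E_def[symmetric]
          using pos E0 by (intro ennreal_mult) (auto intro!: mult_nonneg_nonneg)
        also have "\<dots> = (\<integral>\<^sup>+v. ennreal (max 0 (s (\<phi> p) - \<epsilon>)) * indicator Lo v \<partial>lborel)"
          using emeasure_ellipsoid(1)[OF G pos(1)] by (intro nn_integral_cmult_indicator[symmetric]) (simp add: Lo_def)
        also have "\<dots> \<le> emeasure vol Bl"
          unfolding vol_eq[OF Bl_sets Bl_U]
        proof (rule nn_integral_mono)
          fix v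
          show "ennreal (max 0 (s (\<phi> p) - \<epsilon>)) * indicator Lo v \<le> ennreal (s v) * indicator (\<phi> ` Bl) v"
            using s_bounds(2)[of v] Lo_Bl by (cases "v \<in> Lo") (auto simp: subset_iff intro!: ennreal_leI)
        qed
        finally show ?thesis .
      qed
      have Bl_vol: "Bl \<in> sets vol" using Bl_sets sets_vol by simp
      have \<mu>_eq: "emeasure \<mu> Bl = (\<integral>\<^sup>+x. ennreal (h x) * indicator Bl x \<partial>vol)"
        unfolding \<mu> using h_meas Bl_vol by (intro emeasure_density) auto
      have "emeasure \<mu> Bl \<le> (\<integral>\<^sup>+x. ennreal (h p + \<epsilon>) * indicator Bl x \<partial>vol)"
        unfolding \<mu>_eq using h_bounds(1) by (intro nn_integral_mono) (auto simp: indicator_def intro!: ennreal_leI)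
      also have "\<dots> = ennreal (h p + \<epsilon>) * emeasure vol Bl" by (rule nn_integral_cmult_indicator[OF Bl_vol])
      also have "\<dots> \<le> ennreal (h p + \<epsilon>) * ennreal ((s (\<phi> p) + \<epsilon>) * ((\<rho> / (1 - \<epsilon>)) ^ ?d * E))"
        by (intro mult_left_mono vol_le) simp
      also have "\<dots> = ennreal ((h p + \<epsilon>) * ((s (\<phi> p) + \<epsilon>) * ((\<rho> / (1 - \<epsilon>)) ^ ?d * E)))"
        using hp pos E0 by (intro ennreal_mult[symmetric]) (auto intro!: mult_nonneg_nonneg)
      finally have 1: "measure \<mu> Bl \<le> (h p + \<epsilon>) * ((s (\<phi> p) + \<epsilon>) * ((\<rho> / (1 - \<epsilon>)) ^ ?d * E))"
        unfolding emeasure_eq_measure using hp pos E0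
        by (subst (asm) ennreal_le_iff) (auto intro!: mult_nonneg_nonneg)
      have "ennreal (max 0 (h p - \<epsilon>) * (max 0 (s (\<phi> p) - \<epsilon>) * ((\<rho> / (1 + \<epsilon>)) ^ ?d * E)))
          = ennreal (max 0 (h p - \<epsilon>)) * ennreal (max 0 (s (\<phi> p) - \<epsilon>) * ((\<rho> / (1 + \<epsilon>)) ^ ?d * E))"
        using pos E0 by (intro ennreal_mult) (auto intro!: mult_nonneg_nonneg)
      also have "\<dots> \<le> ennreal (max 0 (h p - \<epsilon>)) * emeasure vol Bl"
        by (intro mult_left_mono vol_ge) simp
      also have "\<dots> = (\<integral>\<^sup>+x. ennreal (max 0 (h p - \<epsilon>)) * indicator Bl x \<partial>vol)"
        by (rule nn_integral_cmult_indicator[OF Bl_vol, symmetric])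
      also have "\<dots> \<le> emeasure \<mu> Bl"
        unfolding \<mu>_eq
      proof (rule nn_integral_mono)
        fix z
        show "ennreal (max 0 (h p - \<epsilon>)) * indicator Bl z \<le> ennreal (h z) * indicator Bl z"
          using h_bounds(2)[of z] by (cases "z \<in> Bl") (auto intro!: ennreal_leI)
      qed
      finally have 2: "max 0 (h p - \<epsilon>) * (max 0 (s (\<phi> p) - \<epsilon>) * ((\<rho> / (1 + \<epsilon>)) ^ ?d * E)) \<le> measure \<mu> Bl"
        unfolding emeasure_eq_measure by (subst (asm) ennreal_le_iff) auto
      show ?thesis using 1 2 unfolding Bl_def by (simp add: power_divide mult_ac)
    qed
    then show ?thesis
      using chart_ball_open[OF c, of p "R / 2"] chart_ball_center[OF p, of "R / 2"] R(1) \<delta>(1)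
      by (intro exI[of _ "chart_ball U \<phi> p (R / 2)"] exI[of _ \<delta>]) auto
  qed
  show ?thesis
  proof (rule that)
    show "0 \<le> k" using h(2)[of p] s0 E0 by (auto simp: k_def intro!: mult_nonneg_nonneg)
    fix e :: real assume e: "0 < e"
    have "((\<lambda>\<epsilon>. max 0 (h p - \<epsilon>) * max 0 (s (\<phi> p) - \<epsilon>) * E / (1 + \<epsilon>) ^ ?d) \<longlongrightarrow>
        max 0 (h p - 0) * max 0 (s (\<phi> p) - 0) * E / (1 + 0) ^ ?d) (at_right 0)"
      by (intro tendsto_intros) auto
    then have a: "((\<lambda>\<epsilon>. max 0 (h p - \<epsilon>) * max 0 (s (\<phi> p) - \<epsilon>) * E / (1 + \<epsilon>) ^ ?d) \<longlongrightarrow> k) (at_right 0)"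
      using h(2)[of p] s0[of "\<phi> p"] by (simp add: k_def max_absorb2)
    have "((\<lambda>\<epsilon>. (h p + \<epsilon>) * (s (\<phi> p) + \<epsilon>) * E / (1 - \<epsilon>) ^ ?d) \<longlongrightarrow>
        (h p + 0) * (s (\<phi> p) + 0) * E / (1 - 0) ^ ?d) (at_right 0)"
      by (intro tendsto_intros) auto
    then have b: "((\<lambda>\<epsilon>. (h p + \<epsilon>) * (s (\<phi> p) + \<epsilon>) * E / (1 - \<epsilon>) ^ ?d) \<longlongrightarrow> k) (at_right 0)"
      by (simp add: k_def)
    have "\<forall>\<^sub>F \<epsilon>::real in at_right 0. 0 < \<epsilon> \<and> \<epsilon> < 1"
      unfolding eventually_at_right_field by (auto intro!: exI[of _ 1])
    with tendstoD[OF a e] tendstoD[OF b e]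
    have "\<forall>\<^sub>F \<epsilon> in at_right 0. 0 < \<epsilon> \<and> \<epsilon> < 1 \<and> k - e \<le> max 0 (h p - \<epsilon>) * max 0 (s (\<phi> p) - \<epsilon>) * E / (1 + \<epsilon>) ^ ?d
        \<and> (h p + \<epsilon>) * (s (\<phi> p) + \<epsilon>) * E / (1 - \<epsilon>) ^ ?d \<le> k + e"
      by eventually_elim (auto simp: dist_real_def abs_diff_less_iff intro: less_imp_le)
    then obtain \<epsilon> where \<epsilon>: "0 < \<epsilon>" "\<epsilon> < 1" "k - e \<le> max 0 (h p - \<epsilon>) * max 0 (s (\<phi> p) - \<epsilon>) * E / (1 + \<epsilon>) ^ ?d"
        "(h p + \<epsilon>) * (s (\<phi> p) + \<epsilon>) * E / (1 - \<epsilon>) ^ ?d \<le> k + e"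
      using eventually_happens'[OF trivial_limit_at_right_real] by blast
    obtain W \<delta> where W: "open W" "p \<in> W" "0 < \<delta>" and bounds: "\<And>y \<rho>. y \<in> W \<Longrightarrow> 0 < \<rho> \<Longrightarrow> \<rho> < \<delta> \<Longrightarrow>
        max 0 (h p - \<epsilon>) * max 0 (s (\<phi> p) - \<epsilon>) * E / (1 + \<epsilon>) ^ ?d * \<rho> ^ ?d \<le> measure \<mu> {z. rdist y z < ennreal \<rho>} \<and>
        measure \<mu> {z. rdist y z < ennreal \<rho>} \<le> (h p + \<epsilon>) * (s (\<phi> p) + \<epsilon>) * E / (1 - \<epsilon>) ^ ?d * \<rho> ^ ?d"
      using main[OF \<epsilon>(1,2)] by blast
    show "\<exists>W \<delta>. open W \<and> p \<in> W \<and> 0 < \<delta> \<and> (\<forall>y\<in>W. \<forall>\<rho>. 0 < \<rho> \<and> \<rho> < \<delta> \<longrightarrow>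
        (k - e) * \<rho> ^ CARD('n) \<le> measure \<mu> {z. rdist y z < ennreal \<rho>} \<and>
        measure \<mu> {z. rdist y z < ennreal \<rho>} \<le> (k + e) * \<rho> ^ CARD('n))"
    proof (intro exI conjI ballI allI impI)
      fix y \<rho> assume "y \<in> W" "0 < \<rho> \<and> \<rho> < \<delta>"
      then have y: "y \<in> W" "0 < \<rho>" "\<rho> < \<delta>" by auto
      have "0 \<le> \<rho> ^ ?d" using y by simp
      then show "(k - e) * \<rho> ^ ?d \<le> measure \<mu> {z. rdist y z < ennreal \<rho>}"
        "measure \<mu> {z. rdist y z < ennreal \<rho>} \<le> (k + e) * \<rho> ^ ?d"
        using bounds[OF y] mult_right_mono[OF \<epsilon>(3), of "\<rho> ^ ?d"] mult_right_mono[OF \<epsilon>(4), of "\<rho> ^ ?d"] by linarith+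
    qed (use W in auto)
  qed
qed

end

section \<open>Smooth maps are Lipschitz\<close>

text \<open>The partial derivatives are bounded on the compact convex ball.\<close>

lemma smooth_lipschitz_on_cball:
  fixes F :: "'b::euclidean_space \<Rightarrow> 'c::real_normed_vector"
  assumes diff: "\<And>x. x \<in> cball a R \<Longrightarrow> F differentiable at x"
    and cont: "\<And>v. continuous_on (cball a R) (\<lambda>x. frechet_derivative F (at x) v)"
  obtains K where "0 \<le> K" "\<And>x y. x \<in> cball a R \<Longrightarrow> y \<in> cball a R \<Longrightarrow> norm (F x - F y) \<le> K * norm (x - y)"
proof -
  let ?D = "\<lambda>x. frechet_derivative F (at x)"
  have "\<exists>C. \<forall>x\<in>cball a R. norm (?D x v) \<le> C" for v
  proof -
    have "bounded ((\<lambda>x. ?D x v) ` cball a R)"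
      by (intro compact_imp_bounded compact_continuous_image cont) simp
    then show ?thesis unfolding bounded_iff by blast
  qed
  then obtain C where C: "\<And>v x. x \<in> cball a R \<Longrightarrow> norm (?D x v) \<le> C v" by metis
  define K where "K = (\<Sum>b\<in>Basis. \<bar>C b\<bar>)"
  have der: "(F has_derivative ?D x) (at x)" if "x \<in> cball a R" for x
    using diff[OF that] by (simp add: frechet_derivative_works)
  have "onorm (?D x) \<le> K" if x: "x \<in> cball a R" for x
  proof (rule onorm_le)
    fix v
    have lin: "linear (?D x)" using der[OF x] by (rule has_derivative_linear)
    have "?D x v = ?D x (\<Sum>b\<in>Basis. (v \<bullet> b) *\<^sub>R b)" by (simp add: euclidean_representation)
    also have "\<dots> = (\<Sum>b\<in>Basis. (v \<bullet> b) *\<^sub>R ?D x b)"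
      by (simp add: linear_sum[OF lin] linear_cmul[OF lin])
    also have "norm \<dots> \<le> (\<Sum>b\<in>Basis. norm v * \<bar>C b\<bar>)"
    proof (rule sum_norm_le)
      fix b :: 'b assume b: "b \<in> Basis"
      have "\<bar>v \<bullet> b\<bar> * norm (?D x b) \<le> norm v * \<bar>C b\<bar>"
        using C[OF x, of b] Basis_le_norm[OF b, of v] by (intro mult_mono) auto
      then show "norm ((v \<bullet> b) *\<^sub>R ?D x b) \<le> norm v * \<bar>C b\<bar>" by simp
    qed
    also have "\<dots> = K * norm v" by (simp add: K_def sum_distrib_left mult.commute)
    finally show "norm (?D x v) \<le> K * norm v" .
  qed
  then have "norm (F x - F y) \<le> K * norm (x - y)" if "x \<in> cball a R" "y \<in> cball a R" for x y
    using der that by (intro differentiable_bound[of "cball a R" F ?D]) (auto intro: has_derivative_at_withinI)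
  moreover have "0 \<le> K" by (simp add: K_def sum_nonneg)
  ultimately show ?thesis using that by blast
qed

context riemannian begin

text \<open>In charts around \<open>p\<close> and \<open>f p\<close> the distance is comparable with the norm, and \<open>f\<close> is \<open>C\<^sup>1\<close>.\<close>

lemma smooth_map_locally_lipschitz:
  assumes f: "smooth_map \<A> f"
  obtains W \<delta> K where "open W" "p \<in> W" "0 < \<delta>" "0 \<le> K"
    "\<And>y z. y \<in> W \<Longrightarrow> rdist y z < ennreal \<delta> \<Longrightarrow> rdist (f y) (f z) \<le> ennreal K * rdist y z"
proof -
  have half: "0 < (1/2::real)" "(1/2::real) < 1" by auto
  have f_cont: "continuous_on UNIV f" using f by (simp add: smooth_map_def)
  obtain U \<phi> where c: "(U, \<phi>) \<in> \<A>" and p: "p \<in> U" by (rule chart_cover)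
  obtain V \<psi> where c': "(V, \<psi>) \<in> \<A>" and p': "f p \<in> V" by (rule chart_cover)
  let ?F = "\<psi> \<circ> f \<circ> inv_into U \<phi>" and ?G = "g (U, \<phi>) p" and ?H = "g (V, \<psi>) (f p)"
  have G: "sym_posdef ?G" and H: "sym_posdef ?H" by (rule metric_sym_posdef[OF c p], rule metric_sym_posdef[OF c' p'])
  obtain e where e: "0 < e" "\<And>v. e * norm v \<le> gnorm ?G v" by (rule gnorm_equiv_norm[OF G]) blast
  obtain C where C: "0 < C" "\<And>v. gnorm ?H v \<le> C * norm v" by (rule gnorm_equiv_norm[OF H]) blast
  obtain R' where R': "0 < R'" and upper: "\<And>y z. y \<in> chart_ball V \<psi> (f p) R' \<Longrightarrow> z \<in> chart_ball V \<psi> (f p) R' \<Longrightarrow>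
      rdist y z \<le> ennreal ((1 + 1/2) * gnorm ?H (\<psi> z - \<psi> y))"
    using rdist_local[OF c' p' half zero_less_one] by metis
  define \<Omega> where "\<Omega> = \<phi> ` U \<inter> inv_into U \<phi> -` (f -` chart_ball V \<psi> (f p) R')"
  have "open (f -` chart_ball V \<psi> (f p) R')" using f_cont chart_ball_open[OF c'] by (simp add: continuous_on_open_vimage)
  then have "open \<Omega>" unfolding \<Omega>_def
    by (intro continuous_open_preimage chart_inv_continuous[OF c] chart_open_image[OF c])
  moreover have "\<phi> p \<in> \<Omega>" unfolding \<Omega>_def using p chart_ball_center[OF p' R'] chart_inv[OF c p] by auto
  ultimately obtain R0 where R0: "0 < R0" "cball (\<phi> p) R0 \<subseteq> \<Omega>" using open_contains_cball by blast
  obtain R \<delta> where R: "0 < R" "R < R0" "0 < \<delta>" and lower: "\<And>y z. y \<in> chart_ball U \<phi> p (R / 2) \<Longrightarrow> rdist y z < ennreal \<delta> \<Longrightarrow>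
       z \<in> chart_ball U \<phi> p R \<and> ennreal ((1 - 1/2) * gnorm ?G (\<phi> z - \<phi> y)) \<le> rdist y z"
    using rdist_local[OF c p half R0(1)] by metis
  have nhd_\<Omega>: "\<phi> z \<in> cball (\<phi> p) R0" "f z \<in> chart_ball V \<psi> (f p) R'" if "z \<in> chart_ball U \<phi> p R" for z
  proof -
    show 1: "\<phi> z \<in> cball (\<phi> p) R0" using that R by (auto simp: chart_ball_def)
    have "z \<in> U" using that by (simp add: chart_ball_def)
    then show "f z \<in> chart_ball V \<psi> (f p) R'" using 1 R0(2) chart_inv[OF c, of z] by (auto simp: \<Omega>_def)
  qed
  have "smooth_on (\<phi> ` (U \<inter> f -` V)) ?F" using f c c' unfolding smooth_map_def by fastforce
  note F = smooth_onD[OF this]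
  have sub: "cball (\<phi> p) R0 \<subseteq> \<phi> ` (U \<inter> f -` V)"
  proof
    fix v assume "v \<in> cball (\<phi> p) R0"
    then have "v \<in> \<Omega>" using R0 by blast
    then show "v \<in> \<phi> ` (U \<inter> f -` V)" unfolding \<Omega>_def chart_ball_def using chart_inv[OF c] by force
  qed
  obtain K0 where K0: "0 \<le> K0" "\<And>x y. x \<in> cball (\<phi> p) R0 \<Longrightarrow> y \<in> cball (\<phi> p) R0 \<Longrightarrow> norm (?F x - ?F y) \<le> K0 * norm (x - y)"
    by (rule smooth_lipschitz_on_cball[of "\<phi> p" R0 ?F]) (use F(1) sub continuous_on_subset[OF F(2) sub] in auto)
  define K where "K = 3 * (C * K0 / e)"
  have K: "0 \<le> K" using C K0 e by (simp add: K_def)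
  show ?thesis
  proof (rule that[OF chart_ball_open[OF c] chart_ball_center[OF p half_gt_zero[OF R(1)]] R(3) K])
    fix y z assume y: "y \<in> chart_ball U \<phi> p (R / 2)" and yz: "rdist y z < ennreal \<delta>"
    have z: "z \<in> chart_ball U \<phi> p R" and ge: "ennreal ((1 - 1/2) * gnorm ?G (\<phi> z - \<phi> y)) \<le> rdist y z"
      using lower[OF y yz] by auto
    have y': "y \<in> chart_ball U \<phi> p R" using y R by (auto simp: chart_ball_def)
    have "y \<in> U" "z \<in> U" using y z by (auto simp: chart_ball_def)
    then have F_eq: "?F (\<phi> z) = \<psi> (f z)" "?F (\<phi> y) = \<psi> (f y)" by (simp_all add: chart_inv[OF c])
    have "(1 + 1/2) * gnorm ?H (\<psi> (f z) - \<psi> (f y)) \<le> (1 + 1/2) * (C * (K0 * ((1 / e) * gnorm ?G (\<phi> z - \<phi> y))))"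
    proof -
      have "norm (\<phi> z - \<phi> y) \<le> (1 / e) * gnorm ?G (\<phi> z - \<phi> y)"
        using e(2)[of "\<phi> z - \<phi> y"] e(1) by (simp add: field_simps)
      then have "K0 * norm (\<phi> z - \<phi> y) \<le> K0 * ((1 / e) * gnorm ?G (\<phi> z - \<phi> y))" using K0 by (intro mult_left_mono)
      moreover have "norm (\<psi> (f z) - \<psi> (f y)) \<le> K0 * norm (\<phi> z - \<phi> y)"
        using K0(2)[OF nhd_\<Omega>(1)[OF z] nhd_\<Omega>(1)[OF y']] unfolding F_eq .
      ultimately have "C * norm (\<psi> (f z) - \<psi> (f y)) \<le> C * (K0 * ((1 / e) * gnorm ?G (\<phi> z - \<phi> y)))"
        using C by (intro mult_left_mono) auto
      then show ?thesis using C(2)[of "\<psi> (f z) - \<psi> (f y)"] by (intro mult_left_mono) auto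
    qed
    also have "\<dots> = K * ((1 - 1/2) * gnorm ?G (\<phi> z - \<phi> y))" by (simp add: K_def)
    finally have le: "(1 + 1/2) * gnorm ?H (\<psi> (f z) - \<psi> (f y)) \<le> K * ((1 - 1/2) * gnorm ?G (\<phi> z - \<phi> y))" .
    have "rdist (f y) (f z) \<le> ennreal ((1 + 1/2) * gnorm ?H (\<psi> (f z) - \<psi> (f y)))"
      by (rule upper[OF nhd_\<Omega>(2)[OF y'] nhd_\<Omega>(2)[OF z]])
    also have "\<dots> \<le> ennreal (K * ((1 - 1/2) * gnorm ?G (\<phi> z - \<phi> y)))" by (rule ennreal_leI[OF le])
    also have "\<dots> = ennreal K * ennreal ((1 - 1/2) * gnorm ?G (\<phi> z - \<phi> y))"
      using K gnorm_nonneg[OF G] by (intro ennreal_mult) auto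
    also have "\<dots> \<le> ennreal K * rdist y z" by (intro mult_left_mono ge) simp
    finally show "rdist (f y) (f z) \<le> ennreal K * rdist y z" .
  qed
qed

text \<open>
  By compactness the local constants are uniform at small distances; at larger distances the
  truncation of the distance at 1 gives the bound.
\<close>

lemma smooth_map_lipschitz:
  assumes comp: "compact (UNIV :: 'a set)" and f: "smooth_map \<A> f"
  obtains L where "1 \<le> L" "\<And>x y. bdist (f x) (f y) \<le> L * bdist x y"
proof -
  have "\<forall>p. \<exists>W \<delta> K. open W \<and> p \<in> W \<and> 0 < \<delta> \<and> 0 \<le> K \<and>
    (\<forall>y z. y \<in> W \<longrightarrow> rdist y z < ennreal \<delta> \<longrightarrow> rdist (f y) (f z) \<le> ennreal K * rdist y z)"
  proof
    fix p
    show "\<exists>W \<delta> K. open W \<and> p \<in> W \<and> 0 < \<delta> \<and> 0 \<le> K \<and>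
      (\<forall>y z. y \<in> W \<longrightarrow> rdist y z < ennreal \<delta> \<longrightarrow> rdist (f y) (f z) \<le> ennreal K * rdist y z)"
      by (rule smooth_map_locally_lipschitz[OF f, of p]) blast
  qed
  then obtain W \<delta> K where W: "\<And>p. open (W p)" "\<And>p. p \<in> W p" "\<And>p. 0 < \<delta> p" "\<And>p. 0 \<le> K p"
    "\<And>p y z. y \<in> W p \<Longrightarrow> rdist y z < ennreal (\<delta> p) \<Longrightarrow> rdist (f y) (f z) \<le> ennreal (K p) * rdist y z" by metis
  obtain P where P: "finite P" "UNIV \<subseteq> (\<Union>p\<in>P. W p)"
    using compactE_image[OF comp, of UNIV W] W(1,2) by (metis UNIV_I UN_I subsetI)
  have "P \<noteq> {}" using P by auto
  define \<delta>0 where "\<delta>0 = min 1 (Min (\<delta> ` P))"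
  define L where "L = max 1 (max (1 / \<delta>0) (Max (K ` P)))"
  have \<delta>0: "0 < \<delta>0" "\<delta>0 \<le> 1" "\<And>p. p \<in> P \<Longrightarrow> \<delta>0 \<le> \<delta> p"
    using P \<open>P \<noteq> {}\<close> W(3) by (auto simp: \<delta>0_def intro: min.coboundedI2)
  have L: "1 \<le> L" "1 / \<delta>0 \<le> L" "\<And>p. p \<in> P \<Longrightarrow> K p \<le> L"
    using P by (auto simp: L_def intro!: max.coboundedI2)
  have "bdist (f x) (f y) \<le> L * bdist x y" for x y
  proof (cases "bdist x y < \<delta>0")
    case True
    then have small: "rdist x y < ennreal \<delta>0" using bdist_less_iff[OF \<delta>0(2)] by simp
    obtain p where p: "p \<in> P" "x \<in> W p" using P by blast
    have "rdist x y < ennreal (\<delta> p)" using small \<delta>0(3)[OF p(1)] by (meson ennreal_leI less_le_trans)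
    then have "rdist (f x) (f y) \<le> ennreal (K p) * rdist x y" by (rule W(5)[OF p(2)])
    also have "rdist x y = ennreal (bdist x y)"
      unfolding ennreal_bdist using small \<delta>0(2) by (metis ennreal_1 ennreal_leI less_imp_le less_le_trans min.absorb2)
    also have "ennreal (K p) * ennreal (bdist x y) \<le> ennreal L * ennreal (bdist x y)"
      by (intro mult_right_mono ennreal_leI L(3) p) simp
    also have "\<dots> = ennreal (L * bdist x y)" using L bdist_nonneg by (intro ennreal_mult[symmetric]) auto
    finally have "ennreal (bdist (f x) (f y)) \<le> ennreal (L * bdist x y)" using bdist_le_rdist order_trans by blast
    then show ?thesis using L(1) bdist_nonneg[of x y] by (subst (asm) ennreal_le_iff) auto
  next
    case False
    have "bdist (f x) (f y) \<le> 1" by (rule bdist_le_1)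
    also have "1 = 1 / \<delta>0 * \<delta>0" using \<delta>0 by simp
    also have "\<dots> \<le> L * bdist x y" using False L \<delta>0 by (intro mult_mono) auto
    finally show ?thesis .
  qed
  then show ?thesis using that L(1) by blast
qed

text \<open>Compactness also makes the bound on the measure of balls uniform.\<close>

lemma ball_measure_bound:
  assumes comp: "compact (UNIV :: 'a set)" and vol: "riemannian_volume \<A> g vol" and h: "smooth_fun \<A> h" "\<And>x. 0 < h x"
    and \<mu>: "\<mu> = density vol (\<lambda>x. ennreal (h x))" and prob: "prob_space \<mu>"
  obtains B where "0 < B" "\<And>x \<rho>. 0 < \<rho> \<Longrightarrow> measure \<mu> {y. bdist x y < \<rho>} \<le> B * \<rho> ^ CARD('n)"
proof -
  interpret prob_space \<mu> by (rule prob)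
  have "\<exists>W \<delta> C. open W \<and> p \<in> W \<and> 0 < \<delta> \<and> 0 < C \<and> (\<forall>y\<in>W. \<forall>\<rho>. 0 < \<rho> \<longrightarrow> \<rho> < \<delta> \<longrightarrow>
        measure \<mu> {z. rdist y z < ennreal \<rho>} \<le> C * \<rho> ^ CARD('n))" for p
  proof -
    obtain k where k: "0 \<le> k" and near:
      "\<And>e. 0 < e \<Longrightarrow> \<exists>W \<delta>. open W \<and> p \<in> W \<and> 0 < \<delta> \<and> (\<forall>y\<in>W. \<forall>\<rho>. 0 < \<rho> \<and> \<rho> < \<delta> \<longrightarrow>
        (k - e) * \<rho> ^ CARD('n) \<le> measure \<mu> {z. rdist y z < ennreal \<rho>} \<and>
        measure \<mu> {z. rdist y z < ennreal \<rho>} \<le> (k + e) * \<rho> ^ CARD('n))"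
      by (rule ball_measure[OF vol h \<mu> prob, of p]) blast
    obtain W \<delta> where "open W" "p \<in> W" "0 < \<delta>" "\<forall>y\<in>W. \<forall>\<rho>. 0 < \<rho> \<and> \<rho> < \<delta> \<longrightarrow>
        (k - 1) * \<rho> ^ CARD('n) \<le> measure \<mu> {z. rdist y z < ennreal \<rho>} \<and>
        measure \<mu> {z. rdist y z < ennreal \<rho>} \<le> (k + 1) * \<rho> ^ CARD('n)"
      using near[OF zero_less_one] by blast
    then show ?thesis using k by (intro exI[of _ W] exI[of _ \<delta>] exI[of _ "k + 1"]) auto
  qed
  then obtain W \<delta> C where W: "\<And>p. open (W p)" "\<And>p. p \<in> W p" "\<And>p. 0 < \<delta> p" "\<And>p. 0 < C p"
    "\<And>p y \<rho>. y \<in> W p \<Longrightarrow> 0 < \<rho> \<Longrightarrow> \<rho> < \<delta> p \<Longrightarrow> measure \<mu> {z. rdist y z < ennreal \<rho>} \<le> C p * \<rho> ^ CARD('n)"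
    by metis
  obtain P where P: "finite P" "UNIV \<subseteq> (\<Union>p\<in>P. W p)"
    using compactE_image[OF comp, of UNIV W] W(1,2) by (metis UNIV_I UN_I subsetI)
  have "P \<noteq> {}" using P by auto
  define \<delta>0 where "\<delta>0 = min 1 (Min (\<delta> ` P))"
  define B where "B = max (1 / \<delta>0 ^ CARD('n)) (Max (C ` P))"
  have \<delta>0: "0 < \<delta>0" "\<delta>0 \<le> 1" "\<And>p. p \<in> P \<Longrightarrow> \<delta>0 \<le> \<delta> p"
    using P \<open>P \<noteq> {}\<close> W(3) by (auto simp: \<delta>0_def intro: min.coboundedI2)
  have B: "1 / \<delta>0 ^ CARD('n) \<le> B" "\<And>p. p \<in> P \<Longrightarrow> C p \<le> B"
    using P by (auto simp: B_def intro!: max.coboundedI2)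
  have B0: "0 < B" using B(1) \<delta>0(1) by (meson less_le_trans zero_less_divide_1_iff zero_less_power)
  show ?thesis
  proof (rule that[OF B0])
    fix x and \<rho> :: real assume \<rho>: "0 < \<rho>"
    show "measure \<mu> {y. bdist x y < \<rho>} \<le> B * \<rho> ^ CARD('n)"
    proof (cases "\<rho> < \<delta>0")
      case True
      obtain p where p: "p \<in> P" "x \<in> W p" using P by blast
      have "\<rho> < \<delta> p" "\<rho> \<le> 1" using True \<delta>0(2) \<delta>0(3)[OF p(1)] by auto
      then have "measure \<mu> {y. bdist x y < \<rho>} \<le> C p * \<rho> ^ CARD('n)"
        using W(5)[OF p(2) \<rho>] by (simp add: bdist_less_iff)
      also have "\<dots> \<le> B * \<rho> ^ CARD('n)" using \<rho> B(2)[OF p(1)] by (intro mult_right_mono) auto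
      finally show ?thesis .
    next
      case False
      have "measure \<mu> {y. bdist x y < \<rho>} \<le> 1" by simp
      also have "1 = 1 / \<delta>0 ^ CARD('n) * \<delta>0 ^ CARD('n)" using \<delta>0 by simp
      also have "\<dots> \<le> B * \<rho> ^ CARD('n)" using B B0 False \<delta>0 by (intro mult_mono power_mono) auto
      finally show ?thesis .
    qed
  qed
qed

lemma ball_measure_limit:
  assumes vol: "riemannian_volume \<A> g vol" and h: "smooth_fun \<A> h" "\<And>x. 0 < h x"
    and \<mu>: "\<mu> = density vol (\<lambda>x. ennreal (h x))" and prob: "prob_space \<mu>"
  shows "((\<lambda>\<rho>. measure \<mu> {y. rdist x y < ennreal \<rho>} / \<rho> ^ CARD('n)) \<longlongrightarrow> ball_density \<A> g \<mu> x) (at_right 0)"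
proof -
  obtain k where near:
      "\<And>e. 0 < e \<Longrightarrow> \<exists>W \<delta>. open W \<and> x \<in> W \<and> 0 < \<delta> \<and> (\<forall>y\<in>W. \<forall>\<rho>. 0 < \<rho> \<and> \<rho> < \<delta> \<longrightarrow>
        (k - e) * \<rho> ^ CARD('n) \<le> measure \<mu> {z. rdist y z < ennreal \<rho>} \<and>
        measure \<mu> {z. rdist y z < ennreal \<rho>} \<le> (k + e) * \<rho> ^ CARD('n))"
    by (rule ball_measure[OF vol h \<mu> prob, of x]) blast
  have lim: "((\<lambda>\<rho>. measure \<mu> {y. rdist x y < ennreal \<rho>} / \<rho> ^ CARD('n)) \<longlongrightarrow> k) (at_right 0)"
  proof (rule tendstoI)
    fix e :: real assume "0 < e"
    then obtain W \<delta> where W: "x \<in> W" "0 < \<delta>" "\<And>y \<rho>. y \<in> W \<Longrightarrow> 0 < \<rho> \<Longrightarrow> \<rho> < \<delta> \<Longrightarrow>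
        (k - e / 2) * \<rho> ^ CARD('n) \<le> measure \<mu> {z. rdist y z < ennreal \<rho>} \<and>
        measure \<mu> {z. rdist y z < ennreal \<rho>} \<le> (k + e / 2) * \<rho> ^ CARD('n)"
      using near[of "e / 2"] by auto
    have "dist (measure \<mu> {y. rdist x y < ennreal \<rho>} / \<rho> ^ CARD('n)) k < e" if "0 < \<rho>" "\<rho> < \<delta>" for \<rho>
    proof -
      have "0 < \<rho> ^ CARD('n)" using that by simp
      then have "k - e / 2 \<le> measure \<mu> {y. rdist x y < ennreal \<rho>} / \<rho> ^ CARD('n)"
        "measure \<mu> {y. rdist x y < ennreal \<rho>} / \<rho> ^ CARD('n) \<le> k + e / 2"
        using W(3)[OF W(1) that] by (simp_all add: pos_le_divide_eq pos_divide_le_eq)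
      then show ?thesis using \<open>0 < e\<close> by (simp add: dist_real_def abs_if)
    qed
    then show "\<forall>\<^sub>F \<rho> in at_right 0. dist (measure \<mu> {y. rdist x y < ennreal \<rho>} / \<rho> ^ CARD('n)) k < e"
      unfolding eventually_at_right_field using W(2) by blast
  qed
  have "ball_density \<A> g \<mu> x = k"
    unfolding ball_density_def riem_ball_def rdist_def[symmetric]
    by (rule tendsto_Lim[OF trivial_limit_at_right_real lim])
  then show ?thesis using lim by simp
qed

end

section \<open>Mixing with respect to the truncated distance\<close>

text \<open>The constant observable 1 is integrated without error, so no bound can be negative.\<close>

lemma exp_mixing_rate_nonneg:
  assumes C: "0 < C" and p: "1 \<le> p"
    and mix: "\<forall>F. (\<exists>L. lipschitz_const_on_power d p F L) \<longrightarrow>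
           (\<forall>(m::nat) k::nat \<Rightarrow> nat. k 0 = 0 \<and> (\<forall>j<p. k j + m \<le> k (Suc j)) \<longrightarrow>
              \<bar>(\<integral>x. F (\<lambda>j\<in>{..p}. (f ^^ k j) x) \<partial>\<mu>) - (\<integral>x. F x \<partial>PiM {..p} (\<lambda>_. \<mu>))\<bar>
                \<le> C * \<theta> ^ m * lipschitz_norm d p F)"
  shows "0 \<le> (\<theta>::real)"
proof -
  let ?F = "\<lambda>_ :: nat \<Rightarrow> 'a. 1 :: real"
  have lip: "lipschitz_const_on_power d p ?F 0" by (simp add: lipschitz_const_on_power_def)
  have ne: "power_space p \<noteq> ({} :: (nat \<Rightarrow> 'a) set)" by (auto simp: power_space_def PiE_eq_empty_iff)
  have "Inf {L. lipschitz_const_on_power d p ?F L} = 0"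
    by (rule cInf_eq_minimum) (use lip in \<open>auto simp: lipschitz_const_on_power_def\<close>)
  then have norm: "lipschitz_norm d p ?F = 1" using ne by (simp add: lipschitz_norm_def)
  have "\<bar>(\<integral>x. ?F (\<lambda>j\<in>{..p}. (f ^^ j) x) \<partial>\<mu>) - (\<integral>x. ?F x \<partial>PiM {..p} (\<lambda>_. \<mu>))\<bar>
      \<le> C * \<theta> ^ 1 * lipschitz_norm d p ?F"
    using mix[rule_format, of ?F "\<lambda>j. j" 1] lip by auto
  from order_trans[OF abs_ge_zero this] have "0 \<le> C * \<theta>" using norm by simp
  then show ?thesis using C by (simp add: zero_le_mult_iff)
qed

context riemannian begin

lemma exp_mixing_bdist:
  assumes p: "1 \<le> p" and mix: "exp_mixing (riem_dist \<A> g) f \<mu> p"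
  shows "\<exists>C \<theta>. 0 < C \<and> 0 < \<theta> \<and> \<theta> < 1 \<and> mixes bdist f \<mu> p C \<theta>"
proof -
  let ?d = "riem_dist \<A> g"
  obtain C \<theta> :: real where C: "0 < C" and \<theta>1: "\<theta> < 1" and
    H: "\<forall>F. (\<exists>L. lipschitz_const_on_power ?d p F L) \<longrightarrow>
           (\<forall>(m::nat) k::nat \<Rightarrow> nat. k 0 = 0 \<and> (\<forall>j<p. k j + m \<le> k (Suc j)) \<longrightarrow>
              \<bar>(\<integral>x. F (\<lambda>j\<in>{..p}. (f ^^ k j) x) \<partial>\<mu>) - (\<integral>x. F x \<partial>PiM {..p} (\<lambda>_. \<mu>))\<bar>
                \<le> C * \<theta> ^ m * lipschitz_norm ?d p F)"
    using mix unfolding exp_mixing_def by blast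
  have \<theta>0: "0 \<le> \<theta>" by (rule exp_mixing_rate_nonneg[OF C p H])
  show ?thesis
  proof (rule exI[of _ C], rule exI[of _ "max \<theta> (1/2)"], unfold mixes_def, intro conjI allI impI)
    fix F :: "(nat \<Rightarrow> 'a) \<Rightarrow> real" and K :: real and m :: nat and k :: "nat \<Rightarrow> nat"
    assume K: "0 \<le> K" and F01: "\<forall>x. 0 \<le> F x \<and> F x \<le> 1"
      and lip: "\<forall>x y. \<bar>F x - F y\<bar> \<le> K * (\<Sum>i\<le>p. bdist (x i) (y i))"
      and k: "k 0 = 0" "\<forall>j<p. k j + m \<le> k (Suc j)"
    have const: "lipschitz_const_on_power ?d p F K"
      unfolding lipschitz_const_on_power_def
    proof (intro conjI ballI K)
      fix x y
      have "ennreal \<bar>F x - F y\<bar> \<le> ennreal (K * (\<Sum>i\<le>p. bdist (x i) (y i)))"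
        using lip by (intro ennreal_leI) auto
      also have "\<dots> = ennreal K * (\<Sum>i\<le>p. ennreal (bdist (x i) (y i)))"
        using K by (simp add: ennreal_mult sum_nonneg bdist_nonneg)
      also have "\<dots> \<le> ennreal K * (\<Sum>i\<le>p. ?d (x i) (y i))"
        using bdist_le_rdist unfolding rdist_def by (intro mult_left_mono sum_mono) auto
      finally show "ennreal \<bar>F x - F y\<bar> \<le> ennreal K * (\<Sum>i\<le>p. ?d (x i) (y i))" .
    qed
    have "lipschitz_norm ?d p F \<le> 1 + K"
      unfolding lipschitz_norm_def
    proof (intro add_mono)
      show "(SUP x\<in>power_space p. \<bar>F x\<bar>) \<le> 1"
        using F01 by (intro cSUP_least) (auto simp: power_space_def PiE_eq_empty_iff)
      show "Inf {L. lipschitz_const_on_power ?d p F L} \<le> K"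
        using const by (intro cInf_lower) (auto simp: lipschitz_const_on_power_def intro!: bdd_belowI[of _ 0])
    qed
    then have "C * \<theta> ^ m * lipschitz_norm ?d p F \<le> C * \<theta> ^ m * (1 + K)"
      using C \<theta>0 by (intro mult_left_mono) auto
    also have "\<dots> \<le> C * max \<theta> (1/2) ^ m * (1 + K)"
      using C \<theta>0 K by (intro mult_right_mono mult_left_mono power_mono) auto
    finally show "\<bar>(\<integral>x. F (\<lambda>j\<in>{..p}. (f ^^ k j) x) \<partial>\<mu>) - (\<integral>x. F x \<partial>PiM {..p} (\<lambda>_. \<mu>))\<bar>
        \<le> C * max \<theta> (1/2) ^ m * (1 + K)"
      using H const k by (meson order_trans)
  qed (use C \<theta>1 in auto)
qed

end

theorem theorem5p3:
  fixes \<A> :: "('a::{t2_space, second_countable_topology}, 'n::finite) chart set"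
    and g :: "('a, 'n) metric_components"
    and f :: "'a \<Rightarrow> 'a" and \<mu> :: "'a measure" and \<tau> :: real and l :: nat
  assumes "riemannian_manifold \<A> g" and "compact (UNIV :: 'a set)"
    and "smooth_diffeo \<A> f"
    and "smooth_measure \<A> g \<mu>" and "prob_space \<mu>"
    and "preserves_measure f \<mu>"
    and "\<And>r::nat. r \<ge> 2 \<Longrightarrow> exp_mixing (riem_dist \<A> g) f \<mu> (r - 1)"
    and "\<tau> > 0"
  shows "((\<lambda>\<rho>::real. measure \<mu>
            {x. card {n::nat. 1 \<le> n \<and> real n \<le> \<tau> / \<rho> ^ CARD('n) \<and>
                              riem_dist \<A> g x ((f ^^ n) x) \<le> ennreal \<rho>} = l})
          \<longlongrightarrow> (\<integral>z. exp (- (ball_density \<A> g \<mu> z * \<tau>)) * (ball_density \<A> g \<mu> z * \<tau>) ^ l / fact l \<partial>\<mu>))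
         (at_right 0)"
proof -
  interpret riemannian \<A> g by unfold_locales (rule assms(1))
  obtain vol h where vol: "riemannian_volume \<A> g vol" and h: "smooth_fun \<A> h" "\<And>x. 0 < h x"
    and \<mu>: "\<mu> = density vol (\<lambda>x. ennreal (h x))"
    using assms(4) unfolding smooth_measure_def by blast
  have sets_\<mu>: "sets \<mu> = sets borel" using vol by (simp add: \<mu> riemannian_volume_def)
  have space_\<mu>: "space \<mu> = UNIV" using sets_eq_imp_space_eq[OF sets_\<mu>] by simp
  have "smooth_map \<A> f" using assms(3) by (simp add: smooth_diffeo_def)
  then obtain L where L: "1 \<le> L" "\<And>x y. bdist (f x) (f y) \<le> L * bdist x y"
    using smooth_map_lipschitz[OF assms(2)] by metis
  obtain B where B: "0 < B" "\<And>x \<rho>. 0 < \<rho> \<Longrightarrow> measure \<mu> {y. bdist x y < \<rho>} \<le> B * \<rho> ^ CARD('n)"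
    by (rule ball_measure_bound[OF assms(2) vol h \<mu> assms(5)]) blast
  have asymp: "((\<lambda>\<rho>. measure \<mu> {y. bdist x y < \<rho>} / \<rho> ^ CARD('n)) \<longlongrightarrow> ball_density \<A> g \<mu> x) (at_right 0)" for x
    by (rule Lim_transform_eventually[OF ball_measure_limit[OF vol h \<mu> assms(5)]])
      (auto simp: eventually_at_right_field bdist_less_iff intro!: exI[of _ 1])
  interpret mixing_returns \<mu> bdist f L B "CARD('n)" "ball_density \<A> g \<mu>"
  proof (rule mixing_returns.intro[OF assms(5)], unfold_locales)
    show "case_prod bdist \<in> borel_measurable (\<mu> \<Otimes>\<^sub>M \<mu>)"
      using bdist_measurable measurable_cong_sets[OF sets_pair_measure_cong[OF sets_\<mu> sets_\<mu>] refl] by blast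
    show "f \<in> \<mu> \<rightarrow>\<^sub>M \<mu>" using assms(6) by (simp add: preserves_measure_def)
    show "1 \<le> CARD('n)" by (simp add: Suc_leI)
    fix p :: nat assume p: "1 \<le> p"
    have "exp_mixing (riem_dist \<A> g) f \<mu> p" using assms(7)[of "Suc p"] p by simp
    then show "\<exists>C \<theta>. 0 < C \<and> 0 < \<theta> \<and> \<theta> < 1 \<and> mixes bdist f \<mu> p C \<theta>"
      by (rule exp_mixing_bdist[OF p])
  qed (fact space_\<mu> bdist_nonneg bdist_refl bdist_sym bdist_triangle L B asymp)+
  show ?thesis
  proof (rule Lim_transform_eventually[OF returns_mixed_poisson[OF assms(8), of l]])
    show "\<forall>\<^sub>F \<rho> in at_right 0.
        measure \<mu> {x. card {n \<in> {1..nat \<lfloor>\<tau> / \<rho> ^ CARD('n)\<rfloor>}. bdist x ((f ^^ n) x) \<le> \<rho>} = l}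
        = measure \<mu> {x. card {n::nat. 1 \<le> n \<and> real n \<le> \<tau> / \<rho> ^ CARD('n) \<and>
                              riem_dist \<A> g x ((f ^^ n) x) \<le> ennreal \<rho>} = l}"
      unfolding eventually_at_right_field
    proof (intro exI[of _ 1] conjI allI impI)
      fix \<rho> :: real assume \<rho>: "0 < \<rho>" "\<rho> < 1"
      have "0 \<le> \<tau> / \<rho> ^ CARD('n)" using \<rho> assms(8) by simp
      then have "n \<le> nat \<lfloor>\<tau> / \<rho> ^ CARD('n)\<rfloor> \<longleftrightarrow> real n \<le> \<tau> / \<rho> ^ CARD('n)" for n
        by (simp add: le_nat_iff le_floor_iff)
      then have "{n \<in> {1..nat \<lfloor>\<tau> / \<rho> ^ CARD('n)\<rfloor>}. bdist x ((f ^^ n) x) \<le> \<rho>}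
          = {n. 1 \<le> n \<and> real n \<le> \<tau> / \<rho> ^ CARD('n) \<and> riem_dist \<A> g x ((f ^^ n) x) \<le> ennreal \<rho>}" for x
        using bdist_le_iff[of \<rho>] \<rho> unfolding rdist_def by auto
      then show "measure \<mu> {x. card {n \<in> {1..nat \<lfloor>\<tau> / \<rho> ^ CARD('n)\<rfloor>}. bdist x ((f ^^ n) x) \<le> \<rho>} = l}
        = measure \<mu> {x. card {n::nat. 1 \<le> n \<and> real n \<le> \<tau> / \<rho> ^ CARD('n) \<and>
                              riem_dist \<A> g x ((f ^^ n) x) \<le> ennreal \<rho>} = l}" by simp
    qed simp
  qed
qed

end
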